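(* Let $m\ge n$, let $A\in\mathbb{C}^{m\times n}$, and suppose that for some $k>0$ $$A=(X_1\quad X_2)\begin{pmatrix}A_{11}&A_{12}\\ A_{21}&A_{22}\end{pmatrix}\begin{pmatrix}Y_1^{*}\\ Y_2^{*}\end{pmatrix},$$ where $X=(X_1\ X_2)\in\mathbb{C}^{m\times m}$ and $Y=(Y_1\ Y_2)\in\mathbb{C}^{n\times n}$ are unitary, $X_1$ and $Y_1$ each have $k$ columns, and $A_{11}$ is $k\times k$. Let $$\varepsilon_k=\left\|\begin{pmatrix}0&A_{12}\\ A_{21}&A_{22}\end{pmatrix}\right\|.$$ Assume $X_1$ and $Y_1$ are $\mu$-coherent. Let $\ell\ge10\mu k\log m$. Then with probability at least $1-4km^{-2}$, Algorithm 2 (described in the context) with input $A$ returns a skeleton $A_{:C'}ZA_{R':}$, with exactly $k$ rows and $k$ columns of $A$, that satisfies $$\|A-A_{:C'}ZA_{R':}\|=O\left(\varepsilon_k(mk)^{1/2}\right).$$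
   Context: $\|\cdot\|$ is the spectral norm ($2$-norm), $^{*}$ is conjugate transpose, $^{+}$ is the Moore-Penrose pseudoinverse, $\log$ is the natural logarithm, $\sigma_j(\cdot)$ is the $j$-th largest singular value. The constant implied by $O(\cdot)$ is absolute. Coherence: a matrix $X\in\mathbb{C}^{n\times k}$ with $k$ orthonormal columns is $\mu$-coherent if $\max_{ij}|X_{ij}|\le(\mu/n)^{1/2}$ (here $n$ is the number of rows of $X$). Restrictions: $A_{:C}$ is the restriction of $A$ to the columns indexed by $C$, and $A_{R:}$ the restriction to the rows indexed by $R$ (repeated indices, if any, give repeated rows or columns). RRQR means the strong rank-revealing QR factorization of Gu and Eisenstat: applied to a matrix $M$ with $q$ columns, it selects $k$ columns of $M$, forming a matrix $M'$, such that $\|M-M'M'^{+}M\|\le\sqrt{1+2k(q-k)}\,\sigma_{k+1}(M)$. Algorithm 2 (input $A\in\mathbb{C}^{m\times n}$): (1) Uniformly and independently select $\ell$ column indices $C$ to form $A_{:C}$. (2) Uniformly and independently select $\ell$ row indices $R$ to form $A_{R:}$. (3) Run RRQR on $A_{:C}$ to select $k$ of its columns and form $A_{:C'}$. (4) Run RRQR on the (conjugate) transpose of $A_{R:}$ to select $k$ rows of $A_{R:}$ and form $A_{R':}$. (5) Compute $Z=A_{:C'}^{+}AA_{R':}^{+}$. (6) Output $A_{:C'}ZA_{R':}$. The probability is over the random choice of $R$ and $C$.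
   Formalization: RRQR is required to satisfy, besides the quoted error bound, the Gu–Eisenstat stopping criterion (no single column exchange increases the volume by more than a factor √2, when σ_k>0); with repeated sampled indices the quoted bound alone would make the claim false. *)

theory Defs
  imports
    "HOL-Probability.Probability_Mass_Function"
    "Jordan_Normal_Form.Schur_Decomposition"
begin

text \<open>Matrices are those of the entry Jordan\_Normal\_Form, with rows and columns indexed from 0.
  Their dimensions are ordinary natural numbers, so that a constant can be chosen
  before the dimensions are.\<close>

definition vec_norm2 :: "complex Matrix.vec \<Rightarrow> real" where
  "vec_norm2 v = sqrt (\<Sum>i<dim_vec v. (cmod (vec_index v i))\<^sup>2)"

text \<open>The unit ball, rather than the unit sphere, keeps the supremum over a nonempty set
  for matrices without columns.\<close>

definition spectral_norm :: "complex mat \<Rightarrow> real" where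
  "spectral_norm M =
     Sup {vec_norm2 (M *\<^sub>v x) | x. x \<in> carrier_vec (dim_col M) \<and> vec_norm2 x \<le> 1}"

text \<open>Singular values: the square roots of the eigenvalues of \<open>M\<^sup>* M\<close>, counted with algebraic
  multiplicity, in decreasing order. The list has one entry per column of \<open>M\<close>, so it may
  contain more than the usual \<open>min\<close> (rows, columns) values; the additional ones are 0.\<close>

definition singular_values :: "complex mat \<Rightarrow> real list" where
  "singular_values M =
     rev (sorted_list_of_multiset
       (image_mset (\<lambda>z. sqrt (Re z)) (proots (char_poly (mat_adjoint M * M)))))"

definition sing_val :: "nat \<Rightarrow> complex mat \<Rightarrow> real" where
  "sing_val j M =
     (if 1 \<le> j \<and> j \<le> length (singular_values M) then singular_values M ! (j - 1) else 0)"

definition is_pinv :: "complex mat \<Rightarrow> complex mat \<Rightarrow> bool" where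
  "is_pinv M N \<longleftrightarrow>
     N \<in> carrier_mat (dim_col M) (dim_row M) \<and>
     M * N * M = M \<and> N * M * N = N \<and>
     mat_adjoint (M * N) = M * N \<and> mat_adjoint (N * M) = N * M"

definition pinv :: "complex mat \<Rightarrow> complex mat" where
  "pinv M = (THE N. is_pinv M N)"

definition unitary_mat :: "nat \<Rightarrow> complex mat \<Rightarrow> bool" where
  "unitary_mat n U \<longleftrightarrow>
     U \<in> carrier_mat n n \<and> mat_adjoint U * U = 1\<^sub>m n \<and> U * mat_adjoint U = 1\<^sub>m n"

definition hcat :: "complex mat \<Rightarrow> complex mat \<Rightarrow> complex mat" where
  "hcat M N = four_block_mat M N (0\<^sub>m 0 (dim_col M)) (0\<^sub>m 0 (dim_col N))"

definition coherent :: "real \<Rightarrow> complex mat \<Rightarrow> bool" where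
  "coherent \<mu> X \<longleftrightarrow>
     mat_adjoint X * X = 1\<^sub>m (dim_col X) \<and>
     (\<forall>i<dim_row X. \<forall>j<dim_col X. cmod (X $$ (i, j)) \<le> sqrt (\<mu> / real (dim_row X)))"

text \<open>Restrictions to a list of indices; repeated indices give repeated columns or rows.\<close>

definition cols_at :: "complex mat \<Rightarrow> nat list \<Rightarrow> complex mat" where
  "cols_at A C = mat (dim_row A) (length C) (\<lambda>(i, j). A $$ (i, C ! j))"

definition rows_at :: "complex mat \<Rightarrow> nat list \<Rightarrow> complex mat" where
  "rows_at A R = mat (length R) (dim_col A) (\<lambda>(i, j). A $$ (R ! i, j))"

text \<open>If \<open>M' = Q R\<^sub>1\<^sub>1\<close> is a QR factorization then \<open>gram_volume M'\<close> is the absolute value of the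
  determinant of \<open>R\<^sub>1\<^sub>1\<close>.\<close>

definition gram_volume :: "complex mat \<Rightarrow> real" where
  "gram_volume M = sqrt (Re (Determinant.det (mat_adjoint M * M)))"

text \<open>\<open>rrqr_selection k M J\<close>: the list \<open>J\<close> of \<open>k\<close> distinct column positions of \<open>M\<close> is a possible
  result of the strong RRQR factorization of Gu and Eisenstat with parameter \<open>f = sqrt 2\<close>.
  With \<open>M \<Pi> = Q (R\<^sub>1\<^sub>1 R\<^sub>1\<^sub>2; 0 R\<^sub>2\<^sub>2)\<close>, where the permutation \<open>\<Pi>\<close> puts the columns at \<open>J\<close> first, the
  algorithm exchanges a selected and an unselected column as long as the exchange increases
  the absolute value of the determinant of \<open>R\<^sub>1\<^sub>1\<close> by a factor of more than \<open>f\<close>. On termination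
  \<open>R\<^sub>1\<^sub>1\<close> is nonsingular and no such exchange remains. If \<open>M\<close> has rank less than \<open>k\<close>,
  there is no nonsingular \<open>R\<^sub>1\<^sub>1\<close>, and only the error bound, \<open>sqrt (1 + f\<^sup>2 k (q - k))\<close> times the
  (\<open>k+1\<close>)-st singular value, is required.

  The stopping criterion cannot be dropped. Repeating columns of a matrix many times
  enlarges both \<open>q\<close> and the singular values, and the error bound alone then
  admits selections that are useless for the matrix that the columns were drawn from.\<close>

definition rrqr_selection :: "nat \<Rightarrow> complex mat \<Rightarrow> nat list \<Rightarrow> bool" where
  "rrqr_selection k M J \<longleftrightarrow>
     length J = k \<and> distinct J \<and> set J \<subseteq> {..<dim_col M} \<and>
     spectral_norm (M - cols_at M J * pinv (cols_at M J) * M)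
       \<le> sqrt (1 + 2 * real k * real (dim_col M - k)) * sing_val (k + 1) M \<and>
     (0 < sing_val k M \<longrightarrow>
        0 < gram_volume (cols_at M J) \<and>
        (\<forall>i<k. \<forall>j<dim_col M. j \<notin> set J \<longrightarrow>
           gram_volume (cols_at M (J[i := j])) \<le> sqrt 2 * gram_volume (cols_at M J)))"

definition is_rrqr :: "(nat \<Rightarrow> complex mat \<Rightarrow> nat list) \<Rightarrow> bool" where
  "is_rrqr rrqr \<longleftrightarrow> (\<forall>k M. k \<le> dim_col M \<longrightarrow> rrqr_selection k M (rrqr k M))"

text \<open>Steps (3) to (6) for given samples \<open>C\<close> and \<open>R\<close>; the result is \<open>C'\<close>, \<open>Z\<close>, \<open>R'\<close>.\<close>

definition skeleton_algorithm ::
  "(nat \<Rightarrow> complex mat \<Rightarrow> nat list) \<Rightarrow> nat \<Rightarrow> complex mat \<Rightarrow> nat list \<Rightarrow> nat list \<Rightarrow>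
   nat list \<times> complex mat \<times> nat list" where
  "skeleton_algorithm rrqr k A C R =
     (let C' = map (\<lambda>j. C ! j) (rrqr k (cols_at A C));
          R' = map (\<lambda>i. R ! i) (rrqr k (mat_adjoint (rows_at A R)));
          Z = pinv (cols_at A C') * A * pinv (rows_at A R')
      in (C', Z, R'))"

definition sample_indices :: "nat \<Rightarrow> nat \<Rightarrow> nat list pmf" where
  "sample_indices l n = replicate_pmf l (pmf_of_set {..<n})"

end

theory Submission
  imports Defs "HOL-Analysis.L2_Norm"
begin

text \<open>
  Let \<open>M\<close> consist of the selected columns and let \<open>P = 1 - M M\<^sup>+\<close> be the projection onto the
  orthogonal complement of their span. The output of the algorithm is \<open>M M\<^sup>+ A N\<^sup>+ N\<close>, where \<open>N\<close> consists of the selected rows.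
  The error is at most \<open>\<parallel>P A\<parallel>\<close> plus the same quantity for the conjugate transpose of \<open>A\<close>
  (\<open>two_sided_residual\<close>), so it is enough to treat columns. The block decomposition gives
  \<open>A = B Y\<^sub>1\<^sup>* + D\<close> where \<open>D\<close> has norm at most \<open>\<epsilon>\<close> (\<open>leading_block_plus_small\<close>); in particular \<open>A\<close> is
  within \<open>\<epsilon>\<close> of a matrix of rank at most \<open>k\<close>. Write \<open>q\<close> for the number of columns of \<open>A\<close>.

  The first ingredient is deterministic. By the stopping criterion of the strong RRQR factorization
  the selection cannot gain more than a factor \<open>sqrt 2\<close> in volume by one exchange, and this forces
  every single sampled column to lie within \<open>sqrt (1 + 2 k) \<epsilon>\<close> of the span of the selected
  ones (\<open>locally_maximal_volume_residual\<close>). The bound is per column, so it does not deteriorate when the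
  sample contains a column many times.

  The second ingredient is probabilistic. Let \<open>C\<close> be the list of sampled column indices. If \<open>m \<ge> 3\<close> then with probability at least \<open>1 - k / m\<^sup>2\<close> the rows of \<open>Y\<^sub>1\<close> at the
  positions \<open>C\<close> see every vector \<open>g\<close>: the squares of the entries of \<open>Y\<^sub>1 g\<close> at these positions sum to at
  least \<open>l / (400 q)\<close> times the square of the norm of \<open>g\<close> (\<open>sampled_rows_well_conditioned\<close>).

  The two are combined by duality in \<open>column_selection_error\<close>. For a vector \<open>y\<close> put \<open>h = A\<^sup>* P y\<close> and
  \<open>g = Y\<^sub>1\<^sup>* h\<close>. Then \<open>h\<close> differs from \<open>Y\<^sub>1 g\<close> by at most \<open>\<epsilon> \<parallel>y\<parallel>\<close>, and the entries of \<open>h\<close> at sampled positions are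
  inner products of \<open>y\<close> with residuals of sampled columns, hence at most \<open>sqrt (1 + 2 k) \<epsilon> \<parallel>y\<parallel>\<close>. So
  \<open>Y\<^sub>1 g\<close> is small at all sampled positions, and the second ingredient makes \<open>g\<close>, and with it \<open>h\<close>, small:
  \<open>\<parallel>h\<parallel> = O (\<epsilon> sqrt (q k) \<parallel>y\<parallel>)\<close>.

  The second ingredient is a matrix Chernoff bound. The usual proof controls the trace of an
  exponential of a sum of random matrices by the Golden-Thompson inequality. Here the exponential
  is replaced by a product \<open>T\<close> of factors \<open>1 - c y y\<^sup>*\<close>, taken symmetrically around the middle, and
  the trace of a high power of \<open>T\<close> is controlled by the Lieb-Thirring inequality
  (\<open>tr_pow2_sandwich\<close>), which for exponents \<open>2\<^sup>s\<close> follows from the Cauchy-Schwarz inequality. One more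
  sample multiplies the expected trace by a fixed factor below 1. On the other hand a
  vector that the sample does not see is hardly moved by the factors (\<open>walk_displacement\<close>), which keeps
  the trace of the power large; Markov's inequality does the rest.
\<close>

text \<open>In what follows \<open>$\<close> selects an entry of a vector of variable dimension.\<close>

no_notation Finite_Cartesian_Product.vec_nth (infixl "$" 90)

section \<open>Conjugate transpose, inner product and norm\<close>

lemma mat_adjoint_dim [simp]: "dim_row (mat_adjoint A) = dim_col A" "dim_col (mat_adjoint A) = dim_row A"
  by (auto simp: mat_adjoint_def)

lemma mat_adjoint_carrier [simp]: "mat_adjoint A \<in> carrier_mat n m \<longleftrightarrow> A \<in> carrier_mat m n"
  by (metis carrier_matI carrier_matD mat_adjoint_dim)

lemma mat_adjoint_index [simp]:
  fixes A :: "complex mat"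
  shows "i < dim_col A \<Longrightarrow> j < dim_row A \<Longrightarrow> mat_adjoint A $$ (i, j) = cnj (A $$ (j, i))"
  by (simp add: mat_adjoint_def mat_of_rows_def cols_def)

lemma mat_adjoint_adjoint [simp]: "mat_adjoint (mat_adjoint A) = (A :: complex mat)"
  by (rule eq_matI) auto

lemma mult_index_sum:
  "i < dim_row A \<Longrightarrow> j < dim_col B \<Longrightarrow> dim_col A = dim_row B \<Longrightarrow>
    (A * B) $$ (i, j) = (\<Sum>t<dim_row B. A $$ (i, t) * B $$ (t, j))"
  by (simp add: scalar_prod_def atLeast0LessThan)

lemma mult_vec_index_sum:
  "i < dim_row A \<Longrightarrow> dim_col A = dim_vec v \<Longrightarrow>
    (A *\<^sub>v v) $ i = (\<Sum>t<dim_vec v. A $$ (i, t) * v $ t)"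
  by (simp add: scalar_prod_def atLeast0LessThan)

lemma mat_adjoint_mult:
  fixes A B :: "complex mat"
  assumes "dim_col A = dim_row B"
  shows "mat_adjoint (A * B) = mat_adjoint B * mat_adjoint A"
  by (rule eq_matI) (use assms in \<open>auto simp: mult_index_sum mult.commute simp del: index_mult_mat(1)\<close>)

lemma mat_adjoint_add:
  fixes A B :: "complex mat"
  assumes "A \<in> carrier_mat n m" "B \<in> carrier_mat n m"
  shows "mat_adjoint (A + B) = mat_adjoint A + mat_adjoint B"
  by (rule eq_matI) (use assms in auto)

lemma mat_adjoint_minus:
  fixes A B :: "complex mat"
  assumes "A \<in> carrier_mat n m" "B \<in> carrier_mat n m"
  shows "mat_adjoint (A - B) = mat_adjoint A - mat_adjoint B"
  by (rule eq_matI) (use assms in auto)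

lemma mat_adjoint_one [simp]: "mat_adjoint (1\<^sub>m n) = (1\<^sub>m n :: complex mat)"
  by (rule eq_matI) auto

definition ip :: "complex Matrix.vec \<Rightarrow> complex Matrix.vec \<Rightarrow> complex" where
  "ip v w = (\<Sum>i<dim_vec v. v $ i * cnj (w $ i))"

lemma ip_minus_left: "v \<in> carrier_vec n \<Longrightarrow> w \<in> carrier_vec n \<Longrightarrow> ip (v - w) x = ip v x - ip w x"
  by (auto simp: ip_def algebra_simps sum_subtractf)

lemma ip_minus_right: "v \<in> carrier_vec n \<Longrightarrow> w \<in> carrier_vec n \<Longrightarrow> x \<in> carrier_vec n \<Longrightarrow>
    ip x (v - w) = ip x v - ip x w"
  by (auto simp: ip_def algebra_simps sum_subtractf)

lemma ip_smult_left: "ip (a \<cdot>\<^sub>v v) x = a * ip v x"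
  by (auto simp: ip_def algebra_simps sum_distrib_left)

lemma ip_sym: "dim_vec v = dim_vec w \<Longrightarrow> ip v w = cnj (ip w v)"
  by (auto simp: ip_def algebra_simps)

lemma vec_norm2_L2: "vec_norm2 v = L2_set (\<lambda>i. cmod (v $ i)) {..<dim_vec v}"
  by (simp add: vec_norm2_def L2_set_def)

lemma vec_norm2_nonneg [simp]: "0 \<le> vec_norm2 v"
  by (simp add: vec_norm2_L2)

lemma vec_norm2_sq: "(vec_norm2 v)\<^sup>2 = (\<Sum>i<dim_vec v. (cmod (v $ i))\<^sup>2)"
  by (simp add: vec_norm2_def sum_nonneg)

lemma ip_self: "ip v v = of_real ((vec_norm2 v)\<^sup>2)"
  by (simp add: vec_norm2_sq ip_def complex_norm_square del: of_real_power)

lemma ip_Cauchy_Schwarz: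
  assumes "dim_vec v = dim_vec w"
  shows "cmod (ip v w) \<le> vec_norm2 v * vec_norm2 w"
proof -
  have "cmod (ip v w) \<le> (\<Sum>i<dim_vec v. \<bar>cmod (v $ i)\<bar> * \<bar>cmod (w $ i)\<bar>)"
    unfolding ip_def by (rule order_trans[OF norm_sum]) (simp add: norm_mult)
  also have "\<dots> \<le> vec_norm2 v * vec_norm2 w"
    unfolding vec_norm2_L2 assms[symmetric] by (rule L2_set_mult_ineq)
  finally show ?thesis .
qed

lemma vec_norm2_triangle:
  assumes "v \<in> carrier_vec n" "w \<in> carrier_vec n"
  shows "vec_norm2 (v + w) \<le> vec_norm2 v + vec_norm2 w"
proof -
  have "vec_norm2 (v + w) \<le> L2_set (\<lambda>i. cmod (v $ i) + cmod (w $ i)) {..<n}"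
    unfolding vec_norm2_L2 using assms by (auto intro!: L2_set_mono norm_triangle_ineq)
  also have "\<dots> \<le> vec_norm2 v + vec_norm2 w"
    unfolding vec_norm2_L2 using assms L2_set_triangle_ineq[of "\<lambda>i. cmod (v $ i)" "\<lambda>i. cmod (w $ i)" "{..<n}"] by auto
  finally show ?thesis .
qed

lemma vec_norm2_smult: "vec_norm2 (a \<cdot>\<^sub>v v) = cmod a * vec_norm2 v"
  by (simp add: vec_norm2_def norm_mult power_mult_distrib real_sqrt_mult flip: sum_distrib_left)

lemma vec_norm2_zero [simp]: "vec_norm2 (0\<^sub>v n) = 0"
  by (simp add: vec_norm2_def)

lemma vec_norm2_eq_0: "v \<in> carrier_vec n \<Longrightarrow> vec_norm2 v = 0 \<longleftrightarrow> v = 0\<^sub>v n"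
  by (auto simp: vec_norm2_L2 L2_set_eq_0_iff)

lemma vec_norm2_minus_commute:
  "v \<in> carrier_vec n \<Longrightarrow> w \<in> carrier_vec n \<Longrightarrow> vec_norm2 (v - w) = vec_norm2 (w - v)"
  unfolding vec_norm2_L2 by (rule L2_set_cong) (auto simp: norm_minus_commute)

lemma norm_entry_le: "i < dim_vec v \<Longrightarrow> cmod (v $ i) \<le> vec_norm2 v"
  unfolding vec_norm2_L2 by (rule member_le_L2_set) auto

lemma ip_adjoint:
  assumes "A \<in> carrier_mat n m" "x \<in> carrier_vec m" "y \<in> carrier_vec n"
  shows "ip (A *\<^sub>v x) y = ip x (mat_adjoint A *\<^sub>v y)"
proof -
  have "ip (A *\<^sub>v x) y = (\<Sum>i<n. \<Sum>j<m. A $$ (i, j) * x $ j * cnj (y $ i))"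
    unfolding ip_def using assms
    by (auto simp: mult_vec_index_sum sum_distrib_right simp del: index_mult_mat_vec)
  also have "\<dots> = (\<Sum>j<m. \<Sum>i<n. A $$ (i, j) * x $ j * cnj (y $ i))"
    by (rule sum.swap)
  also have "\<dots> = ip x (mat_adjoint A *\<^sub>v y)"
    unfolding ip_def using assms
    by (auto simp: mult_vec_index_sum sum_distrib_left mult_ac simp del: index_mult_mat_vec intro!: sum.cong)
  finally show ?thesis .
qed

text \<open>A bound on a matrix as an operator, in the form in which bounds compose. Unlike an inequality for
  \<open>spectral_norm\<close> it can be read off and applied without reference to a supremum.\<close>

definition op_le :: "complex mat \<Rightarrow> real \<Rightarrow> bool" where
  "op_le M b \<longleftrightarrow> (\<forall>x \<in> carrier_vec (dim_col M). vec_norm2 (M *\<^sub>v x) \<le> b * vec_norm2 x)"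

lemma op_leD: "op_le M b \<Longrightarrow> x \<in> carrier_vec (dim_col M) \<Longrightarrow> vec_norm2 (M *\<^sub>v x) \<le> b * vec_norm2 x"
  by (simp add: op_le_def)

definition frob_sq :: "complex mat \<Rightarrow> real" where
  "frob_sq M = (\<Sum>i<dim_row M. \<Sum>j<dim_col M. (cmod (M $$ (i, j)))\<^sup>2)"

lemma frob_sq_nonneg: "0 \<le> frob_sq A"
  by (auto simp: frob_sq_def intro!: sum_nonneg)

text \<open>Each entry of \<open>M g\<close> is an inner product with a row of \<open>M\<close>. This makes the supremum in
  the spectral norm a finite one, and it bounds the square of the norm of \<open>M g\<close> by a trace.\<close>

lemma frob_sq_mult_vec:
  assumes g: "g \<in> carrier_vec (dim_col M)"
  shows "(vec_norm2 (M *\<^sub>v g))\<^sup>2 \<le> frob_sq M * (vec_norm2 g)\<^sup>2"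
proof -
  have "(cmod ((M *\<^sub>v g) $ i))\<^sup>2 \<le> (\<Sum>j<dim_col M. (cmod (M $$ (i, j)))\<^sup>2) * (vec_norm2 g)\<^sup>2"
    if i: "i < dim_row M" for i
  proof -
    define r where "r = vec (dim_col M) (\<lambda>j. cnj (M $$ (i, j)))"
    have "(M *\<^sub>v g) $ i = ip g r"
      unfolding ip_def r_def using g i
      by (auto simp: mult_vec_index_sum mult.commute simp del: index_mult_mat_vec)
    then have "cmod ((M *\<^sub>v g) $ i) \<le> vec_norm2 g * vec_norm2 r"
      using ip_Cauchy_Schwarz[of g r] g by (simp add: r_def)
    then have "(cmod ((M *\<^sub>v g) $ i))\<^sup>2 \<le> (vec_norm2 g * vec_norm2 r)\<^sup>2" by (intro power_mono) auto
    also have "(vec_norm2 r)\<^sup>2 = (\<Sum>j<dim_col M. (cmod (M $$ (i, j)))\<^sup>2)" by (simp add: vec_norm2_sq r_def)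
    then have "(vec_norm2 g * vec_norm2 r)\<^sup>2 = (\<Sum>j<dim_col M. (cmod (M $$ (i, j)))\<^sup>2) * (vec_norm2 g)\<^sup>2"
      by (simp add: power_mult_distrib)
    finally show ?thesis .
  qed
  then show ?thesis unfolding vec_norm2_sq[of "M *\<^sub>v g"] frob_sq_def sum_distrib_right
    by (auto intro!: sum_mono)
qed

lemma op_le_exists: "\<exists>b\<ge>0. op_le M b"
proof (intro exI conjI)
  show "0 \<le> sqrt (frob_sq M)" by (simp add: frob_sq_nonneg)
  show "op_le M (sqrt (frob_sq M))" unfolding op_le_def
  proof
    fix x :: "complex Matrix.vec" assume "x \<in> carrier_vec (dim_col M)"
    then have "(vec_norm2 (M *\<^sub>v x))\<^sup>2 \<le> (sqrt (frob_sq M) * vec_norm2 x)\<^sup>2"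
      using frob_sq_mult_vec[of x M] by (simp add: power_mult_distrib frob_sq_nonneg)
    then show "vec_norm2 (M *\<^sub>v x) \<le> sqrt (frob_sq M) * vec_norm2 x"
      by (rule power2_le_imp_le) (simp add: frob_sq_nonneg)
  qed
qed

lemma op_le_spectral_norm: "op_le M (spectral_norm M)"
proof -
  let ?S = "{vec_norm2 (M *\<^sub>v x) | x. x \<in> carrier_vec (dim_col M) \<and> vec_norm2 x \<le> 1}"
  obtain b where b: "b \<ge> 0" "op_le M b" using op_le_exists by blast
  have bdd: "bdd_above ?S"
  proof (rule bdd_aboveI[of _ b], safe)
    fix x assume "x \<in> carrier_vec (dim_col M)" "vec_norm2 x \<le> 1"
    then show "vec_norm2 (M *\<^sub>v x) \<le> b"
      using op_leD[OF b(2), of x] mult_left_mono[of "vec_norm2 x" 1 b] b(1) by simp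
  qed
  show ?thesis unfolding op_le_def
  proof
    fix x :: "complex Matrix.vec" assume x: "x \<in> carrier_vec (dim_col M)"
    show "vec_norm2 (M *\<^sub>v x) \<le> spectral_norm M * vec_norm2 x"
    proof (cases "vec_norm2 x = 0")
      case True
      then show ?thesis using op_leD[OF b(2) x] by simp
    next
      case False
      then have pos: "vec_norm2 x > 0" using vec_norm2_nonneg[of x] by linarith
      define u where "u = complex_of_real (1 / vec_norm2 x) \<cdot>\<^sub>v x"
      have "vec_norm2 u \<le> 1" "u \<in> carrier_vec (dim_col M)"
        using x pos by (auto simp: u_def vec_norm2_smult norm_divide)
      then have "vec_norm2 (M *\<^sub>v u) \<le> spectral_norm M"
        unfolding spectral_norm_def by (intro cSup_upper bdd) blast
      moreover have "vec_norm2 (M *\<^sub>v u) = vec_norm2 (M *\<^sub>v x) / vec_norm2 x"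
        using x pos by (simp add: u_def mult_mat_vec[of M "dim_row M" "dim_col M"] vec_norm2_smult norm_divide)
      ultimately show ?thesis using pos by (simp add: field_simps)
    qed
  qed
qed

lemma spectral_norm_nonneg: "0 \<le> spectral_norm M"
proof (cases "\<exists>x\<in>carrier_vec (dim_col M). vec_norm2 x \<noteq> 0")
  case True
  then obtain x where x: "x \<in> carrier_vec (dim_col M)" "vec_norm2 x \<noteq> 0" by blast
  then have "0 \<le> spectral_norm M * vec_norm2 x"
    using op_leD[OF op_le_spectral_norm x(1)] vec_norm2_nonneg order_trans by blast
  then show ?thesis using x(2) vec_norm2_nonneg[of x] by (simp add: zero_le_mult_iff)
next
  case False
  obtain b where b: "b \<ge> 0" "op_le M b" using op_le_exists by blast
  have "{vec_norm2 (M *\<^sub>v x) | x. x \<in> carrier_vec (dim_col M) \<and> vec_norm2 x \<le> 1} = {0}"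
  proof -
    have "vec_norm2 (M *\<^sub>v x) = 0" if "x \<in> carrier_vec (dim_col M)" for x
      using op_leD[OF b(2) that] False that vec_norm2_nonneg[of "M *\<^sub>v x"] by (simp add: order_antisym)
    moreover have "0\<^sub>v (dim_col M) \<in> carrier_vec (dim_col M) \<and> vec_norm2 (0\<^sub>v (dim_col M)) \<le> 1" by simp
    ultimately show ?thesis by (auto intro!: exI[of _ "0\<^sub>v (dim_col M)"] simp del: vec_norm2_zero)
  qed
  then show ?thesis unfolding spectral_norm_def by simp
qed

lemma spectral_norm_le: 
  assumes "op_le M b" "b \<ge> 0"
  shows "spectral_norm M \<le> b"
  unfolding spectral_norm_def
proof (rule cSup_least)
  have "0\<^sub>v (dim_col M) \<in> carrier_vec (dim_col M) \<and> vec_norm2 (0\<^sub>v (dim_col M)) \<le> 1" by simp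
  then show "{vec_norm2 (M *\<^sub>v x) | x. x \<in> carrier_vec (dim_col M) \<and> vec_norm2 x \<le> 1} \<noteq> {}" by blast
next
  fix r assume "r \<in> {vec_norm2 (M *\<^sub>v x) | x. x \<in> carrier_vec (dim_col M) \<and> vec_norm2 x \<le> 1}"
  then obtain x where x: "r = vec_norm2 (M *\<^sub>v x)" "x \<in> carrier_vec (dim_col M)" "vec_norm2 x \<le> 1" by blast
  then show "r \<le> b"
    using op_leD[OF assms(1) x(2)] mult_left_mono[of "vec_norm2 x" 1 b] assms(2) by simp
qed

text \<open>For \<open>z = M\<^sup>* y\<close> the square of the norm of \<open>z\<close> is the inner product of \<open>M z\<close> and \<open>y\<close>, to which the
  Cauchy-Schwarz inequality applies; one factor \<open>\<parallel>z\<parallel>\<close> cancels.\<close>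

lemma op_le_adjoint:
  assumes "op_le M b" "b \<ge> 0"
  shows "op_le (mat_adjoint M) b"
  unfolding op_le_def
proof
  fix y :: "complex Matrix.vec" assume y: "y \<in> carrier_vec (dim_col (mat_adjoint M))"
  let ?z = "mat_adjoint M *\<^sub>v y"
  have M: "M \<in> carrier_mat (dim_row M) (dim_col M)" by simp
  have y': "y \<in> carrier_vec (dim_row M)" using y by simp
  have z: "?z \<in> carrier_vec (dim_col M)" by (rule carrier_vecI) simp
  have "(vec_norm2 ?z)\<^sup>2 = cmod (ip ?z ?z)" by (simp add: ip_self norm_power)
  also have "ip ?z ?z = ip (M *\<^sub>v ?z) y" using ip_adjoint[OF M z y'] by simp
  also have "cmod \<dots> \<le> vec_norm2 (M *\<^sub>v ?z) * vec_norm2 y"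
    by (rule ip_Cauchy_Schwarz) (use y' in auto)
  also have "\<dots> \<le> b * vec_norm2 ?z * vec_norm2 y"
    by (intro mult_right_mono op_leD[OF assms(1)] z) auto
  finally have *: "vec_norm2 ?z * vec_norm2 ?z \<le> (b * vec_norm2 y) * vec_norm2 ?z"
    by (simp add: power2_eq_square mult_ac)
  show "vec_norm2 ?z \<le> b * vec_norm2 y"
  proof (cases "vec_norm2 ?z = 0")
    case True
    then show ?thesis using assms(2) by simp
  next
    case False
    then show ?thesis using * vec_norm2_nonneg[of ?z] by (simp add: mult_le_cancel_right)
  qed
qed

lemma hermitian_idempotent_contraction:
  assumes E: "E \<in> carrier_mat n n" "mat_adjoint E = E" "E * E = E"
  shows "op_le E 1"
  unfolding op_le_def
proof
  fix x :: "complex Matrix.vec" assume "x \<in> carrier_vec (dim_col E)"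
  then have x: "x \<in> carrier_vec n" using E by auto
  have Ex: "E *\<^sub>v x \<in> carrier_vec n" using E x by simp
  have "ip (E *\<^sub>v x) (E *\<^sub>v x) = ip x (E *\<^sub>v (E *\<^sub>v x))"
    using ip_adjoint[OF E(1) x Ex] E(2) by simp
  also have "E *\<^sub>v (E *\<^sub>v x) = E *\<^sub>v x" using E(1,3) x by (simp flip: assoc_mult_mat_vec)
  finally have "(vec_norm2 (E *\<^sub>v x))\<^sup>2 \<le> vec_norm2 x * vec_norm2 (E *\<^sub>v x)"
    using ip_Cauchy_Schwarz[of x "E *\<^sub>v x"] x Ex
    by (metis carrier_vecD ip_self norm_of_real abs_of_nonneg zero_le_power2)
  then show "vec_norm2 (E *\<^sub>v x) \<le> 1 * vec_norm2 x"
    using vec_norm2_nonneg[of "E *\<^sub>v x"] vec_norm2_nonneg[of x]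
    by (cases "vec_norm2 (E *\<^sub>v x) = 0") (auto simp: power2_eq_square mult_le_cancel_right)
qed

lemma isometry_norm:
  assumes Y: "Y \<in> carrier_mat n k" "mat_adjoint Y * Y = 1\<^sub>m k" and x: "x \<in> carrier_vec k"
  shows "vec_norm2 (Y *\<^sub>v x) = vec_norm2 x"
proof -
  have "ip (Y *\<^sub>v x) (Y *\<^sub>v x) = ip x (mat_adjoint Y *\<^sub>v (Y *\<^sub>v x))"
    by (rule ip_adjoint) (use Y x in auto)
  also have "mat_adjoint Y *\<^sub>v (Y *\<^sub>v x) = x"
    using Y x by (simp add: assoc_mult_mat_vec[symmetric, of _ k n _ k])
  finally have "(vec_norm2 (Y *\<^sub>v x))\<^sup>2 = (vec_norm2 x)\<^sup>2" by (simp add: ip_self flip: of_real_power)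
  then show ?thesis by (simp add: power2_eq_iff_nonneg)
qed

lemma isometry_op_le:
  assumes "Y \<in> carrier_mat n k" "mat_adjoint Y * Y = 1\<^sub>m k"
  shows "op_le Y 1" "op_le (mat_adjoint Y) 1"
proof -
  show "op_le Y 1" unfolding op_le_def using isometry_norm[OF assms] assms(1) by auto
  then show "op_le (mat_adjoint Y) 1" by (rule op_le_adjoint) simp
qed

lemma op_le_mult:
  assumes "op_le A a" "op_le B b" "a \<ge> 0" "dim_col A = dim_row B"
  shows "op_le (A * B) (a * b)"
  unfolding op_le_def
proof
  fix x :: "complex Matrix.vec" assume "x \<in> carrier_vec (dim_col (A * B))"
  then have x: "x \<in> carrier_vec (dim_col B)" by simp
  have Bx: "B *\<^sub>v x \<in> carrier_vec (dim_col A)" using assms(4) by (intro carrier_vecI) simp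
  have "(A * B) *\<^sub>v x = A *\<^sub>v (B *\<^sub>v x)"
    using x assms(4) by (intro assoc_mult_mat_vec[of _ "dim_row A" "dim_col A" _ "dim_col B"]) auto
  then have "vec_norm2 ((A * B) *\<^sub>v x) \<le> a * vec_norm2 (B *\<^sub>v x)"
    using op_leD[OF assms(1) Bx] by simp
  also have "\<dots> \<le> a * (b * vec_norm2 x)"
    by (intro mult_left_mono op_leD[OF assms(2) x] assms)
  finally show "vec_norm2 ((A * B) *\<^sub>v x) \<le> a * b * vec_norm2 x" by (simp add: mult_ac)
qed

lemma op_le_add:
  assumes "op_le A a" "op_le B b" "A \<in> carrier_mat n m" "B \<in> carrier_mat n m"
  shows "op_le (A + B) (a + b)"
  unfolding op_le_def
proof
  fix x :: "complex Matrix.vec" assume "x \<in> carrier_vec (dim_col (A + B))"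
  then have x: "x \<in> carrier_vec m" using assms by simp
  have "vec_norm2 ((A + B) *\<^sub>v x) \<le> vec_norm2 (A *\<^sub>v x) + vec_norm2 (B *\<^sub>v x)"
    using assms x vec_norm2_triangle[of "A *\<^sub>v x" n "B *\<^sub>v x"]
    by (simp add: add_mult_distrib_mat_vec[of _ n m])
  also have "\<dots> \<le> (a + b) * vec_norm2 x"
    using op_leD[OF assms(1), of x] op_leD[OF assms(2), of x] assms x by (simp add: algebra_simps)
  finally show "vec_norm2 ((A + B) *\<^sub>v x) \<le> (a + b) * vec_norm2 x" .
qed

definition outer :: "complex Matrix.vec \<Rightarrow> complex Matrix.vec \<Rightarrow> complex mat" where
  "outer u w = mat (dim_vec u) (dim_vec w) (\<lambda>(i, j). u $ i * cnj (w $ j))"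

lemma outer_carrier [simp]: "u \<in> carrier_vec n \<Longrightarrow> w \<in> carrier_vec m \<Longrightarrow> outer u w \<in> carrier_mat n m"
  by (auto simp: outer_def)

lemma outer_dim [simp]: "dim_row (outer u w) = dim_vec u" "dim_col (outer u w) = dim_vec w"
  by (auto simp: outer_def)

lemma outer_mult_vec: "dim_vec x = dim_vec w \<Longrightarrow> outer u w *\<^sub>v x = ip x w \<cdot>\<^sub>v u"
  by (rule eq_vecI) (auto simp: mult_vec_index_sum outer_def ip_def sum_distrib_left mult_ac
      simp del: index_mult_mat_vec)

lemma mult_outer: "dim_col A = dim_vec u \<Longrightarrow> A * outer u w = outer (A *\<^sub>v u) w"
  by (rule eq_matI) (auto simp: mult_vec_index_sum mult_index_sum outer_def sum_distrib_left mult_ac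
      simp del: index_mult_mat_vec index_mult_mat(1))

lemma outer_mult: "dim_row A = dim_vec w \<Longrightarrow> outer u w * A = outer u (mat_adjoint A *\<^sub>v w)"
  by (rule eq_matI) (auto simp: mult_vec_index_sum mult_index_sum outer_def sum_distrib_left mult_ac
      simp del: index_mult_mat_vec index_mult_mat(1))

lemma adjoint_outer [simp]: "mat_adjoint (outer u w) = outer w u"
  by (rule eq_matI) (auto simp: outer_def)

lemma outer_zero [simp]: "outer (0\<^sub>v n) w = 0\<^sub>m n (dim_vec w)" "outer u (0\<^sub>v n) = 0\<^sub>m (dim_vec u) n"
  by (auto simp: outer_def)

lemma outer_smult_left: "outer (a \<cdot>\<^sub>v u) w = a \<cdot>\<^sub>m outer u w"
  by (rule eq_matI) (auto simp: outer_def)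

lemma outer_smult_right: "outer u (a \<cdot>\<^sub>v w) = cnj a \<cdot>\<^sub>m outer u w"
  by (rule eq_matI) (auto simp: outer_def)

lemma mat_adjoint_smult: "mat_adjoint (a \<cdot>\<^sub>m M) = cnj a \<cdot>\<^sub>m mat_adjoint M"
  by (rule eq_matI) auto

lemma zero_mat_mult_vec: "x \<in> carrier_vec m \<Longrightarrow> 0\<^sub>m n m *\<^sub>v x = (0\<^sub>v n :: complex Matrix.vec)"
  by (rule eq_vecI) auto

lemma mat_adjoint_zero: "mat_adjoint (0\<^sub>m n m) = (0\<^sub>m m n :: complex mat)"
  by (rule eq_matI) auto

section \<open>Moore-Penrose pseudoinverse\<close>

text \<open>Gram-Schmidt orthogonalization, one column at a time: if \<open>E = M G\<close> projects onto the first \<open>j\<close> columns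
  and \<open>c\<close> is the component of the next column orthogonal to them, then \<open>E + c c\<^sup>* / \<parallel>c\<parallel>\<^sup>2\<close> projects
  onto \<open>j + 1\<close> columns. Since \<open>c\<close> is in the range of \<open>M\<close>, the new projection has again the form
  \<open>M G'\<close>.\<close>

lemma projection_onto_columns:
  fixes M :: "complex mat"
  assumes M: "M \<in> carrier_mat p n" and "j \<le> n"
  shows "\<exists>G \<in> carrier_mat n p. mat_adjoint (M * G) = M * G \<and> (M * G) * (M * G) = M * G \<and>
    (\<forall>i<j. (M * G) *\<^sub>v col M i = col M i)"
  using assms(2)
proof (induction j)
  case 0
  show ?case using M
    by (intro bexI[of _ "0\<^sub>m n p"]) (auto simp: mat_adjoint_zero)
next
  case (Suc j)
  then obtain G where G: "G \<in> carrier_mat n p" and herm: "mat_adjoint (M * G) = M * G"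
    and idem: "(M * G) * (M * G) = M * G" and fix_col: "\<And>i. i < j \<Longrightarrow> (M * G) *\<^sub>v col M i = col M i"
    by auto
  define E where "E = M * G"
  have E: "E \<in> carrier_mat p p" using M G by (simp add: E_def)
  define a where "a = col M j"
  have a: "a \<in> carrier_vec p" unfolding a_def using M by (intro carrier_vecI) simp
  have ej: "unit_vec n j \<in> carrier_vec n" by simp
  have Me: "M *\<^sub>v unit_vec n j = a"
    using M Suc.prems by (auto simp: a_def intro!: eq_vecI)
  define c where "c = a - E *\<^sub>v a"
  have c: "c \<in> carrier_vec p" using a E by (simp add: c_def)
  \<comment> \<open>If the new column depends on the earlier ones then \<open>c = 0\<close>, hence \<open>w = 0\<close>, and nothing is added.\<close>
  define w where "w = complex_of_real (1 / (vec_norm2 c)\<^sup>2) \<cdot>\<^sub>v c"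
  have w: "w \<in> carrier_vec p" using c by (simp add: w_def)
  have Ec: "E *\<^sub>v c = 0\<^sub>v p"
  proof -
    have "E *\<^sub>v c = E *\<^sub>v a - (E * E) *\<^sub>v a"
      unfolding c_def using E a by (simp add: mult_minus_distrib_mat_vec[of _ p p] assoc_mult_mat_vec[of _ p p _ p])
    then show ?thesis using idem E a unfolding E_def[symmetric] by simp
  qed
  have Ew: "E *\<^sub>v w = 0\<^sub>v p"
    unfolding w_def mult_mat_vec[OF E c] Ec by (rule eq_vecI) auto
  have cw: "c = 0\<^sub>v p \<or> ip c w = 1"
  proof (cases "vec_norm2 c = 0")
    case False
    then have "ip c w = 1"
      using ip_self[of c] c by (simp add: w_def ip_def mult.assoc[symmetric] field_simps flip: sum_divide_distrib)
    then show ?thesis ..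
  qed (use vec_norm2_eq_0[OF c] in auto)
  define F where "F = outer c w"
  have F: "F \<in> carrier_mat p p" using c w by (simp add: F_def)
  define u where "u = unit_vec n j - G *\<^sub>v a"
  have u: "u \<in> carrier_vec n" using G a by (simp add: u_def)
  define G' where "G' = G + outer u w"
  have G': "G' \<in> carrier_mat n p" using G u w by (simp add: G'_def)
  have Mu: "M *\<^sub>v u = c"
    unfolding u_def c_def E_def using M G a Me
    by (simp add: mult_minus_distrib_mat_vec[of _ p n] assoc_mult_mat_vec[of _ p n _ p])
  have MG': "M * G' = E + F"
    unfolding G'_def F_def E_def using M G u w Mu
    by (simp add: mult_add_distrib_mat[of _ p n] mult_outer)
  have hermF: "mat_adjoint F = F"
    by (simp add: F_def w_def outer_smult_left outer_smult_right mat_adjoint_smult)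
  have FE: "F * E = 0\<^sub>m p p" unfolding F_def using E w herm Ew c
    by (simp add: outer_mult E_def[symmetric])
  have EF: "E * F = 0\<^sub>m p p" unfolding F_def using E c Ec w by (simp add: mult_outer)
  have Fc: "F *\<^sub>v c = c" using cw c w by (auto simp: F_def outer_mult_vec)
  have FF: "F * F = F" unfolding F_def using Fc c w by (simp add: mult_outer F_def)
  have "mat_adjoint (E + F) = E + F" using mat_adjoint_add[OF E F] herm hermF by (simp add: E_def)
  moreover have "(E + F) * (E + F) = E + F"
  proof -
    have "(E + F) * (E + F) = E * E + F * E + (E * F + F * F)"
      using E F by (simp add: mult_add_distrib_mat[of _ p p] add_mult_distrib_mat[of _ p p])
    also have "\<dots> = E + F" using E F FE EF FF idem by (simp add: E_def[symmetric])
    finally show ?thesis .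
  qed
  moreover have "(E + F) *\<^sub>v col M i = col M i" if "i < Suc j" for i
  proof (cases "i = j")
    case True
    have split: "a = E *\<^sub>v a + c" using a E by (auto simp: c_def)
    have "F *\<^sub>v a = F *\<^sub>v (E *\<^sub>v a + c)" using split by simp
    also have "\<dots> = (F * E) *\<^sub>v a + F *\<^sub>v c"
      using E F a c by (simp add: mult_add_distrib_mat_vec[of _ p p] assoc_mult_mat_vec[of _ p p _ p])
    also have "\<dots> = c" using Fc FE a c by (simp add: zero_mat_mult_vec)
    finally have "(E + F) *\<^sub>v a = E *\<^sub>v a + c" using E F a by (simp add: add_mult_distrib_mat_vec[of _ p p])
    also have "\<dots> = a" using split by simp
    finally show ?thesis using True by (simp add: a_def)
  next
    case False
    then have i: "i < j" using that by simp
    have ci: "col M i \<in> carrier_vec p" using M by (intro carrier_vecI) simp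
    have "F *\<^sub>v col M i = F *\<^sub>v (E *\<^sub>v col M i)" using fix_col[OF i] by (simp add: E_def)
    also have "\<dots> = (F * E) *\<^sub>v col M i" using E F ci by (simp add: assoc_mult_mat_vec[of _ p p _ p])
    also have "\<dots> = 0\<^sub>v p" using FE ci by (simp add: zero_mat_mult_vec)
    finally show ?thesis using fix_col[OF i] E F ci
      by (simp add: E_def[symmetric] add_mult_distrib_mat_vec[of _ p p])
  qed
  ultimately show ?case using G' by (intro bexI[of _ G']) (auto simp: MG')
qed

lemma least_squares_inverse_exists:
  assumes M: "M \<in> carrier_mat p n"
  shows "\<exists>G \<in> carrier_mat n p. mat_adjoint (M * G) = M * G \<and> M * G * M = (M :: complex mat)"
proof -
  obtain G where G: "G \<in> carrier_mat n p" "mat_adjoint (M * G) = M * G" 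
    "\<And>i. i < n \<Longrightarrow> (M * G) *\<^sub>v col M i = col M i"
    using projection_onto_columns[OF M order_refl] by auto
  have "M * G * M = M"
  proof (rule mat_col_eqI)
    fix i assume "i < dim_col M"
    then show "col (M * G * M) i = col M i"
      using G M col_mult2[of "M * G" p p M n i] by simp
  qed (use M G in auto)
  then show ?thesis using G by blast
qed

text \<open>If \<open>M G\<close> is the orthogonal projection onto the range of \<open>M\<close> and \<open>H M\<close> the one onto the range of \<open>M\<^sup>*\<close>,
  then \<open>H M G\<close> is the pseudoinverse. Such an \<open>H\<close> comes from the adjoint of a \<open>G\<close> for \<open>M\<^sup>*\<close>.\<close>

lemma is_pinv_exists: "\<exists>N. is_pinv M N"
proof -
  define p n where "p = dim_row M" and "n = dim_col M"
  have M: "M \<in> carrier_mat p n" by (simp add: p_def n_def)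
  obtain G where G: "G \<in> carrier_mat n p" "mat_adjoint (M * G) = M * G" "M * G * M = M"
    using least_squares_inverse_exists[OF M] by auto
  obtain H' where H': "H' \<in> carrier_mat p n" "mat_adjoint (mat_adjoint M * H') = mat_adjoint M * H'"
    "mat_adjoint M * H' * mat_adjoint M = mat_adjoint M"
    using least_squares_inverse_exists[of "mat_adjoint M" n p] M by auto
  define H where "H = mat_adjoint H'"
  have H: "H \<in> carrier_mat n p" using H' by (simp add: H_def)
  have HM: "mat_adjoint (H * M) = H * M"
    using H'(1,2) M by (simp add: H_def mat_adjoint_mult)
  have MHM: "M * H * M = M"
  proof -
    have "mat_adjoint (mat_adjoint M * H' * mat_adjoint M) = M" using H'(3) by simp
    then show ?thesis using M H'(1) H
      by (simp add: mat_adjoint_mult H_def assoc_mult_mat[of _ p n _ p _ n])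
  qed
  define N where "N = H * M * G"
  have N: "N \<in> carrier_mat n p" using H M G by (simp add: N_def)
  have MN: "M * N = M * G"
  proof -
    have "M * N = (M * H * M) * G" unfolding N_def using M G H
      by (simp add: assoc_mult_mat[of _ p n _ p _ n] assoc_mult_mat[of _ p n _ p _ p]
          assoc_mult_mat[of _ n p _ n _ p] assoc_mult_mat[of _ p n _ n _ p])
    then show ?thesis by (simp add: MHM)
  qed
  have NM: "N * M = H * M"
  proof -
    have "N * M = H * (M * G * M)" unfolding N_def using M G H
      by (simp add: assoc_mult_mat[of _ n p _ n _ p] assoc_mult_mat[of _ n p _ p _ n]
          assoc_mult_mat[of _ p n _ p _ n])
    then show ?thesis by (simp add: G)
  qed
  have "N * M * N = N"
    unfolding NM using MN M G H N assoc_mult_mat[of H n p M n N p] assoc_mult_mat[of H n p M n G p]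
    by (simp add: N_def)
  moreover have "M * N * M = M" by (simp add: MN G)
  ultimately show ?thesis using N MN NM G HM
    by (intro exI[of _ N]) (auto simp: is_pinv_def p_def n_def)
qed

text \<open>Both candidates give the same projections: \<open>M N = M N' M N\<close>, and taking adjoints exchanges the
  factors \<open>M N'\<close> and \<open>M N\<close>.\<close>

lemma is_pinv_unique:
  assumes "is_pinv M N" "is_pinv M N'"
  shows "N = N'"
proof -
  define p n where "p = dim_row M" and "n = dim_col M"
  have M: "M \<in> carrier_mat p n" by (simp add: p_def n_def)
  have N: "N \<in> carrier_mat n p" "M * N * M = M" "N * M * N = N"
    "mat_adjoint (M * N) = M * N" "mat_adjoint (N * M) = N * M"
    using assms(1) by (auto simp: is_pinv_def p_def n_def)
  have N': "N' \<in> carrier_mat n p" "M * N' * M = M" "N' * M * N' = N'"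
    "mat_adjoint (M * N') = M * N'" "mat_adjoint (N' * M) = N' * M"
    using assms(2) by (auto simp: is_pinv_def p_def n_def)
  have "M * N = M * N'"
  proof -
    have "M * N = mat_adjoint ((M * N' * M) * N)" using N N' by simp
    also have "(M * N' * M) * N = (M * N') * (M * N)"
      using M N(1) N'(1) assoc_mult_mat[of "M * N'" p p M n N p] by simp
    also have "mat_adjoint \<dots> = (M * N) * (M * N')"
      using M N N' by (simp add: mat_adjoint_mult[of "M * N'"])
    also have "\<dots> = (M * N * M) * N'" using M N(1) N'(1) assoc_mult_mat[of "M * N" p p M n N' p] by simp
    finally show ?thesis using N by simp
  qed
  moreover have "N * M = N' * M"
  proof -
    have "N * M = mat_adjoint (N * (M * N' * M))" using N N' by simp
    also have "N * (M * N' * M) = (N * M) * (N' * M)"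
      using M N(1) N'(1) assoc_mult_mat[of N n p M n "N' * M" n] assoc_mult_mat[of M p n N' p M n] by simp
    also have "mat_adjoint \<dots> = (N' * M) * (N * M)"
      using M N N' by (simp add: mat_adjoint_mult[of "N * M"])
    also have "\<dots> = N' * (M * N * M)"
      using M N(1) N'(1) assoc_mult_mat[of N' n p M n "N * M" n] assoc_mult_mat[of M p n N p M n] by simp
    finally show ?thesis using N by simp
  qed
  ultimately have "N = N' * M * N" "N' = N' * (M * N)"
    using N N' M assoc_mult_mat[of N' n p M n N' p] by auto
  then show ?thesis using assoc_mult_mat[of N' n p M n N p] M N N' by simp
qed

lemma is_pinv_pinv: "is_pinv M (pinv M)"
  unfolding pinv_def using is_pinv_exists is_pinv_unique by (metis theI)

lemma pinv_carrier: "M \<in> carrier_mat p n \<Longrightarrow> pinv M \<in> carrier_mat n p"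
  using is_pinv_pinv[of M] by (auto simp: is_pinv_def)

lemma is_pinv_adjoint:
  assumes "is_pinv M N"
  shows "is_pinv (mat_adjoint M) (mat_adjoint N)"
proof -
  define p n where "p = dim_row M" and "n = dim_col M"
  have M: "M \<in> carrier_mat p n" by (simp add: p_def n_def)
  have N: "N \<in> carrier_mat n p" "M * N * M = M" "N * M * N = N"
    "mat_adjoint (M * N) = M * N" "mat_adjoint (N * M) = N * M"
    using assms(1) by (auto simp: is_pinv_def p_def n_def)
  have NM: "mat_adjoint M * mat_adjoint N = mat_adjoint (N * M)"
    and MN: "mat_adjoint N * mat_adjoint M = mat_adjoint (M * N)"
    using M N(1) by (auto simp: mat_adjoint_mult)
  have "mat_adjoint M * mat_adjoint N * mat_adjoint M = mat_adjoint (M * N * M)"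
    using M N(1) by (simp add: mat_adjoint_mult assoc_mult_mat[of _ n p _ n _ p])
  moreover have "mat_adjoint N * mat_adjoint M * mat_adjoint N = mat_adjoint (N * M * N)"
    using M N(1) by (simp add: mat_adjoint_mult assoc_mult_mat[of _ p n _ p _ n])
  ultimately show ?thesis
    using N M unfolding is_pinv_def by (auto simp: NM MN)
qed

lemma pinv_adjoint: "pinv (mat_adjoint M) = mat_adjoint (pinv M)"
  using is_pinv_unique is_pinv_adjoint is_pinv_pinv by blast

definition residual_projection :: "complex mat \<Rightarrow> complex mat" where
  "residual_projection M = 1\<^sub>m (dim_row M) - M * pinv M"

lemma residual_projection:
  assumes M: "M \<in> carrier_mat p n"
  shows "residual_projection M \<in> carrier_mat p p"
    "mat_adjoint (residual_projection M) = residual_projection M"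
    "residual_projection M * residual_projection M = residual_projection M"
    "residual_projection M * M = 0\<^sub>m p n"
proof -
  define N where "N = pinv M"
  have N: "N \<in> carrier_mat n p" "M * N * M = M" "N * M * N = N" "mat_adjoint (M * N) = M * N"
    using is_pinv_pinv[of M] M by (auto simp: is_pinv_def N_def)
  have P: "residual_projection M = 1\<^sub>m p - M * N" using M by (simp add: residual_projection_def N_def)
  have MN: "M * N \<in> carrier_mat p p" using M N by simp
  have MNMN: "M * N * (M * N) = M * N"
    using assoc_mult_mat[of "M * N" p p M n N p] M N by simp
  show "residual_projection M \<in> carrier_mat p p" using MN by (simp add: P minus_carrier_mat)
  show "mat_adjoint (residual_projection M) = residual_projection M"
    unfolding P using mat_adjoint_minus[of "1\<^sub>m p" p p "M * N"] MN N by simp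
  show "residual_projection M * residual_projection M = residual_projection M"
  proof -
    have "(1\<^sub>m p - M * N) * (1\<^sub>m p - M * N) = 1\<^sub>m p - M * N - (M * N - M * N * (M * N))"
      using MN left_mult_one_mat[OF MN] right_mult_one_mat[OF MN]
      by (simp add: mult_minus_distrib_mat[of _ p p _ p] minus_mult_distrib_mat[of _ p p _ _ p] minus_carrier_mat
          del: assoc_mult_mat)
    also have "\<dots> = 1\<^sub>m p - M * N" unfolding MNMN using M N(1) by (intro eq_matI) auto
    finally show ?thesis unfolding P .
  qed
  show "residual_projection M * M = 0\<^sub>m p n"
    unfolding P using M MN N by (simp add: minus_mult_distrib_mat[of _ p p])
qed

section \<open>Gram determinants and exchanges of columns\<close>

lemma hcat_carrier [simp]: "M \<in> carrier_mat p k \<Longrightarrow> N \<in> carrier_mat p r \<Longrightarrow> hcat M N \<in> carrier_mat p (k + r)"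
  unfolding hcat_def by (metis add.right_neutral four_block_carrier_mat zero_carrier_mat carrier_matD(2))

lemma hcat_index:
  "M \<in> carrier_mat p k \<Longrightarrow> N \<in> carrier_mat p r \<Longrightarrow> i < p \<Longrightarrow> j < k + r \<Longrightarrow>
    hcat M N $$ (i, j) = (if j < k then M $$ (i, j) else N $$ (i, j - k))"
  by (auto simp: hcat_def)

lemma gram_hcat:
  assumes M: "M \<in> carrier_mat p k" and N: "N \<in> carrier_mat p r"
  shows "mat_adjoint (hcat M N) * hcat M N =
    four_block_mat (mat_adjoint M * M) (mat_adjoint M * N) (mat_adjoint N * M) (mat_adjoint N * N)"
  (is "?L = ?R")
proof (rule eq_matI)
  have H: "hcat M N \<in> carrier_mat p (k + r)" using M N by simp
  show "dim_row ?L = dim_row ?R" "dim_col ?L = dim_col ?R"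
    using carrier_matD[OF H] M N by auto
  fix i j assume "i < dim_row ?R" "j < dim_col ?R"
  then have ij: "i < k + r" "j < k + r" using M N by auto
  have "?L $$ (i, j) = (\<Sum>t<p. cnj (hcat M N $$ (t, i)) * hcat M N $$ (t, j))"
    using carrier_matD[OF H] ij by (simp add: mult_index_sum del: index_mult_mat(1))
  also have "\<dots> = ?R $$ (i, j)"
    using M N ij by (auto simp: mult_index_sum hcat_index[OF M N] simp del: index_mult_mat(1) intro!: sum.cong)
  finally show "?L $$ (i, j) = ?R $$ (i, j)" .
qed

definition col_mat :: "complex Matrix.vec \<Rightarrow> complex mat" where
  "col_mat v = mat (dim_vec v) 1 (\<lambda>(i, j). v $ i)"

lemma col_mat_carrier [simp]: "v \<in> carrier_vec n \<Longrightarrow> col_mat v \<in> carrier_mat n (Suc 0)"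
  by (auto simp: col_mat_def)

lemma mult_col_mat: "dim_vec v = dim_col A \<Longrightarrow> A * col_mat v = col_mat (A *\<^sub>v v)"
  by (rule eq_matI) (auto simp: col_mat_def mult_index_sum mult_vec_index_sum
      simp del: index_mult_mat(1) index_mult_mat_vec)

lemma det_gram_col_mat: "Determinant.det (mat_adjoint (col_mat v) * col_mat v) = of_real ((vec_norm2 v)\<^sup>2)"
proof -
  have "mat_adjoint (col_mat v) * col_mat v \<in> carrier_mat 1 1" by (auto simp: col_mat_def)
  then have "Determinant.det (mat_adjoint (col_mat v) * col_mat v) = (mat_adjoint (col_mat v) * col_mat v) $$ (0, 0)"
    by (rule det_single)
  also have "\<dots> = ip v v"
    by (auto simp: col_mat_def mult_index_sum ip_def mult.commute simp del: index_mult_mat(1))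
  finally show ?thesis by (simp add: ip_self)
qed

text \<open>Volume is base times height. Subtracting from the new column its projection onto the range of \<open>M\<close> is
  a multiplication from the right by a unipotent matrix \<open>U\<close>; afterwards the Gram matrix is block diagonal.\<close>

lemma det_gram_append_column:
  assumes M: "M \<in> carrier_mat p k" and b: "b \<in> carrier_vec p"
  shows "Determinant.det (mat_adjoint (hcat M (col_mat b)) * hcat M (col_mat b)) =
    of_real ((vec_norm2 (residual_projection M *\<^sub>v b))\<^sup>2) * Determinant.det (mat_adjoint M * M)"
proof -
  note P = residual_projection[OF M]
  define N where "N = pinv M"
  have N: "N \<in> carrier_mat k p" using pinv_carrier[OF M] by (simp add: N_def)
  define P where "P = residual_projection M"
  have Pd: "P = 1\<^sub>m p - M * N" using M by (simp add: P_def residual_projection_def N_def)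
  define c where "c = P *\<^sub>v b"
  have c: "c \<in> carrier_vec p" using P(1) b by (simp add: c_def P_def)
  have MN: "M * N \<in> carrier_mat p p" using M N by simp
  define d where "d = N *\<^sub>v b"
  have d: "d \<in> carrier_vec k" using N b by (simp add: d_def)
  have bc: "b = M *\<^sub>v d + c"
  proof -
    have "c = b - M *\<^sub>v d" unfolding c_def Pd d_def
      using minus_mult_distrib_mat_vec[of "1\<^sub>m p" p p "M * N" b] MN M N b
      by (simp add: assoc_mult_mat_vec[of M p k N p])
    then show ?thesis using b M d by auto
  qed
  define U where "U = four_block_mat (1\<^sub>m k) (col_mat d) (0\<^sub>m 1 k) (1\<^sub>m 1)"
  have U: "U \<in> carrier_mat (k + 1) (k + 1)" unfolding U_def
    by (intro four_block_carrier_mat) auto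
  define H where "H = hcat M (col_mat c)"
  have H: "H \<in> carrier_mat p (k + 1)" using hcat_carrier[OF M col_mat_carrier[OF c]] by (simp add: H_def)
  have HU: "hcat M (col_mat b) = H * U"
  proof -
    have "H * U = four_block_mat (M * 1\<^sub>m k + col_mat c * 0\<^sub>m 1 k) (M * col_mat d + col_mat c * 1\<^sub>m 1)
      (0\<^sub>m 0 k * 1\<^sub>m k + 0\<^sub>m 0 1 * 0\<^sub>m 1 k) (0\<^sub>m 0 k * col_mat d + 0\<^sub>m 0 1 * 1\<^sub>m 1)"
    proof -
      have "H = four_block_mat M (col_mat c) (0\<^sub>m 0 k) (0\<^sub>m 0 1)"
        using M c by (simp add: H_def hcat_def col_mat_def)
      then show ?thesis unfolding U_def
        by (simp only:) (rule mult_four_block_mat[of _ p k _ 1 _ 0], use M c d in auto)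
    qed
    also have "M * 1\<^sub>m k + col_mat c * 0\<^sub>m 1 k = M"
    proof -
      have "col_mat c * 0\<^sub>m 1 k = 0\<^sub>m p k" by (rule right_mult_zero_mat) (use c in simp)
      then show ?thesis using M by simp
    qed
    also have "M * col_mat d + col_mat c * 1\<^sub>m 1 = col_mat b"
      using M c d bc by (simp add: mult_col_mat) (auto simp: col_mat_def intro!: eq_matI)
    also have "four_block_mat M (col_mat b)
      (0\<^sub>m 0 k * 1\<^sub>m k + 0\<^sub>m 0 1 * 0\<^sub>m 1 k) (0\<^sub>m 0 k * col_mat d + 0\<^sub>m 0 1 * 1\<^sub>m 1) = hcat M (col_mat b)"
      unfolding hcat_def by (rule cong_four_block_mat) (use M d in \<open>auto simp: col_mat_def\<close>)
    finally show ?thesis by simp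
  qed
  have detU: "Determinant.det U = 1"
    using det_four_block_mat_lower_left_zero[of "1\<^sub>m k" k "col_mat d" 1 "0\<^sub>m 1 k" "1\<^sub>m 1"] d
    by (simp add: U_def)
  have detU': "Determinant.det (mat_adjoint U) = 1"
  proof -
    have "mat_adjoint U = four_block_mat (1\<^sub>m k) (0\<^sub>m k 1) (mat_adjoint (col_mat d)) (1\<^sub>m 1)"
      unfolding U_def by (rule eq_matI) (use d in \<open>auto simp: col_mat_def\<close>)
    then show ?thesis
      using det_four_block_mat_upper_right_zero[of "1\<^sub>m k" k "0\<^sub>m k 1" 1 "mat_adjoint (col_mat d)" "1\<^sub>m 1"] d
      by simp
  qed
  have MC: "mat_adjoint M * col_mat c = 0\<^sub>m k 1"
  proof -
    have "mat_adjoint M *\<^sub>v c = (mat_adjoint M * P) *\<^sub>v b"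
      unfolding c_def P_def using M P(1) b assoc_mult_mat_vec[of "mat_adjoint M" k p _ p b] by simp
    also have "mat_adjoint M * P = mat_adjoint (P * M)"
      using M P(1,2) by (simp add: P_def mat_adjoint_mult)
    also have "\<dots> = 0\<^sub>m k p" using P(4) by (simp add: P_def mat_adjoint_zero)
    finally show ?thesis using M b c by (simp add: mult_col_mat) (auto simp: col_mat_def)
  qed
  have CM: "mat_adjoint (col_mat c) * M = 0\<^sub>m 1 k"
  proof -
    have "mat_adjoint (col_mat c) * M = mat_adjoint (mat_adjoint M * col_mat c)"
      using M c by (simp add: mat_adjoint_mult col_mat_def)
    then show ?thesis by (simp add: MC mat_adjoint_zero)
  qed
  define G where "G = mat_adjoint H * H"
  have G: "G \<in> carrier_mat (k + 1) (k + 1)" using H by (simp add: G_def)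
  have "G = four_block_mat (mat_adjoint M * M) (0\<^sub>m k 1) (0\<^sub>m 1 k) (mat_adjoint (col_mat c) * col_mat c)"
    unfolding G_def H_def gram_hcat[OF M col_mat_carrier[OF c]] MC CM ..
  also have "Determinant.det \<dots> =
    Determinant.det (mat_adjoint M * M) * Determinant.det (mat_adjoint (col_mat c) * col_mat c)"
    by (rule det_four_block_mat_lower_left_zero) (use M in \<open>auto simp: col_mat_def\<close>)
  finally have "Determinant.det G =
    Determinant.det (mat_adjoint M * M) * Determinant.det (mat_adjoint (col_mat c) * col_mat c)" .
  moreover have "mat_adjoint (H * U) * (H * U) = mat_adjoint U * (G * U)"
    using assoc_mult_mat[of "mat_adjoint U" "k + 1" "k + 1" "mat_adjoint H" p "H * U" "k + 1"]
      assoc_mult_mat[of "mat_adjoint H" "k + 1" p H "k + 1" U "k + 1"] H U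
    by (simp add: mat_adjoint_mult G_def)
  moreover have "Determinant.det (mat_adjoint U * (G * U)) = Determinant.det G"
    using det_mult[of "mat_adjoint U" "k + 1" "G * U"] det_mult[OF G U] G U detU detU' by simp
  ultimately show ?thesis unfolding HU det_gram_col_mat
    by (simp add: c_def P_def)
qed

lemma cols_at_carrier [simp]: "A \<in> carrier_mat p q \<Longrightarrow> cols_at A L \<in> carrier_mat p (length L)"
  by (auto simp: cols_at_def)

lemma cols_at_dim [simp]: "dim_row (cols_at A L) = dim_row A" "dim_col (cols_at A L) = length L"
  by (auto simp: cols_at_def)

lemma cols_at_index [simp]:
  "i < dim_row A \<Longrightarrow> j < length L \<Longrightarrow> cols_at A L $$ (i, j) = A $$ (i, L ! j)"
  by (auto simp: cols_at_def)

lemma col_cols_at: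
  "t < length L \<Longrightarrow> L ! t < dim_col A \<Longrightarrow> col (cols_at A L) t = col A (L ! t)"
  by (rule eq_vecI) auto

lemma mult_cols_at:
  assumes "dim_col A = dim_row B" "set L \<subseteq> {..<dim_col B}"
  shows "A * cols_at B L = cols_at (A * B) L"
proof (rule eq_matI)
  fix i j assume "i < dim_row (cols_at (A * B) L)" "j < dim_col (cols_at (A * B) L)"
  then have ij: "i < dim_row A" "j < length L" by auto
  then have "L ! j < dim_col B" using assms(2) nth_mem by blast
  then show "(A * cols_at B L) $$ (i, j) = cols_at (A * B) L $$ (i, j)"
    using ij assms(1) by (simp add: mult_index_sum del: index_mult_mat(1))
qed auto

lemma cols_at_cols_at:
  "set J \<subseteq> {..<length L} \<Longrightarrow> cols_at (cols_at A L) J = cols_at A (map (\<lambda>j. L ! j) J)"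
  by (rule eq_matI) (auto simp: subset_iff)

lemma cols_at_append1:
  "j < dim_col A \<Longrightarrow> cols_at A (L @ [j]) = hcat (cols_at A L) (col_mat (col A j))"
  by (rule eq_matI) (auto simp: hcat_def col_mat_def nth_append less_Suc_eq)

text \<open>The last coordinate is split off, so that it can be recovered by projecting along the other columns.\<close>

lemma cols_at_append1_mult_vec:
  assumes A: "A \<in> carrier_mat p q" and j: "j < q" and z: "z \<in> carrier_vec (Suc (length L))"
  shows "cols_at A (L @ [j]) *\<^sub>v z = cols_at A L *\<^sub>v vec (length L) (\<lambda>i. z $ i) + z $ length L \<cdot>\<^sub>v col A j"
  by (rule eq_vecI)
    (use A j z in \<open>auto simp: mult_vec_index_sum nth_append mult.commute simp del: index_mult_mat_vec\<close>)

lemma cols_at_one_isometry: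
  assumes "distinct L" "set L \<subseteq> {..<q}"
  shows "mat_adjoint (cols_at (1\<^sub>m q) L) * cols_at (1\<^sub>m q) L = (1\<^sub>m (length L) :: complex mat)"
proof (rule eq_matI)
  fix i j assume "i < dim_row (1\<^sub>m (length L) :: complex mat)" "j < dim_col (1\<^sub>m (length L) :: complex mat)"
  then have ij: "i < length L" "j < length L" by auto
  then have "L ! i < q" "L ! j < q" using assms(2) nth_mem by blast+
  then show "(mat_adjoint (cols_at (1\<^sub>m q) L) * cols_at (1\<^sub>m q) L) $$ (i, j) = (1\<^sub>m (length L) :: complex mat) $$ (i, j)"
    using ij assms(1) nth_eq_iff_index_eq[OF assms(1) ij]
    by (auto simp: mult_index_sum if_distrib[of cnj] if_distrib[of "\<lambda>x. x * _"] sum.delta simp del: index_mult_mat(1) cong: if_cong)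
qed auto

text \<open>Exchanging two columns exchanges two rows and two columns of the Gram matrix, so the sign changes twice.\<close>

lemma det_gram_swap:
  assumes "i < length L" "j < length L" "i \<noteq> j"
  shows "Determinant.det (mat_adjoint (cols_at A (L[i := L ! j, j := L ! i])) * cols_at A (L[i := L ! j, j := L ! i]))
    = Determinant.det (mat_adjoint (cols_at A L) * cols_at A L)"
proof -
  let ?G = "mat_adjoint (cols_at A L) * cols_at A L"
  have G: "?G \<in> carrier_mat (length L) (length L)" by (intro carrier_matI) auto
  have "mat_adjoint (cols_at A (L[i := L ! j, j := L ! i])) * cols_at A (L[i := L ! j, j := L ! i])
    = swaprows i j (swapcols i j ?G)"
    by (rule eq_matI) (use assms in \<open>auto simp: mult_index_sum nth_list_update simp del: index_mult_mat(1)\<close>)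
  moreover have "Determinant.det (swaprows i j (swapcols i j ?G)) = - Determinant.det (swapcols i j ?G)"
    by (rule det_swaprows[of _ "length L"]) (use assms G in auto)
  moreover have "Determinant.det (swapcols i j ?G) = - Determinant.det ?G"
    by (rule det_swapcols[OF _ _ _ G]) (use assms in auto)
  ultimately show ?thesis by simp
qed

lemma cols_at_swap_mult_vec:
  assumes ij: "i < length L" "j < length L" and z: "z \<in> carrier_vec (length L)"
  shows "cols_at A (L[i := L ! j, j := L ! i]) *\<^sub>v vec (length L) (\<lambda>t. z $ Transposition.transpose i j t) = cols_at A L *\<^sub>v z"
proof (rule eq_vecI)
  let ?\<pi> = "Transposition.transpose i j" and ?L = "L[i := L ! j, j := L ! i]"
  show "dim_vec (cols_at A ?L *\<^sub>v vec (length L) (\<lambda>t. z $ ?\<pi> t)) = dim_vec (cols_at A L *\<^sub>v z)" by simp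
  fix r assume "r < dim_vec (cols_at A L *\<^sub>v z)"
  then have r: "r < dim_row A" by simp
  have \<pi>: "?\<pi> t < length L" if "t < length L" for t using that ij by (auto simp: Transposition.transpose_def)
  have L: "?L ! t = L ! ?\<pi> t" if "t < length L" for t
    using that ij by (auto simp: Transposition.transpose_def nth_list_update)
  have "(cols_at A ?L *\<^sub>v vec (length L) (\<lambda>t. z $ ?\<pi> t)) $ r = (\<Sum>t<length L. A $$ (r, L ! ?\<pi> t) * z $ ?\<pi> t)"
    using r L by (simp add: mult_vec_index_sum del: index_mult_mat_vec)
  also have "\<dots> = (\<Sum>t<length L. A $$ (r, L ! t) * z $ t)"
    by (rule sum.reindex_bij_witness[of _ ?\<pi> ?\<pi>]) (use \<pi> in auto)
  also have "\<dots> = (cols_at A L *\<^sub>v z) $ r"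
    using r z by (simp add: mult_vec_index_sum del: index_mult_mat_vec)
  finally show "(cols_at A ?L *\<^sub>v vec (length L) (\<lambda>t. z $ ?\<pi> t)) $ r = (cols_at A L *\<^sub>v z) $ r" .
qed

lemma residual_of_own_column:
  assumes "M \<in> carrier_mat p k" "t < k"
  shows "residual_projection M *\<^sub>v col M t = 0\<^sub>v p"
  using residual_projection(1,4)[OF assms(1)] assms col_mult2[of "residual_projection M" p p M k t] by auto

text \<open>Appending a zero row makes the matrix square and singular.\<close>

lemma wide_matrix_kernel:
  fixes W :: "complex mat"
  assumes W: "W \<in> carrier_mat k (Suc k)"
  shows "\<exists>z \<in> carrier_vec (Suc k). z \<noteq> 0\<^sub>v (Suc k) \<and> W *\<^sub>v z = 0\<^sub>v k"
proof -
  define S where "S = mat (Suc k) (Suc k) (\<lambda>(i, j). if i < k then W $$ (i, j) else 0)"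
  have S: "S \<in> carrier_mat (Suc k) (Suc k)" by (simp add: S_def)
  have "S = mat\<^sub>r (Suc k) (Suc k) (\<lambda>i. if i = k then 0\<^sub>v (Suc k) else row S i)"
    by (rule eq_matI) (auto simp: S_def)
  moreover have "Determinant.det (mat\<^sub>r (Suc k) (Suc k) (\<lambda>i. if i = k then 0\<^sub>v (Suc k) else row S i)) = 0"
    by (rule det_row_0) (auto simp: S_def)
  ultimately have "Determinant.det S = 0" by simp
  then obtain z where z: "z \<in> carrier_vec (Suc k)" "z \<noteq> 0\<^sub>v (Suc k)" "S *\<^sub>v z = 0\<^sub>v (Suc k)"
    using det_0_iff_vec_prod_zero_field[OF S] by auto
  have "W *\<^sub>v z = 0\<^sub>v k"
  proof (rule eq_vecI)
    fix i assume i: "i < dim_vec (0\<^sub>v k)"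
    have "(W *\<^sub>v z) $ i = (S *\<^sub>v z) $ i"
      using i z(1) W S by (simp add: mult_vec_index_sum del: index_mult_mat_vec) (auto simp: S_def)
    then show "(W *\<^sub>v z) $ i = 0\<^sub>v k $ i" using z i by simp
  qed (use W in auto)
  then show ?thesis using z by blast
qed

section \<open>Local maximality of the volume bounds the residuals\<close>

text \<open>Let \<open>a\<close> be column \<open>j\<close> of \<open>A\<close>, let \<open>\<gamma>\<close> be its distance from the span of the \<open>k\<close> selected columns, and let \<open>v\<close> be a combination of
  the \<open>k + 1\<close> columns with coefficient vector \<open>z\<close>. By Cramer's rule each coefficient is a quotient of volumes: \<open>v\<close> has norm at least
  \<open>|z\<^sub>t|\<close> times the distance \<open>\<beta>\<close> of the \<open>t\<close>-th column from the span of the \<open>k\<close> others. The product of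
  \<open>\<beta>\<close> and the volume of those \<open>k\<close> columns is the volume of all \<open>k + 1\<close>, which is also \<open>\<gamma>\<close> times
  the volume of the selection. As an exchange gains at most a factor \<open>sqrt 2\<close>, this gives
  \<open>\<gamma> \<le> sqrt 2 \<beta>\<close>, and summing the squares of the coefficients gives
  \<open>\<gamma> \<parallel>z\<parallel> \<le> sqrt (1 + 2 k) \<parallel>v\<parallel>\<close>.

  That \<open>W\<close> annihilates the combination is a system of \<open>k\<close> linear conditions on \<open>z\<close>, which has
  a nonzero solution. For this \<open>z\<close> only \<open>D\<close> contributes to \<open>v\<close>, so \<open>\<parallel>v\<parallel> \<le> e \<parallel>z\<parallel>\<close>. The last step uses that
  the \<open>k + 1\<close> columns are distinct, which is automatic unless \<open>\<gamma>\<close> or the volume vanishes.\<close>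

lemma locally_maximal_volume_residual:
  fixes A :: "complex mat"
  assumes A: "A \<in> carrier_mat p q" and L: "length L = k" "set L \<subseteq> {..<q}"
    and pos: "0 < Re (Determinant.det (mat_adjoint (cols_at A L) * cols_at A L))"
    and j: "j < q"
    and max: "\<And>i. i < k \<Longrightarrow> Re (Determinant.det (mat_adjoint (cols_at A (L[i := j])) * cols_at A (L[i := j])))
      \<le> 2 * Re (Determinant.det (mat_adjoint (cols_at A L) * cols_at A L))"
    and split: "A = B * W + D" "B \<in> carrier_mat p k" "W \<in> carrier_mat k q" "D \<in> carrier_mat p q"
    and D: "op_le D e" "0 \<le> e"
  shows "vec_norm2 (residual_projection (cols_at A L) *\<^sub>v col A j) \<le> sqrt (1 + 2 * real k) * e"
proof (cases "vec_norm2 (residual_projection (cols_at A L) *\<^sub>v col A j) = 0")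
  case True
  then show ?thesis using D(2) by simp
next
  case False
  define gram where "gram = (\<lambda>K. Determinant.det (mat_adjoint (cols_at A K) * cols_at A K))"
  define M where "M = cols_at A L"
  have M: "M \<in> carrier_mat p k" using A L by (auto simp: M_def)
  define \<gamma> where "\<gamma> = vec_norm2 (residual_projection M *\<^sub>v col A j)"
  have \<gamma>: "\<gamma> > 0" using False vec_norm2_nonneg by (simp add: \<gamma>_def M_def order.not_eq_order_implies_strict)
  have colA: "col A i \<in> carrier_vec p" for i using A by (intro carrier_vecI) simp
  have gram_append: "gram (K @ [i]) = of_real ((vec_norm2 (residual_projection (cols_at A K) *\<^sub>v col A i))\<^sup>2) * gram K"
    if "i < q" for K i
    using that A det_gram_append_column[of "cols_at A K" p "length K" "col A i"] colA
    by (simp add: gram_def cols_at_append1)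
  have Lq: "L ! i < q" if "i < k" for i using that L nth_mem by blast
  have "distinct L"
  proof (rule ccontr)
    assume "\<not> distinct L"
    then obtain s t where st: "s < k" "t < k" "s \<noteq> t" "L ! s = L ! t"
      using L by (auto simp: distinct_conv_nth)
    have "mat_adjoint M * M \<in> carrier_mat k k" using M by simp
    then have "Determinant.det (mat_adjoint M * M) = 0"
    proof (rule det_identical_columns[OF _ st(3,1,2)])
      have "col M s = col M t"
        using st L Lq[OF st(1)] Lq[OF st(2)] A by (simp add: M_def col_cols_at)
      then show "col (mat_adjoint M * M) s = col (mat_adjoint M * M) t"
        using M st col_mult2[of "mat_adjoint M" k p M k] by simp
    qed
    then show False using pos by (simp add: M_def)
  qed
  moreover have "j \<notin> set L"
  proof
    assume "j \<in> set L"
    then obtain t where t: "t < k" "L ! t = j" using L by (auto simp: in_set_conv_nth)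
    then have "residual_projection M *\<^sub>v col A j = 0\<^sub>v p"
      using residual_of_own_column[OF M t(1)] col_cols_at[of t L A] L A j by (simp add: M_def)
    then show False using \<gamma> by (simp add: \<gamma>_def)
  qed
  ultimately have dist: "distinct (L @ [j])" by simp
  have Lj: "set (L @ [j]) \<subseteq> {..<q}" "length (L @ [j]) = Suc k" using L j by auto
  obtain z where z: "z \<in> carrier_vec (Suc k)" "z \<noteq> 0\<^sub>v (Suc k)" "cols_at W (L @ [j]) *\<^sub>v z = 0\<^sub>v k"
    using wide_matrix_kernel[of "cols_at W (L @ [j])" k] cols_at_carrier[OF split(3), of "L @ [j]"] Lj(2)
    by auto
  define v where "v = cols_at A (L @ [j]) *\<^sub>v z"
  have v: "v \<in> carrier_vec p" using A by (auto simp: v_def intro!: carrier_vecI)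
  \<comment> \<open>\<open>E\<close> embeds the coefficients as a vector supported on the chosen columns; distinctness makes it an isometry.\<close>
  define E where "E = cols_at (1\<^sub>m q :: complex mat) (L @ [j])"
  have E: "E \<in> carrier_mat q (Suc k)" using Lj by (auto simp: E_def)
  have isoE: "mat_adjoint E * E = 1\<^sub>m (Suc k)"
    using cols_at_one_isometry[OF dist Lj(1)] Lj by (simp add: E_def)
  have sel: "cols_at K (L @ [j]) *\<^sub>v z = K *\<^sub>v (E *\<^sub>v z)" if "K \<in> carrier_mat r q" for K r
  proof -
    have "K * E = cols_at K (L @ [j])" unfolding E_def using that Lj by (subst mult_cols_at) auto
    then show ?thesis using that E z assoc_mult_mat_vec[of K r q E "Suc k" z] by simp
  qed
  have Ez: "E *\<^sub>v z \<in> carrier_vec q" using E z by simp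
  have "v = D *\<^sub>v (E *\<^sub>v z)"
  proof -
    have "v = (B * W) *\<^sub>v (E *\<^sub>v z) + D *\<^sub>v (E *\<^sub>v z)"
      unfolding v_def sel[OF A] using split Ez by (simp add: add_mult_distrib_mat_vec[of _ p q])
    also have "(B * W) *\<^sub>v (E *\<^sub>v z) = B *\<^sub>v (W *\<^sub>v (E *\<^sub>v z))"
      by (rule assoc_mult_mat_vec) (use split Ez in auto)
    also have "W *\<^sub>v (E *\<^sub>v z) = 0\<^sub>v k" using z(3) sel[OF split(3)] by simp
    also have "B *\<^sub>v 0\<^sub>v k = 0\<^sub>v p" using split by auto
    finally show ?thesis using split Ez by simp
  qed
  then have v_le: "vec_norm2 v \<le> e * vec_norm2 z"
    using op_leD[OF D(1), of "E *\<^sub>v z"] split Ez isometry_norm[OF E isoE z(1)] by simp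
  have coord: "cmod c * vec_norm2 (residual_projection (cols_at A K) *\<^sub>v col A i) \<le> vec_norm2 v"
    if K: "v = cols_at A K *\<^sub>v u + c \<cdot>\<^sub>v col A i" "u \<in> carrier_vec (length K)" for K u c i
  proof -
    define P where "P = residual_projection (cols_at A K)"
    have AK: "cols_at A K \<in> carrier_mat p (length K)" using A by simp
    note P = residual_projection[OF AK, folded P_def]
    have "P *\<^sub>v v = (P * cols_at A K) *\<^sub>v u + c \<cdot>\<^sub>v (P *\<^sub>v col A i)"
      unfolding K(1) using P(1) AK K(2) colA[of i]
      by (simp add: mult_add_distrib_mat_vec[of _ p p] mult_mat_vec[of _ p p] assoc_mult_mat_vec[of _ p p _ "length K"])
    also have "\<dots> = c \<cdot>\<^sub>v (P *\<^sub>v col A i)" using P(1,4) K(2) colA[of i] by (simp add: zero_mat_mult_vec)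
    finally have "cmod c * vec_norm2 (P *\<^sub>v col A i) = vec_norm2 (P *\<^sub>v v)" by (simp add: vec_norm2_smult)
    also have "\<dots> \<le> vec_norm2 v"
      using op_leD[OF hermitian_idempotent_contraction[OF P(1-3)], of v] v P(1) by simp
    finally show ?thesis by (simp add: P_def)
  qed
  have last: "(cmod (z $ k))\<^sup>2 * \<gamma>\<^sup>2 \<le> (vec_norm2 v)\<^sup>2"
  proof -
    have "cmod (z $ k) * \<gamma> \<le> vec_norm2 v"
      unfolding \<gamma>_def M_def
      using coord[of L "vec k (\<lambda>i. z $ i)" "z $ k" j] cols_at_append1_mult_vec[OF A j, of z L] z(1) L
      by (simp add: v_def)
    then show ?thesis using \<gamma> by (metis power_mult_distrib power_mono zero_le_mult_iff norm_ge_zero less_imp_le)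
  qed
  have other: "(cmod (z $ t))\<^sup>2 * \<gamma>\<^sup>2 \<le> 2 * (vec_norm2 v)\<^sup>2" if t: "t < k" for t
  proof -
    define L' where "L' = L[t := j]"
    define \<beta> where "\<beta> = vec_norm2 (residual_projection (cols_at A L') *\<^sub>v col A (L ! t))"
    \<comment> \<open>Column \<open>t\<close> of the selection changes places with \<open>a\<close>, so that it becomes the last one.\<close>
    have swap: "(L @ [j])[t := (L @ [j]) ! k, k := (L @ [j]) ! t] = L' @ [L ! t]"
      using t L by (simp add: L'_def nth_append list_update_append)
    have L': "length L' = k" using L by (simp add: L'_def)
    have "v = cols_at A (L' @ [L ! t]) *\<^sub>v vec (Suc k) (\<lambda>s. z $ Transposition.transpose t k s)"
      using cols_at_swap_mult_vec[of t "L @ [j]" k z A] t z(1) Lj(2) by (simp add: swap v_def)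
    also have "\<dots> = cols_at A L' *\<^sub>v vec k (\<lambda>s. z $ Transposition.transpose t k s) + z $ t \<cdot>\<^sub>v col A (L ! t)"
    proof -
      have "vec k (\<lambda>i. vec (Suc k) (\<lambda>s. z $ Transposition.transpose t k s) $ i) =
          vec k (\<lambda>s. z $ Transposition.transpose t k s)"
        by (rule eq_vecI) auto
      then show ?thesis
        using cols_at_append1_mult_vec[OF A Lq[OF t], of "vec (Suc k) (\<lambda>s. z $ Transposition.transpose t k s)" L'] L'
        by simp
    qed
    finally have le: "cmod (z $ t) * \<beta> \<le> vec_norm2 v"
      unfolding \<beta>_def using L' by (intro coord) auto
    have "gram (L' @ [L ! t]) = gram (L @ [j])"
      using det_gram_swap[of t "L @ [j]" k A] t Lj(2) by (simp add: swap gram_def)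
    then have "of_real (\<beta>\<^sup>2) * gram L' = of_real (\<gamma>\<^sup>2) * gram L"
      using gram_append[of "L ! t" L'] gram_append[OF j, of L] Lq[OF t] by (simp add: \<beta>_def \<gamma>_def M_def)
    then have "Re (of_real (\<beta>\<^sup>2) * gram L') = Re (of_real (\<gamma>\<^sup>2) * gram L)" by simp
    then have "\<gamma>\<^sup>2 * Re (gram L) = \<beta>\<^sup>2 * Re (gram L')" by simp
    also have "\<dots> \<le> \<beta>\<^sup>2 * (2 * Re (gram L))"
      using max[OF t] by (intro mult_left_mono) (auto simp: gram_def L'_def)
    finally have "\<gamma>\<^sup>2 \<le> 2 * \<beta>\<^sup>2" using pos by (simp add: gram_def)
    then have "(cmod (z $ t))\<^sup>2 * \<gamma>\<^sup>2 \<le> (cmod (z $ t))\<^sup>2 * (2 * \<beta>\<^sup>2)" by (rule mult_left_mono) simp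
    also have "\<dots> = 2 * (cmod (z $ t) * \<beta>)\<^sup>2" by (simp add: power_mult_distrib)
    also have "\<dots> \<le> 2 * (vec_norm2 v)\<^sup>2"
      using le by (intro mult_left_mono power_mono) (auto simp: \<beta>_def)
    finally show ?thesis .
  qed
  have "(vec_norm2 z)\<^sup>2 * \<gamma>\<^sup>2 = (\<Sum>t<k. (cmod (z $ t))\<^sup>2 * \<gamma>\<^sup>2) + (cmod (z $ k))\<^sup>2 * \<gamma>\<^sup>2"
    using z(1) by (simp add: vec_norm2_sq sum_distrib_right distrib_right)
  also have "\<dots> \<le> (\<Sum>t<k. 2 * (vec_norm2 v)\<^sup>2) + (vec_norm2 v)\<^sup>2"
    by (intro add_mono sum_mono last other) auto
  also have "\<dots> = (1 + 2 * real k) * (vec_norm2 v)\<^sup>2" by (simp add: algebra_simps)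
  also have "\<dots> \<le> (1 + 2 * real k) * (e * vec_norm2 z)\<^sup>2"
    using v_le by (intro mult_left_mono power_mono) auto
  finally have "(vec_norm2 z)\<^sup>2 * \<gamma>\<^sup>2 \<le> (vec_norm2 z)\<^sup>2 * ((1 + 2 * real k) * e\<^sup>2)"
    by (simp add: power_mult_distrib mult_ac)
  moreover have "0 < (vec_norm2 z)\<^sup>2" using z(1,2) vec_norm2_eq_0[OF z(1)] by simp
  ultimately have "\<gamma>\<^sup>2 \<le> (1 + 2 * real k) * e\<^sup>2" by (simp add: mult_le_cancel_left)
  then have "\<gamma>\<^sup>2 \<le> (sqrt (1 + 2 * real k) * e)\<^sup>2" by (simp add: power_mult_distrib)
  then show ?thesis using D(2) power2_le_imp_le by (auto simp: \<gamma>_def M_def)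
qed

lemma sing_val_decreasing:
  assumes "1 \<le> i"
  shows "sing_val (Suc i) M \<le> sing_val i M \<or> sing_val (Suc i) M = 0"
proof (cases "Suc i \<le> length (singular_values M)")
  case True
  have "sorted (rev (singular_values M))" by (simp add: singular_values_def)
  then have "singular_values M ! i \<le> singular_values M ! (i - 1)"
    using True assms by (simp add: sorted_rev_nth_mono)
  then show ?thesis using True assms by (simp add: sing_val_def)
qed (simp add: sing_val_def)

text \<open>If the sampled columns have a positive \<open>k\<close>-th singular value, the stopping criterion provides the local
  maximality. If they have no positive \<open>k\<close>-th singular value then the \<open>(k+1)\<close>-st one is not
  positive either, and the error bound of the factorization already says that all residuals vanish.\<close>

lemma rrqr_selection_residual:
  assumes A: "A \<in> carrier_mat p q" and C: "set C \<subseteq> {..<q}"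
    and J: "rrqr_selection k (cols_at A C) J" and k: "0 < k" and j: "j < length C"
    and split: "A = B * W + D" "B \<in> carrier_mat p k" "W \<in> carrier_mat k q" "D \<in> carrier_mat p q"
    and D: "op_le D e" "0 \<le> e"
  defines "L \<equiv> map (\<lambda>j. C ! j) J"
  shows "vec_norm2 (residual_projection (cols_at A L) *\<^sub>v col A (C ! j)) \<le> sqrt (1 + 2 * real k) * e"
proof -
  have J': "length J = k" "set J \<subseteq> {..<length C}" using J by (auto simp: rrqr_selection_def)
  have sel: "cols_at (cols_at A C) J = cols_at A L" using J' by (simp add: cols_at_cols_at L_def)
  have Cj: "C ! j < q" if "j < length C" for j using that C nth_mem by blast
  have Lq: "set L \<subseteq> {..<q}" using J' Cj by (auto simp: L_def)
  define M where "M = cols_at A L"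
  have M: "M \<in> carrier_mat p k" using A J' by (auto simp: M_def L_def)
  note P = residual_projection[OF M]
  show ?thesis
  proof (cases "0 < sing_val k (cols_at A C)")
    case True
    show ?thesis
    proof (cases "j \<in> set J")
      case True
      then obtain t where t: "t < k" "J ! t = j" using J' by (auto simp: in_set_conv_nth)
      then have "col M t = col A (C ! j)"
        using J' A Cj[OF j] by (simp add: M_def L_def col_cols_at)
      then show ?thesis using residual_of_own_column[OF M t(1)] D(2) by (simp add: M_def)
    next
      case False
      have vol: "gram_volume (cols_at A L) > 0"
        "\<And>i. i < k \<Longrightarrow> gram_volume (cols_at A (L[i := C ! j])) \<le> sqrt 2 * gram_volume (cols_at A L)"
      proof -
        show "gram_volume (cols_at A L) > 0" using J True sel by (simp add: rrqr_selection_def)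
        fix i assume i: "i < k"
        have "set (J[i := j]) \<subseteq> {..<length C}"
          using J' j set_update_subset_insert[of J i j] by auto
        then have sel': "cols_at (cols_at A C) (J[i := j]) = cols_at A (L[i := C ! j])"
          by (simp add: cols_at_cols_at L_def map_update)
        have "gram_volume (cols_at (cols_at A C) (J[i := j])) \<le> sqrt 2 * gram_volume (cols_at (cols_at A C) J)"
          using J True False i j by (simp add: rrqr_selection_def)
        then show "gram_volume (cols_at A (L[i := C ! j])) \<le> sqrt 2 * gram_volume (cols_at A L)"
          by (simp only: sel sel')
      qed
      show ?thesis
      proof (rule locally_maximal_volume_residual[OF A _ Lq _ Cj[OF j] _ split D])
        show "length L = k" using J' by (simp add: L_def)
        show "0 < Re (Determinant.det (mat_adjoint (cols_at A L) * cols_at A L))"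
          using vol(1) by (simp add: gram_volume_def)
        show "Re (Determinant.det (mat_adjoint (cols_at A (L[i := C ! j])) * cols_at A (L[i := C ! j])))
          \<le> 2 * Re (Determinant.det (mat_adjoint (cols_at A L) * cols_at A L))" if "i < k" for i
          using vol(2)[OF that] by (simp add: gram_volume_def flip: real_sqrt_mult)
      qed
    qed
  next
    case False
    then have "sing_val (k + 1) (cols_at A C) \<le> 0"
      using sing_val_decreasing[of k "cols_at A C"] k by force
    then have "sqrt (1 + 2 * real k * real (length C - k)) * sing_val (k + 1) (cols_at A C) \<le> 0"
      by (simp add: mult_le_0_iff)
    moreover define R where "R = cols_at A C - M * pinv M * cols_at A C"
    have "spectral_norm R \<le> sqrt (1 + 2 * real k * real (length C - k)) * sing_val (k + 1) (cols_at A C)"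
      using J sel by (simp add: rrqr_selection_def M_def R_def)
    ultimately have R0: "spectral_norm R \<le> 0" by simp
    have AC: "cols_at A C \<in> carrier_mat p (length C)" using A by simp
    have MN: "M * pinv M \<in> carrier_mat p p" using M pinv_carrier[OF M] by simp
    have "R = residual_projection M * cols_at A C"
      unfolding R_def residual_projection_def using M MN AC left_mult_one_mat[OF AC]
      by (simp add: minus_mult_distrib_mat[of _ p p _ _ "length C"] del: assoc_mult_mat)
    then have "residual_projection M *\<^sub>v col A (C ! j) = R *\<^sub>v unit_vec (length C) j"
    proof -
      assume R: "R = residual_projection M * cols_at A C"
      have "cols_at A C *\<^sub>v unit_vec (length C) j = col A (C ! j)"
        using A j Cj[OF j] by (intro eq_vecI) auto
      then show ?thesis unfolding R
        using P(1) AC by (simp add: assoc_mult_mat_vec[of _ p p _ "length C"])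
    qed
    moreover have "vec_norm2 (R *\<^sub>v unit_vec (length C) j) \<le> spectral_norm R * vec_norm2 (unit_vec (length C) j)"
      by (rule op_leD[OF op_le_spectral_norm]) (use AC in \<open>auto simp: R_def\<close>)
    ultimately have "vec_norm2 (residual_projection M *\<^sub>v col A (C ! j)) \<le> 0"
      using R0 mult_right_mono[OF R0, of "vec_norm2 (unit_vec (length C) j)"] by simp
    then show ?thesis using D(2) by (simp add: M_def order_trans[OF _ mult_nonneg_nonneg])
  qed
qed

section \<open>A Lieb-Thirring inequality for dyadic powers\<close>

definition tr :: "complex mat \<Rightarrow> complex" where
  "tr M = (\<Sum>i<dim_row M. M $$ (i, i))"

lemma tr_mult:
  "A \<in> carrier_mat n m \<Longrightarrow> B \<in> carrier_mat m n \<Longrightarrow> tr (A * B) = (\<Sum>i<n. \<Sum>j<m. A $$ (i, j) * B $$ (j, i))"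
  by (auto simp: tr_def mult_index_sum simp del: index_mult_mat(1))

lemma tr_mult_commute:
  assumes "A \<in> carrier_mat n m" "B \<in> carrier_mat m n"
  shows "tr (A * B) = tr (B * A)"
  unfolding tr_mult[OF assms] tr_mult[OF assms(2,1)]
  by (subst sum.swap) (simp add: mult.commute)

lemma tr_minus: "A \<in> carrier_mat n n \<Longrightarrow> B \<in> carrier_mat n n \<Longrightarrow> tr (A - B) = tr A - tr B"
  by (auto simp: tr_def sum_subtractf)

lemma tr_smult: "A \<in> carrier_mat n n \<Longrightarrow> tr (a \<cdot>\<^sub>m A) = a * tr A"
  by (auto simp: tr_def sum_distrib_left)

lemma tr_outer: "dim_vec u = dim_vec w \<Longrightarrow> tr (outer u w) = ip u w"
  by (auto simp: tr_def outer_def ip_def)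

lemma tr_mult_adjoint: "tr (A * mat_adjoint A) = of_real (frob_sq A)"
  using tr_mult[of A "dim_row A" "dim_col A" "mat_adjoint A"]
  by (simp add: frob_sq_def complex_norm_square del: of_real_power)

lemma frob_sq_adjoint: "frob_sq (mat_adjoint A) = frob_sq A"
  unfolding frob_sq_def by (subst sum.swap) auto

lemma frob_sq_L2:
  "sqrt (frob_sq A) = L2_set (\<lambda>(i, j). cmod (A $$ (i, j))) ({..<dim_row A} \<times> {..<dim_col A})"
  by (auto simp: frob_sq_def L2_set_def sum.cartesian_product intro!: arg_cong[where f = sqrt] sum.cong)

lemma tr_Cauchy_Schwarz:
  assumes A: "A \<in> carrier_mat n m" and B: "B \<in> carrier_mat m n"
  shows "cmod (tr (A * B)) \<le> sqrt (frob_sq A) * sqrt (frob_sq B)"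
proof -
  have "cmod (tr (A * B)) \<le> (\<Sum>(i, j)\<in>{..<n} \<times> {..<m}. cmod (A $$ (i, j)) * cmod (B $$ (j, i)))"
    unfolding tr_mult[OF A B] sum.cartesian_product
    by (rule order_trans[OF norm_sum]) (auto simp: norm_mult intro!: sum_mono)
  also have "\<dots> = (\<Sum>ij\<in>{..<n} \<times> {..<m}. \<bar>(\<lambda>(i, j). cmod (A $$ (i, j))) ij\<bar> * \<bar>(\<lambda>(i, j). cmod (mat_adjoint B $$ (i, j))) ij\<bar>)"
    using B by (intro sum.cong) auto
  also have "\<dots> \<le> L2_set (\<lambda>(i, j). cmod (A $$ (i, j))) ({..<n} \<times> {..<m}) *
      L2_set (\<lambda>(i, j). cmod (mat_adjoint B $$ (i, j))) ({..<n} \<times> {..<m})"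
    by (rule L2_set_mult_ineq)
  also have "\<dots> = sqrt (frob_sq A) * sqrt (frob_sq (mat_adjoint B))"
    unfolding frob_sq_L2 using A B by simp
  finally show ?thesis by (simp add: frob_sq_adjoint)
qed

text \<open>The power with exponent \<open>2\<^sup>s\<close>. Squaring the argument first is the recursion that the
  induction for the trace inequalities follows.\<close>

fun pow2 :: "nat \<Rightarrow> complex mat \<Rightarrow> complex mat" where
  "pow2 0 A = A"
| "pow2 (Suc s) A = pow2 s (A * A)"

lemma pow2_carrier [simp]: "A \<in> carrier_mat n n \<Longrightarrow> pow2 s A \<in> carrier_mat n n"
  by (induction s arbitrary: A) auto

lemma pow2_Suc': "pow2 (Suc s) A = pow2 s A * pow2 s A"
proof (induction s arbitrary: A)
  case (Suc s)
  show ?case using Suc[of "A * A"] by simp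
qed simp

lemma pow2_adjoint: "A \<in> carrier_mat n n \<Longrightarrow> mat_adjoint (pow2 s A) = pow2 s (mat_adjoint A)"
  by (induction s arbitrary: A) (auto simp: mat_adjoint_mult)

lemma tr_pow2_commute:
  assumes "X \<in> carrier_mat n n" "Y \<in> carrier_mat n n"
  shows "tr (pow2 s (X * Y)) = tr (pow2 s (Y * X))"
  using assms(2)
proof (induction s arbitrary: Y)
  case 0
  then show ?case using tr_mult_commute assms(1) by simp
next
  case (Suc s)
  have "tr (pow2 s (X * (Y * X * Y))) = tr (pow2 s (Y * X * Y * X))"
    by (rule Suc.IH) (use assms(1) Suc.prems in simp)
  moreover have "X * (Y * X * Y) = (X * Y) * (X * Y)" "Y * X * Y * X = (Y * X) * (Y * X)"
    using assms(1) Suc.prems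
    by (simp_all add: assoc_mult_mat[of _ n n _ n _ n])
  ultimately show ?case by simp
qed

text \<open>The second part compares \<open>X\<^sup>2\<^sup>N\<close> with \<open>(X X\<^sup>*)\<^sup>N\<close>, for \<open>N = 2\<^sup>s\<close>. The two parts feed each
  other. Applied to \<open>X = P Q\<close>, the second part and cyclicity of the trace replace the factors \<open>P\<close> and
  \<open>Q\<close> by their squares and halve the exponent, which is the induction step of the first part.
  Applied to the square of \<open>X\<close>, the second part and cyclicity lead to
  a power of the product of the hermitian matrices \<open>X X\<^sup>*\<close> and \<open>X\<^sup>* X\<close>; the first part and the Cauchy-Schwarz inequality
  finish, because powers of these two matrices have the same trace.\<close>

lemma tr_pow2_inequalities:
  "(\<forall>P \<in> carrier_mat n n :: complex mat set. \<forall>Q \<in> carrier_mat n n. mat_adjoint P = P \<longrightarrow> mat_adjoint Q = Q \<longrightarrow>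
      cmod (tr (pow2 s (P * Q))) \<le> cmod (tr (pow2 s P * pow2 s Q))) \<and>
   (\<forall>X \<in> carrier_mat n n. cmod (tr (pow2 (Suc s) X)) \<le> Re (tr (pow2 s (X * mat_adjoint X))))"
proof (induction s)
  case 0
  have "cmod (tr (X * X)) \<le> Re (tr (X * mat_adjoint X))" if "X \<in> carrier_mat n n" for X :: "complex mat"
    using tr_Cauchy_Schwarz[OF that that] frob_sq_nonneg[of X] by (simp add: tr_mult_adjoint)
  then show ?case by simp
next
  case (Suc s)
  then have K: "\<And>P Q. P \<in> carrier_mat n n \<Longrightarrow> Q \<in> carrier_mat n n \<Longrightarrow> mat_adjoint P = P \<Longrightarrow> mat_adjoint Q = Q \<Longrightarrow>
      cmod (tr (pow2 s (P * Q))) \<le> cmod (tr (pow2 s P * pow2 s Q))"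
    and W: "\<And>X. X \<in> carrier_mat n n \<Longrightarrow> cmod (tr (pow2 (Suc s) X)) \<le> Re (tr (pow2 s (X * mat_adjoint X)))"
    by blast+
  show ?case
  proof (intro conjI ballI impI)
    fix P Q :: "complex mat" assume P: "P \<in> carrier_mat n n" "mat_adjoint P = P" and Q: "Q \<in> carrier_mat n n" "mat_adjoint Q = Q"
    have PQ: "P * Q \<in> carrier_mat n n" using P Q by simp
    have "P * Q * mat_adjoint (P * Q) = P * (Q * Q * P)"
      using P Q by (simp add: mat_adjoint_mult assoc_mult_mat[of _ n n _ n _ n])
    moreover have "tr (pow2 s (P * (Q * Q * P))) = tr (pow2 s (Q * Q * P * P))"
      by (rule tr_pow2_commute) (use P Q in auto)
    moreover have "Q * Q * P * P = Q * Q * (P * P)"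
      using P Q by (simp add: assoc_mult_mat[of _ n n _ n _ n])
    moreover have "tr (pow2 s (Q * Q * (P * P))) = tr (pow2 s (P * P * (Q * Q)))"
      by (rule tr_pow2_commute) (use P Q in auto)
    ultimately have "cmod (tr (pow2 (Suc s) (P * Q))) \<le> Re (tr (pow2 s (P * P * (Q * Q))))"
      using W[OF PQ] by simp
    also have "\<dots> \<le> cmod (tr (pow2 s (P * P * (Q * Q))))" by (rule complex_Re_le_cmod)
    also have "\<dots> \<le> cmod (tr (pow2 s (P * P) * pow2 s (Q * Q)))"
      by (rule K) (use P Q in \<open>auto simp: mat_adjoint_mult\<close>)
    finally show "cmod (tr (pow2 (Suc s) (P * Q))) \<le> cmod (tr (pow2 (Suc s) P * pow2 (Suc s) Q))" by simp
  next
    fix X :: "complex mat" assume X: "X \<in> carrier_mat n n"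
    define B where "B = X * mat_adjoint X"
    define C where "C = mat_adjoint X * X"
    have B: "B \<in> carrier_mat n n" "mat_adjoint B = B" using X by (auto simp: B_def mat_adjoint_mult)
    have C: "C \<in> carrier_mat n n" "mat_adjoint C = C" using X by (auto simp: C_def mat_adjoint_mult)
    have XX: "X * X \<in> carrier_mat n n" using X by simp
    have "X * X * mat_adjoint (X * X) = X * (B * mat_adjoint X)"
      using X by (simp add: B_def mat_adjoint_mult assoc_mult_mat[of _ n n _ n _ n])
    moreover have "tr (pow2 s (X * (B * mat_adjoint X))) = tr (pow2 s (B * mat_adjoint X * X))"
      by (rule tr_pow2_commute) (use X B in auto)
    moreover have "B * mat_adjoint X * X = B * C"
      unfolding C_def using X B(1) by (simp add: assoc_mult_mat[of _ n n _ n _ n])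
    ultimately have "cmod (tr (pow2 (Suc s) (X * X))) \<le> Re (tr (pow2 s (B * C)))"
      using W[OF XX] by simp
    also have "\<dots> \<le> cmod (tr (pow2 s (B * C)))" by (rule complex_Re_le_cmod)
    also have "\<dots> \<le> cmod (tr (pow2 s B * pow2 s C))" using K B C by blast
    also have "\<dots> \<le> sqrt (frob_sq (pow2 s B)) * sqrt (frob_sq (pow2 s C))"
      by (rule tr_Cauchy_Schwarz[of _ n n]) (use B C in auto)
    also have "frob_sq (pow2 s B) = Re (tr (pow2 (Suc s) B))"
      using tr_mult_adjoint[of "pow2 s B"] pow2_adjoint[OF B(1), of s] B(2) unfolding pow2_Suc' by simp
    also have "frob_sq (pow2 s C) = Re (tr (pow2 (Suc s) C))"
      using tr_mult_adjoint[of "pow2 s C"] pow2_adjoint[OF C(1), of s] C(2) unfolding pow2_Suc' by simp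
    also have "tr (pow2 (Suc s) C) = tr (pow2 (Suc s) B)"
      unfolding B_def C_def by (rule tr_pow2_commute) (use X in auto)
    also have "sqrt (Re (tr (pow2 (Suc s) B))) * sqrt (Re (tr (pow2 (Suc s) B))) = Re (tr (pow2 (Suc s) B))"
    proof -
      have "0 \<le> Re (tr (pow2 (Suc s) B))"
        using tr_mult_adjoint[of "pow2 s B"] pow2_adjoint[OF B(1), of s] B(2) frob_sq_nonneg[of "pow2 s B"]
        unfolding pow2_Suc' by simp
      then show ?thesis by simp
    qed
    finally show "cmod (tr (pow2 (Suc (Suc s)) X)) \<le> Re (tr (pow2 (Suc s) (X * mat_adjoint X)))"
      by (simp add: B_def)
  qed
qed

text \<open>The trace on the right is real and nonnegative, being the square of the Frobenius norm of a product of two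
  hermitian roots of the factors; this removes the absolute
  value on the right of the first inequality in \<open>tr_pow2_inequalities\<close>.\<close>

lemma tr_pow2_sandwich:
  assumes T: "T \<in> carrier_mat n n" "mat_adjoint T = T" and V: "V \<in> carrier_mat n n" "mat_adjoint V = V"
  shows "Re (tr (pow2 (Suc s) (V * T * V))) \<le> Re (tr (pow2 (Suc s) T * pow2 (Suc (Suc s)) V))"
proof -
  define K where "K = pow2 s T"
  define U where "U = pow2 (Suc s) V"
  have K: "K \<in> carrier_mat n n" "mat_adjoint K = K" using T pow2_adjoint[OF T(1), of s] by (auto simp: K_def)
  have U: "U \<in> carrier_mat n n" "mat_adjoint U = U"
    using V pow2_adjoint[OF V(1), of "Suc s"] pow2_carrier[OF V(1), of "Suc s"] by (auto simp: U_def)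
  have "pow2 (Suc s) T * pow2 (Suc (Suc s)) V = (K * K) * (U * U)"
    using pow2_Suc'[of s T] pow2_Suc'[of "Suc s" V] by (simp add: K_def U_def)
  also have "\<dots> = K * (K * U * U)" using K U by (simp add: assoc_mult_mat[of _ n n _ n _ n])
  also have "tr \<dots> = tr (K * U * U * K)" by (rule tr_mult_commute) (use K U in auto)
  also have "K * U * U * K = (K * U) * mat_adjoint (K * U)"
    using K U by (simp add: mat_adjoint_mult assoc_mult_mat[of _ n n _ n _ n])
  finally have square: "tr (pow2 (Suc s) T * pow2 (Suc (Suc s)) V) = of_real (frob_sq (K * U))"
    by (simp only: tr_mult_adjoint)
  have "tr (pow2 (Suc s) (V * T * V)) = tr (pow2 (Suc s) (T * (V * V)))"
    using tr_pow2_commute[of V n "T * V" "Suc s"] T V by (simp add: assoc_mult_mat[of _ n n _ n _ n])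
  then have "Re (tr (pow2 (Suc s) (V * T * V))) \<le> cmod (tr (pow2 (Suc s) (T * (V * V))))"
    using complex_Re_le_cmod by metis
  also have "\<dots> \<le> cmod (tr (pow2 (Suc s) T * pow2 (Suc s) (V * V)))"
    using tr_pow2_inequalities[of n "Suc s"] T V by (simp add: mat_adjoint_mult)
  also have "pow2 (Suc s) (V * V) = pow2 (Suc (Suc s)) V" by simp
  finally show ?thesis unfolding square using frob_sq_nonneg[of "K * U"] by simp
qed

text \<open>Jensen's inequality in an elementary form: for a hermitian matrix \<open>K\<close> and a unit vector \<open>g\<close>, the form of
  \<open>K\<^sup>2\<close> at \<open>g\<close> is the square of the norm of \<open>K g\<close>, hence at least the square of the form of \<open>K\<close>.\<close>

lemma pow2_form_ge:
  assumes T: "T \<in> carrier_mat n n" "mat_adjoint T = T" and g: "g \<in> carrier_vec n" "vec_norm2 g = 1"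
    and nn: "0 \<le> Re (ip (T *\<^sub>v g) g)"
  shows "Re (ip (T *\<^sub>v g) g) ^ (2 ^ s) \<le> Re (ip (pow2 s T *\<^sub>v g) g)"
proof (induction s)
  case (Suc s)
  define K where "K = pow2 s T"
  have K: "K \<in> carrier_mat n n" "mat_adjoint K = K" using T pow2_adjoint[OF T(1), of s] by (auto simp: K_def)
  have Kg: "K *\<^sub>v g \<in> carrier_vec n" using K g by simp
  have "Re (ip (T *\<^sub>v g) g) ^ (2 ^ Suc s) = (Re (ip (T *\<^sub>v g) g) ^ (2 ^ s))\<^sup>2"
    by (simp add: mult.commute flip: power_mult)
  also have "\<dots> \<le> (Re (ip (K *\<^sub>v g) g))\<^sup>2"
    unfolding K_def by (rule power_mono[OF Suc]) (use nn in simp)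
  also have "\<dots> \<le> (cmod (ip (K *\<^sub>v g) g))\<^sup>2" by (simp add: cmod_power2)
  also have "\<dots> \<le> (vec_norm2 (K *\<^sub>v g))\<^sup>2"
    using ip_Cauchy_Schwarz[of "K *\<^sub>v g" g] K g by (intro power_mono) auto
  also have "\<dots> = Re (ip (K *\<^sub>v g) (K *\<^sub>v g))" by (simp add: ip_self)
  also have "ip (K *\<^sub>v g) (K *\<^sub>v g) = ip (K *\<^sub>v (K *\<^sub>v g)) g"
    using ip_adjoint[OF K(1) Kg g(1)] K(2) by simp
  also have "K *\<^sub>v (K *\<^sub>v g) = pow2 (Suc s) T *\<^sub>v g"
    using K(1) g assoc_mult_mat_vec[of K n n K n g] unfolding pow2_Suc' by (simp add: K_def)
  finally show ?case .
qed simp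

text \<open>For a hermitian root \<open>K\<close> of the power, the trace of \<open>K\<^sup>2\<close> is the square of its Frobenius norm, which dominates
  the norm of \<open>K g\<close>.\<close>

lemma tr_pow2_ge_form:
  assumes T: "T \<in> carrier_mat n n" "mat_adjoint T = T" and g: "g \<in> carrier_vec n" "vec_norm2 g = 1"
    and nn: "0 \<le> Re (ip (T *\<^sub>v g) g)"
  shows "Re (ip (T *\<^sub>v g) g) ^ (2 ^ Suc s) \<le> Re (tr (pow2 (Suc s) T))"
proof -
  define K where "K = pow2 s T"
  have K: "K \<in> carrier_mat n n" "mat_adjoint K = K" using T pow2_adjoint[OF T(1), of s] by (auto simp: K_def)
  have Kg: "K *\<^sub>v g \<in> carrier_vec n" using K g by simp
  have "Re (ip (T *\<^sub>v g) g) ^ (2 ^ Suc s) \<le> Re (ip (pow2 (Suc s) T *\<^sub>v g) g)"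
    by (rule pow2_form_ge[OF assms])
  also have "pow2 (Suc s) T *\<^sub>v g = K *\<^sub>v (K *\<^sub>v g)"
    using K(1) g assoc_mult_mat_vec[of K n n K n g] unfolding pow2_Suc' by (simp add: K_def)
  also have "ip (K *\<^sub>v (K *\<^sub>v g)) g = ip (K *\<^sub>v g) (K *\<^sub>v g)"
    using ip_adjoint[OF K(1) Kg g(1)] K(2) by simp
  also have "Re \<dots> = (vec_norm2 (K *\<^sub>v g))\<^sup>2" by (simp add: ip_self)
  also have "\<dots> \<le> frob_sq K" using frob_sq_mult_vec[of g K] g K by simp
  also have "\<dots> = Re (tr (pow2 (Suc s) T))"
    using tr_mult_adjoint[of K] K(2) unfolding pow2_Suc' by (simp add: K_def)
  finally show ?thesis .
qed

section \<open>Products of damping factors\<close>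

fun sandwich :: "nat \<Rightarrow> (nat \<Rightarrow> complex mat) \<Rightarrow> nat list \<Rightarrow> complex mat" where
  "sandwich k V [] = 1\<^sub>m k"
| "sandwich k V (x # xs) = V x * sandwich k V xs * V x"

text \<open>Applying the right half of the sandwich to a vector, one factor after the other.\<close>

fun walk :: "(nat \<Rightarrow> complex mat) \<Rightarrow> nat list \<Rightarrow> complex Matrix.vec \<Rightarrow> complex Matrix.vec" where
  "walk V [] g = g"
| "walk V (x # xs) g = walk V xs (V x *\<^sub>v g)"

lemma sandwich_hermitian:
  assumes "\<And>x. V x \<in> carrier_mat k k" "\<And>x. mat_adjoint (V x) = V x"
  shows "sandwich k V xs \<in> carrier_mat k k \<and> mat_adjoint (sandwich k V xs) = sandwich k V xs"
proof (induction xs)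
  case (Cons x xs)
  have S: "sandwich k V xs \<in> carrier_mat k k" "mat_adjoint (sandwich k V xs) = sandwich k V xs"
    using Cons by auto
  have "mat_adjoint (V x * sandwich k V xs * V x) = V x * (sandwich k V xs * V x)"
    using assms(1)[of x] assms(2)[of x] S by (simp add: mat_adjoint_mult)
  also have "\<dots> = V x * sandwich k V xs * V x"
    using assms(1)[of x] S assoc_mult_mat[of "V x" k k "sandwich k V xs" k "V x" k] by simp
  finally show ?case using assms(1)[of x] S by simp
qed simp

lemma walk_carrier:
  "(\<And>x. V x \<in> carrier_mat k k) \<Longrightarrow> g \<in> carrier_vec k \<Longrightarrow> walk V xs g \<in> carrier_vec k"
  by (induction xs arbitrary: g) (simp_all add: mult_mat_vec_carrier[of _ k k])

lemma sandwich_form: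
  assumes "\<And>x. V x \<in> carrier_mat k k" "\<And>x. mat_adjoint (V x) = V x" "g \<in> carrier_vec k"
  shows "ip (sandwich k V xs *\<^sub>v g) g = of_real ((vec_norm2 (walk V xs g))\<^sup>2)"
  using assms(3)
proof (induction xs arbitrary: g)
  case (Cons x xs)
  have T: "sandwich k V xs \<in> carrier_mat k k" using sandwich_hermitian[of V k xs, OF assms(1,2)] by simp
  have Vg: "V x *\<^sub>v g \<in> carrier_vec k" using assms(1)[of x] Cons.prems by simp
  have TVg: "sandwich k V xs *\<^sub>v (V x *\<^sub>v g) \<in> carrier_vec k" using T Vg by simp
  have "V x * sandwich k V xs * V x *\<^sub>v g = V x *\<^sub>v (sandwich k V xs *\<^sub>v (V x *\<^sub>v g))"
    using assms(1)[of x] T Cons.prems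
      assoc_mult_mat_vec[of "V x * sandwich k V xs" k k "V x" k g]
      assoc_mult_mat_vec[of "V x" k k "sandwich k V xs" k "V x *\<^sub>v g"] Vg by simp
  then have "ip (sandwich k V (x # xs) *\<^sub>v g) g = ip (sandwich k V xs *\<^sub>v (V x *\<^sub>v g)) (V x *\<^sub>v g)"
    using ip_adjoint[OF assms(1)[of x] TVg Cons.prems] assms(2)[of x] by simp
  then show ?case using Cons.IH[OF Vg] by simp
qed (simp add: ip_self)

text \<open>Acts as the scalar \<open>1 - c \<parallel>y\<parallel>\<^sup>2\<close> on the direction of \<open>y\<close>, and as the identity on its orthogonal complement.\<close>

definition damp :: "nat \<Rightarrow> real \<Rightarrow> complex Matrix.vec \<Rightarrow> complex mat" where
  "damp k c y = 1\<^sub>m k - of_real c \<cdot>\<^sub>m outer y y"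

lemma damp_carrier [simp]: "y \<in> carrier_vec k \<Longrightarrow> damp k c y \<in> carrier_mat k k"
  unfolding damp_def by (intro minus_carrier_mat smult_carrier_mat outer_carrier)

lemma damp_adjoint [simp]: "y \<in> carrier_vec k \<Longrightarrow> mat_adjoint (damp k c y) = damp k c y"
  unfolding damp_def by (subst mat_adjoint_minus[of _ k k]) (auto simp: mat_adjoint_smult)

lemma damp_mult_vec:
  assumes "y \<in> carrier_vec k" "w \<in> carrier_vec k"
  shows "damp k c y *\<^sub>v w = w - (of_real c * ip w y) \<cdot>\<^sub>v y"
proof -
  have "damp k c y *\<^sub>v w = 1\<^sub>m k *\<^sub>v w - (of_real c \<cdot>\<^sub>m outer y y) *\<^sub>v w"
    unfolding damp_def using assms by (intro minus_mult_distrib_mat_vec[of _ k k]) auto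
  also have "(of_real c \<cdot>\<^sub>m outer y y) *\<^sub>v w = outer (of_real c \<cdot>\<^sub>v y) y *\<^sub>v w"
    by (simp add: outer_smult_left)
  also have "\<dots> = ip w y \<cdot>\<^sub>v (of_real c \<cdot>\<^sub>v y)" using assms by (intro outer_mult_vec) auto
  finally show ?thesis using assms by (simp add: smult_smult_assoc mult.commute)
qed

lemma damp_square:
  assumes y: "y \<in> carrier_vec k"
  shows "damp k a y * damp k a y = damp k (2 * a - a\<^sup>2 * (vec_norm2 y)\<^sup>2) y"
proof -
  have O: "outer y y \<in> carrier_mat k k" using y by simp
  define b where "b = 2 * a - a\<^sup>2 * (vec_norm2 y)\<^sup>2"
  have "damp k a y * damp k a y = damp k a y - of_real a \<cdot>\<^sub>m (outer (damp k a y *\<^sub>v y) y)"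
  proof -
    define X where "X = complex_of_real a \<cdot>\<^sub>m outer y y"
    have X: "X \<in> carrier_mat k k" using O by (simp add: X_def)
    have "damp k a y * (1\<^sub>m k - X) = damp k a y * 1\<^sub>m k - damp k a y * X"
      by (rule mult_minus_distrib_mat[OF damp_carrier[OF y] _ X]) simp
    then have "damp k a y * damp k a y = damp k a y * 1\<^sub>m k - damp k a y * (of_real a \<cdot>\<^sub>m outer y y)"
      by (metis X_def damp_def)
    then show ?thesis using y O damp_carrier[OF y, of a] mult_smult_distrib[OF damp_carrier[OF y, of a] O]
      right_mult_one_mat[OF damp_carrier[OF y, of a]]
      by (simp add: mult_outer carrier_matD(2)[OF damp_carrier[OF y]])
  qed
  also have "damp k a y *\<^sub>v y = (1 - of_real (a * (vec_norm2 y)\<^sup>2)) \<cdot>\<^sub>v y"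
    using y by (simp add: damp_mult_vec ip_self) (auto intro!: eq_vecI simp: algebra_simps)
  also have "damp k a y - of_real a \<cdot>\<^sub>m outer ((1 - of_real (a * (vec_norm2 y)\<^sup>2)) \<cdot>\<^sub>v y) y = damp k b y"
    unfolding damp_def outer_smult_left
    by (rule eq_matI) (use y in \<open>auto simp: b_def outer_def algebra_simps power2_eq_square\<close>)
  finally show ?thesis by (simp add: b_def)
qed

lemma pow2_damp:
  assumes y: "y \<in> carrier_vec k"
  shows "\<exists>b. pow2 s (damp k a y) = damp k b y \<and> 1 - b * (vec_norm2 y)\<^sup>2 = (1 - a * (vec_norm2 y)\<^sup>2) ^ (2 ^ s)"
proof (induction s arbitrary: a)
  case (Suc s)
  define a' where "a' = 2 * a - a\<^sup>2 * (vec_norm2 y)\<^sup>2"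
  obtain b where b: "pow2 s (damp k a' y) = damp k b y"
    "1 - b * (vec_norm2 y)\<^sup>2 = (1 - a' * (vec_norm2 y)\<^sup>2) ^ (2 ^ s)" using Suc by blast
  have "1 - a' * (vec_norm2 y)\<^sup>2 = (1 - a * (vec_norm2 y)\<^sup>2)\<^sup>2"
    by (simp add: a'_def power2_eq_square algebra_simps)
  then have "(1 - a' * (vec_norm2 y)\<^sup>2) ^ (2 ^ s) = (1 - a * (vec_norm2 y)\<^sup>2) ^ (2 ^ Suc s)"
    by (simp flip: power_mult)
  then show ?case using b damp_square[OF y, of a] by (intro exI[of _ b]) (simp add: a'_def)
qed auto

text \<open>Multiply \<open>(1 - x)\<^sup>n\<close> by \<open>(1 + x)\<^sup>n\<close>, which is at least \<open>1 + n x\<close>.\<close>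

lemma bernoulli_decay:
  fixes x :: real
  assumes "0 \<le> x" "x \<le> 1"
  shows "(1 - x) ^ n * (1 + real n * x) \<le> 1"
proof -
  have "(1 - x) ^ n * (1 + real n * x) \<le> (1 - x) ^ n * (1 + x) ^ n"
    using assms Bernoulli_inequality[of x n] by (intro mult_left_mono) auto
  also have "\<dots> = (1 - x\<^sup>2) ^ n" by (simp add: power2_eq_square algebra_simps flip: power_mult_distrib)
  also have "\<dots> \<le> 1" using assms by (intro power_le_one) (auto simp: power_le_one)
  finally show ?thesis .
qed

text \<open>By \<open>tr_pow2_sandwich\<close> one may damp the power \<open>H\<close> instead of \<open>T\<close>, at the price of raising the damping factor to the
  power \<open>2 p\<close> where \<open>p = 2\<^sup>s\<^sup>+\<^sup>1\<close>. That matrix is again a damping factor, and the trace decreases by its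
  strength times the value at \<open>y\<close> of the form of \<open>H\<close>. The strength is not much smaller than the
  first-order value \<open>2 p c\<close>: with \<open>p c \<parallel>y\<parallel>\<^sup>2 \<le> 1\<close>, \<open>bernoulli_decay\<close> loses at most a factor 3.\<close>

lemma damped_trace_decrease:
  assumes T: "T \<in> carrier_mat k k" "mat_adjoint T = T" and y: "y \<in> carrier_vec k"
    and c: "0 \<le> c" "c * 2 ^ Suc s * (vec_norm2 y)\<^sup>2 \<le> 1"
  defines "H \<equiv> pow2 (Suc s) T"
  shows "Re (tr (pow2 (Suc s) (damp k c y * T * damp k c y))) \<le>
    Re (tr H) - 2 / 3 * (c * 2 ^ Suc s) * Re (ip (H *\<^sub>v y) y)"
proof -
  define \<nu> where "\<nu> = (vec_norm2 y)\<^sup>2"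
  define p :: real where "p = 2 ^ Suc s"
  define K where "K = pow2 s T"
  have K: "K \<in> carrier_mat k k" "mat_adjoint K = K" using T pow2_adjoint[OF T(1), of s] by (auto simp: K_def)
  have H: "H \<in> carrier_mat k k" using T(1) pow2_carrier[of T k "Suc s"] by (simp add: H_def)
  have Ky: "K *\<^sub>v y \<in> carrier_vec k" using K y by simp
  have form: "Re (ip (H *\<^sub>v y) y) = (vec_norm2 (K *\<^sub>v y))\<^sup>2"
  proof -
    have "H *\<^sub>v y = K *\<^sub>v (K *\<^sub>v y)"
      using K(1) y assoc_mult_mat_vec[of K k k K k y] unfolding H_def pow2_Suc' by (simp add: K_def)
    then show ?thesis using ip_adjoint[OF K(1) Ky y] K(2) by (simp add: ip_self)
  qed
  obtain b where b: "pow2 (Suc (Suc s)) (damp k c y) = damp k b y" "1 - b * \<nu> = (1 - c * \<nu>) ^ (2 ^ Suc (Suc s))"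
    using pow2_damp[OF y, of "Suc (Suc s)" c] unfolding \<nu>_def by blast
  have "Re (tr (pow2 (Suc s) (damp k c y * T * damp k c y))) \<le> Re (tr (H * damp k b y))"
    using tr_pow2_sandwich[OF T damp_carrier[OF y, of c] damp_adjoint[OF y, of c], of s] b(1) by (simp only: H_def)
  also have "H * damp k b y = H - of_real b \<cdot>\<^sub>m outer (H *\<^sub>v y) y"
    using H y mult_minus_distrib_mat[of H k k "1\<^sub>m k" k "of_real b \<cdot>\<^sub>m outer y y"]
      mult_smult_distrib[OF H, of "outer y y" k] right_mult_one_mat[OF H]
    by (simp add: damp_def mult_outer)
  also have "Re (tr (H - of_real b \<cdot>\<^sub>m outer (H *\<^sub>v y) y)) = Re (tr H) - b * (vec_norm2 (K *\<^sub>v y))\<^sup>2"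
    using H y form by (simp add: tr_minus[of _ k] tr_smult[of _ k] tr_outer)
  also have "\<dots> \<le> Re (tr H) - 2 / 3 * (c * p) * (vec_norm2 (K *\<^sub>v y))\<^sup>2"
  proof (cases "\<nu> = 0")
    case True
    then have "y = 0\<^sub>v k" using vec_norm2_eq_0[OF y] by (simp add: \<nu>_def)
    then have "K *\<^sub>v y = 0\<^sub>v k" using K(1) by auto
    then show ?thesis by simp
  next
    case False
    then have \<nu>: "\<nu> > 0" by (simp add: \<nu>_def)
    define x where "x = c * \<nu>"
    have p: "p \<ge> 1" using one_le_power[of "2::real" "Suc s"] by (simp add: p_def)
    have x0: "0 \<le> x" using c \<nu> by (simp add: x_def)
    have px: "p * x \<le> 1" using c(2) by (simp add: x_def p_def \<nu>_def mult_ac)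
    have x1: "x \<le> 1" using mult_right_mono[OF p x0] px by simp
    have "(1 - b * \<nu>) * (1 + 2 * p * x) \<le> 1"
      using bernoulli_decay[OF x0 x1, of "2 ^ Suc (Suc s)"] unfolding b(2) by (simp add: x_def p_def)
    then have *: "2 * p * x \<le> b * \<nu> * (1 + 2 * p * x)" by (simp add: algebra_simps)
    have "b * \<nu> \<ge> 0"
    proof (rule ccontr)
      assume "\<not> 0 \<le> b * \<nu>"
      moreover have "0 < 1 + 2 * p * x" using p x0 by (intro add_pos_nonneg) auto
      ultimately have "b * \<nu> * (1 + 2 * p * x) < 0" by (intro mult_neg_pos[of "b * \<nu>"]) auto
      moreover have "0 \<le> 2 * p * x" using p x0 by simp
      ultimately show False using * by linarith
    qed
    then have "b * \<nu> * (1 + 2 * p * x) \<le> b * \<nu> * 3" using px by (intro mult_left_mono) auto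
    with * have "2 * p * x \<le> 3 * (b * \<nu>)" by simp
    then have "(2 / 3 * (c * p)) * \<nu> \<le> b * \<nu>" by (simp add: x_def field_simps)
    then have "2 / 3 * (c * p) \<le> b" using \<nu> by (simp add: mult_le_cancel_right)
    then have "2 / 3 * (c * p) * (vec_norm2 (K *\<^sub>v y))\<^sup>2 \<le> b * (vec_norm2 (K *\<^sub>v y))\<^sup>2"
      by (rule mult_right_mono) simp
    then show ?thesis by simp
  qed
  finally show ?thesis unfolding form by (simp add: p_def)
qed

text \<open>The iteration is that of the least mean squares method started at \<open>w\<close> and compared with \<open>g\<close>: the vector moves along \<open>y\<close> in
  proportion to its inner product \<open>e\<close> with \<open>y\<close>. If \<open>v\<close> is the inner product of \<open>g\<close> with
  \<open>y\<close>, the square of the distance to \<open>g\<close> grows by at most \<open>c (|v|\<^sup>2 - |e - v|\<^sup>2)\<close>. There is no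
  accumulation of errors: the contributions \<open>|v|\<^sup>2\<close> refer to \<open>g\<close> itself and not to the moving vector.\<close>

lemma walk_displacement:
  assumes y: "\<And>x. y x \<in> carrier_vec k" and c: "0 \<le> c"
    and small: "\<And>x. x \<in> set xs \<Longrightarrow> c * (vec_norm2 (y x))\<^sup>2 \<le> 1"
    and w: "w \<in> carrier_vec k" and g: "g \<in> carrier_vec k"
  shows "(vec_norm2 (walk (\<lambda>x. damp k c (y x)) xs w - g))\<^sup>2 \<le>
    (vec_norm2 (w - g))\<^sup>2 + c * (\<Sum>x\<leftarrow>xs. (cmod (ip g (y x)))\<^sup>2)"
  using small w
proof (induction xs arbitrary: w)
  case (Cons x xs)
  define d where "d = w - g"
  define e where "e = ip w (y x)"
  define v where "v = ip g (y x)"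
  define w' where "w' = damp k c (y x) *\<^sub>v w"
  have d: "d \<in> carrier_vec k" using Cons.prems g by (simp add: d_def)
  have w': "w' \<in> carrier_vec k" unfolding w'_def by (rule mult_mat_vec_carrier[OF damp_carrier[OF y]]) (use Cons.prems in simp)
  have w'g: "w' - g = d - (of_real c * e) \<cdot>\<^sub>v y x"
    using Cons.prems g y[of x] by (auto simp: w'_def damp_mult_vec d_def e_def)
  have dy: "ip d (y x) = e - v" using Cons.prems g by (simp add: d_def e_def v_def ip_minus_left)
  have ce: "(of_real c * e) \<cdot>\<^sub>v y x \<in> carrier_vec k" using y[of x] by simp
  have "of_real ((vec_norm2 (w' - g))\<^sup>2) = ip (d - (of_real c * e) \<cdot>\<^sub>v y x) (d - (of_real c * e) \<cdot>\<^sub>v y x)"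
    by (simp only: w'g ip_self)
  also have "\<dots> = ip d d - of_real c * cnj e * (e - v) - of_real c * e * cnj (e - v)
      + of_real c * e * (of_real c * cnj e) * of_real ((vec_norm2 (y x))\<^sup>2)"
  proof -
    define z where "z = (of_real c * e) \<cdot>\<^sub>v y x"
    have z: "z \<in> carrier_vec k" using y[of x] by (simp add: z_def)
    have zl: "ip z a = of_real c * e * ip (y x) a" for a by (simp add: z_def ip_smult_left)
    have zr: "ip a z = of_real c * cnj e * ip a (y x)" if "a \<in> carrier_vec k" for a
      using ip_sym[of a z] ip_sym[of a "y x"] that z y[of x] by (simp add: zl)
    have "ip (y x) d = cnj (e - v)" using ip_sym[of "y x" d] d y[of x] dy by simp
    moreover have "ip (d - z) (d - z) = ip d d - ip d z - (ip z d - ip z z)"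
      using d z by (simp add: ip_minus_left[of _ k] ip_minus_right[of _ k])
    ultimately have "ip (d - z) (d - z) = ip d d - of_real c * cnj e * (e - v) - of_real c * e * cnj (e - v)
      + of_real c * e * (of_real c * cnj e) * ip (y x) (y x)"
      using zr[OF d] zr[OF y[of x]] by (simp add: zl dy)
    then show ?thesis by (simp only: z_def ip_self[of "y x"])
  qed
  finally have eq: "of_real ((vec_norm2 (w' - g))\<^sup>2) = of_real ((vec_norm2 d)\<^sup>2) - of_real c * cnj e * (e - v) - of_real c * e * cnj (e - v)
      + of_real c * e * (of_real c * cnj e) * complex_of_real ((vec_norm2 (y x))\<^sup>2)" by (simp only: ip_self)
  have cmod_sq: "(cmod a)\<^sup>2 = Re a * Re a + Im a * Im a" for a
    by (metis cmod_power2 power2_eq_square)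
  have "(vec_norm2 (w' - g))\<^sup>2 = (vec_norm2 d)\<^sup>2 - c * (2 * (cmod e)\<^sup>2 - 2 * Re (cnj e * v))
      + c * (cmod e)\<^sup>2 * (c * (vec_norm2 (y x))\<^sup>2)"
  proof -
    define a1 a2 a3 where "a1 = (vec_norm2 (w' - g))\<^sup>2" and "a2 = (vec_norm2 d)\<^sup>2" and "a3 = (vec_norm2 (y x))\<^sup>2"
    show ?thesis
      using arg_cong[OF eq, of Re] unfolding cmod_sq a1_def[symmetric] a2_def[symmetric] a3_def[symmetric]
      by (simp add: algebra_simps)
  qed
  also have "\<dots> \<le> (vec_norm2 d)\<^sup>2 - c * (2 * (cmod e)\<^sup>2 - 2 * Re (cnj e * v)) + c * (cmod e)\<^sup>2 * 1"
    using Cons.prems(1)[of x] c by (intro add_left_mono mult_left_mono) auto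
  also have "\<dots> = (vec_norm2 d)\<^sup>2 + c * ((cmod v)\<^sup>2 - (cmod (e - v))\<^sup>2)"
    unfolding cmod_sq by (simp add: algebra_simps)
  also have "\<dots> \<le> (vec_norm2 d)\<^sup>2 + c * (cmod v)\<^sup>2"
    using c by (intro add_left_mono mult_left_mono) auto
  finally have "(vec_norm2 (w' - g))\<^sup>2 \<le> (vec_norm2 d)\<^sup>2 + c * (cmod v)\<^sup>2" .
  moreover have "(vec_norm2 (walk (\<lambda>x. damp k c (y x)) xs w' - g))\<^sup>2 \<le>
    (vec_norm2 (w' - g))\<^sup>2 + c * (\<Sum>x\<leftarrow>xs. (cmod (ip g (y x)))\<^sup>2)"
    by (rule Cons.IH[OF _ w']) (use Cons.prems in auto)
  ultimately show ?case by (simp add: w'_def d_def v_def algebra_simps)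
qed simp

section \<open>Independent uniform samples\<close>

lemma finite_set_sample_indices: "0 < q \<Longrightarrow> finite (set_pmf (sample_indices l q))"
  by (simp add: sample_indices_def set_replicate_pmf lessThan_empty_iff lists_eq_set finite_lists_length_eq)

lemma set_sample_indices:
  "0 < q \<Longrightarrow> C \<in> set_pmf (sample_indices l q) \<Longrightarrow> length C = l \<and> set C \<subseteq> {..<q}"
  by (auto simp: sample_indices_def set_replicate_pmf lessThan_empty_iff)

lemma expectation_sample_indices_Suc:
  assumes "0 < q"
  shows "measure_pmf.expectation (sample_indices (Suc l) q) F =
    measure_pmf.expectation (sample_indices l q) (\<lambda>xs. (\<Sum>x<q. F (x # xs)) / real q)"
proof -
  have int: "integrable (measure_pmf (sample_indices l q)) f" for f :: "nat list \<Rightarrow> real"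
    by (rule integrable_measure_pmf_finite[OF finite_set_sample_indices[OF assms]])
  have "sample_indices (Suc l) q = pmf_of_set {..<q} \<bind> (\<lambda>x. map_pmf (\<lambda>xs. x # xs) (sample_indices l q))"
    by (simp add: sample_indices_def map_pmf_def)
  then have "measure_pmf.expectation (sample_indices (Suc l) q) F =
    (\<Sum>x<q. measure_pmf.expectation (map_pmf (\<lambda>xs. x # xs) (sample_indices l q)) F /\<^sub>R real (card {..<q}))"
    using assms finite_set_sample_indices[OF assms]
    by (simp only:) (rule pmf_expectation_bind_pmf_of_set, auto)
  also have "\<dots> = (\<Sum>x<q. measure_pmf.expectation (sample_indices l q) (\<lambda>xs. F (x # xs))) / real q"
    by (simp add: divide_inverse sum_distrib_left mult.commute)
  also have "\<dots> = measure_pmf.expectation (sample_indices l q) (\<lambda>xs. (\<Sum>x<q. F (x # xs)) / real q)"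
    using int by (simp add: Bochner_Integration.integral_sum)
  finally show ?thesis .
qed

text \<open>The list is built by putting a new independent sample in front, so the hypothesis is a bound for the conditional expectation
  given the tail, and it is used once for each of the \<open>l\<close> samples.\<close>

lemma expectation_sample_indices_le:
  assumes q: "0 < q" and r: "0 \<le> r" and step: "\<And>xs. (\<Sum>x<q. F (x # xs)) \<le> real q * r * F xs"
  shows "measure_pmf.expectation (sample_indices l q) F \<le> r ^ l * F []"
  using step
proof (induction l)
  case 0
  then show ?case by (simp add: sample_indices_def)
next
  case (Suc l)
  have int: "integrable (measure_pmf (sample_indices l q)) f" for f :: "nat list \<Rightarrow> real"
    by (rule integrable_measure_pmf_finite[OF finite_set_sample_indices[OF q]])
  have "measure_pmf.expectation (sample_indices (Suc l) q) F \<le>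
    measure_pmf.expectation (sample_indices l q) (\<lambda>xs. r * F xs)"
    unfolding expectation_sample_indices_Suc[OF q]
    by (rule integral_mono[OF int int]) (use step q in \<open>auto simp: field_simps\<close>)
  also have "\<dots> = r * measure_pmf.expectation (sample_indices l q) F" by simp
  also have "\<dots> \<le> r * (r ^ l * F [])" by (rule mult_left_mono[OF Suc.IH[OF Suc.prems] r])
  finally show ?case by (simp add: mult_ac)
qed

text \<open>Markov's inequality.\<close>

lemma prob_sample_indices_le:
  assumes q: "0 < q" and F: "\<And>xs. 0 \<le> F xs"
    and large: "\<And>C. C \<in> S \<Longrightarrow> length C = l \<Longrightarrow> set C \<subseteq> {..<q} \<Longrightarrow> t \<le> F C"
  shows "measure_pmf.prob (sample_indices l q) S * t \<le> measure_pmf.expectation (sample_indices l q) F"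
proof -
  have int: "integrable (measure_pmf (sample_indices l q)) f" for f :: "nat list \<Rightarrow> real"
    by (rule integrable_measure_pmf_finite[OF finite_set_sample_indices[OF q]])
  have "measure_pmf.prob (sample_indices l q) S * t = measure_pmf.expectation (sample_indices l q) (\<lambda>C. indicator S C * t)"
    by simp
  also have "\<dots> \<le> measure_pmf.expectation (sample_indices l q) F"
    by (rule integral_mono_AE[OF int int])
      (use F large set_sample_indices[OF q] in \<open>auto simp: AE_measure_pmf_iff indicator_def\<close>)
  finally show ?thesis .
qed

section \<open>Random rows of a coherent isometry\<close>

text \<open>The conjugate of a row, so that the entries of \<open>Y g\<close> are inner products \<open>ip g\<close> with these vectors.\<close>

definition frame_vec :: "complex mat \<Rightarrow> nat \<Rightarrow> complex Matrix.vec" where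
  "frame_vec Y x = vec (dim_col Y) (\<lambda>j. cnj (Y $$ (x, j)))"

lemma frame_vec_carrier [simp]: "Y \<in> carrier_mat q k \<Longrightarrow> frame_vec Y x \<in> carrier_vec k"
  by (auto simp: frame_vec_def)

lemma ip_frame_vec:
  "Y \<in> carrier_mat q k \<Longrightarrow> g \<in> carrier_vec k \<Longrightarrow> x < q \<Longrightarrow> ip g (frame_vec Y x) = (Y *\<^sub>v g) $ x"
  by (auto simp: ip_def frame_vec_def mult_vec_index_sum mult.commute simp del: index_mult_mat_vec)

text \<open>The outer products of the conjugated rows add up to the identity, since the columns of \<open>Y\<close> are orthonormal.\<close>

lemma sum_frame_forms:
  assumes Y: "Y \<in> carrier_mat q k" "mat_adjoint Y * Y = 1\<^sub>m k" and H: "H \<in> carrier_mat k k"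
  shows "(\<Sum>x<q. ip (H *\<^sub>v frame_vec Y x) (frame_vec Y x)) = tr H"
proof -
  have orth: "(\<Sum>x<q. Y $$ (x, a) * cnj (Y $$ (x, b))) = (if a = b then 1 else 0)" if "a < k" "b < k" for a b
  proof -
    have "(mat_adjoint Y * Y) $$ (b, a) = (\<Sum>x<q. cnj (Y $$ (x, b)) * Y $$ (x, a))"
      using Y(1) that by (simp add: mult_index_sum del: index_mult_mat(1))
    then show ?thesis using Y(2) that by (auto simp: mult.commute split: if_splits)
  qed
  have "(\<Sum>x<q. ip (H *\<^sub>v frame_vec Y x) (frame_vec Y x)) =
    (\<Sum>x<q. \<Sum>a<k. \<Sum>b<k. H $$ (a, b) * (Y $$ (x, a) * cnj (Y $$ (x, b))))"
    using Y(1) H by (auto simp: ip_def frame_vec_def mult_vec_index_sum sum_distrib_left sum_distrib_right mult_ac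
        simp del: index_mult_mat_vec intro!: sum.cong)
  also have "\<dots> = (\<Sum>a<k. \<Sum>x<q. \<Sum>b<k. H $$ (a, b) * (Y $$ (x, a) * cnj (Y $$ (x, b))))"
    by (rule sum.swap)
  also have "\<dots> = (\<Sum>a<k. \<Sum>b<k. \<Sum>x<q. H $$ (a, b) * (Y $$ (x, a) * cnj (Y $$ (x, b))))"
    by (intro sum.cong refl sum.swap)
  also have "\<dots> = (\<Sum>a<k. \<Sum>b<k. H $$ (a, b) * (if a = b then 1 else 0))"
    by (intro sum.cong refl) (simp add: orth flip: sum_distrib_left)
  also have "\<dots> = tr H" using H by (simp add: tr_def if_distrib cong: if_cong)
  finally show ?thesis .
qed

lemma coherence_ge_one:
  assumes Y: "Y \<in> carrier_mat q k" "mat_adjoint Y * Y = 1\<^sub>m k" and k: "0 < k"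
    and coh: "\<And>i j. i < q \<Longrightarrow> j < k \<Longrightarrow> cmod (Y $$ (i, j)) \<le> sqrt (\<mu> / real q)"
  shows "0 < q \<and> 1 \<le> \<mu>"
proof -
  have "1 = (mat_adjoint Y * Y) $$ (0, 0)" using Y(2) k by simp
  also have "\<dots> = (\<Sum>x<q. cnj (Y $$ (x, 0)) * Y $$ (x, 0))"
    using Y(1) k by (simp add: mult_index_sum del: index_mult_mat(1))
  also have "\<dots> = of_real (\<Sum>x<q. (cmod (Y $$ (x, 0)))\<^sup>2)"
    by (simp add: complex_norm_square mult.commute del: of_real_power)
  finally have one: "(\<Sum>x<q. (cmod (Y $$ (x, 0)))\<^sup>2) = 1" by (metis of_real_eq_1_iff)
  then have q: "0 < q" by (cases q) auto
  have \<mu>: "0 \<le> \<mu>"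
  proof (rule ccontr)
    assume "\<not> 0 \<le> \<mu>"
    then have "sqrt (\<mu> / real q) < 0" using q by (simp add: divide_less_0_iff)
    then show False using coh[OF q k] norm_ge_zero[of "Y $$ (0, 0)"] by linarith
  qed
  have "(cmod (Y $$ (x, 0)))\<^sup>2 \<le> \<mu> / real q" if "x < q" for x
    using power_mono[OF coh[OF that k], of 2] \<mu> by simp
  then have "(\<Sum>x<q. (cmod (Y $$ (x, 0)))\<^sup>2) \<le> (\<Sum>x<q. \<mu> / real q)" by (intro sum_mono) auto
  then show ?thesis using one q by simp
qed

lemma dyadic_between:
  fixes a :: real
  assumes "1 < a"
  shows "\<exists>s. a \<le> 2 ^ Suc s \<and> 2 ^ Suc s \<le> 2 * a"
proof -
  obtain n0 where n0: "a \<le> 2 ^ n0"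
    using real_arch_pow[of 2 a] by (auto intro: less_imp_le)
  define n where "n = (LEAST n. a \<le> 2 ^ n)"
  have n: "a \<le> 2 ^ n" unfolding n_def by (rule LeastI[of _ n0]) (rule n0)
  have "n \<noteq> 0" using n assms by (intro notI) simp
  then obtain s where s: "n = Suc s" using not0_implies_Suc by blast
  have "\<not> a \<le> 2 ^ s" using not_less_Least[of s "\<lambda>n. a \<le> 2 ^ n"] s by (simp add: n_def)
  then show ?thesis using n s by (intro exI[of _ s]) auto
qed

text \<open>Let \<open>\<Lambda> = l / (k \<mu>)\<close>, which is at least \<open>10 ln m\<close>; coherence bounds the squares of the norms of the rows by
  \<open>k \<mu> / q\<close>. The damping strength \<open>c\<close> is chosen such that \<open>c p k \<mu> / q = 1\<close>, where \<open>p\<close> is a power of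
  2 between \<open>\<Lambda>\<close> and \<open>2 \<Lambda>\<close>, and \<open>F\<close> is the trace of the \<open>p\<close>-th power of the product.

  Each sample multiplies the expectation of \<open>F\<close> by at most \<open>1 - 2 / (3 k \<mu>)\<close>, so after \<open>l\<close> samples it is
  at most \<open>k exp (- 2 \<Lambda> / 3)\<close>. If a unit vector \<open>u\<close> violates the claim, then \<open>walk_displacement\<close> moves it by at
  most \<open>sqrt (\<Lambda> / (400 p)) \<le> 1 / 20\<close>, and \<open>F\<close> is at least \<open>(19 / 20)\<^sup>2\<^sup>p\<close>, which is at least \<open>exp (- 2 \<Lambda> / 5)\<close>. The
  quotient of the two bounds is \<open>k exp (- 4 \<Lambda> / 15)\<close>, and \<open>40 / 15 \<ge> 2\<close>. The constant 400 is what makes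
  the displacement small enough for the last exponent to win against the first.\<close>

lemma sampled_rows_well_conditioned:
  assumes Y: "Y \<in> carrier_mat q k" "mat_adjoint Y * Y = 1\<^sub>m k" and k: "0 < k"
    and coh: "\<And>i j. i < q \<Longrightarrow> j < k \<Longrightarrow> cmod (Y $$ (i, j)) \<le> sqrt (\<mu> / real q)"
    and l: "10 * \<mu> * real k * ln (real m) \<le> real l" and m: "3 \<le> m"
  shows "measure_pmf.prob (sample_indices l q)
    {C. \<exists>g \<in> carrier_vec k. (\<Sum>x\<leftarrow>C. (cmod ((Y *\<^sub>v g) $ x))\<^sup>2) < real l / (400 * real q) * (vec_norm2 g)\<^sup>2}
    \<le> real k / (real m)\<^sup>2"
proof -
  have q: "0 < q" and \<mu>: "1 \<le> \<mu>" using coherence_ge_one[OF Y k coh] by auto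
  have lnm: "1 \<le> ln (real m)"
  proof -
    have "exp 1 \<le> (3::real)" by (rule exp_le)
    then have "exp 1 \<le> real m" using m by linarith
    then show ?thesis using m by (simp add: ln_ge_iff)
  qed
  define \<Lambda> where "\<Lambda> = real l / (real k * \<mu>)"
  have k\<mu>: "0 < real k * \<mu>" using k \<mu> by simp
  have \<Lambda>: "10 * ln (real m) \<le> \<Lambda>"
    using l k\<mu> by (simp add: \<Lambda>_def pos_le_divide_eq mult_ac)
  then have \<Lambda>10: "10 \<le> \<Lambda>" using lnm by linarith
  obtain s where s: "\<Lambda> \<le> 2 ^ Suc s" "2 ^ Suc s \<le> 2 * \<Lambda>" using dyadic_between[of \<Lambda>] \<Lambda>10 by auto
  define p :: real where "p = 2 ^ Suc s"
  have p: "0 < p" "\<Lambda> \<le> p" "p \<le> 2 * \<Lambda>" using s by (auto simp: p_def)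
  define c where "c = real q / (p * (real k * \<mu>))"
  have c: "0 \<le> c" using p k\<mu> by (simp add: c_def)
  define y where "y = frame_vec Y"
  have y: "y x \<in> carrier_vec k" for x using Y by (simp add: y_def)
  have y_norm: "(vec_norm2 (y x))\<^sup>2 \<le> real k * \<mu> / real q" if "x < q" for x
  proof -
    have "(vec_norm2 (y x))\<^sup>2 = (\<Sum>j<k. (cmod (Y $$ (x, j)))\<^sup>2)"
      using Y(1) by (simp add: y_def vec_norm2_sq frame_vec_def)
    also have "\<dots> \<le> (\<Sum>j<k. \<mu> / real q)"
    proof (rule sum_mono)
      fix j assume "j \<in> {..<k}"
      then show "(cmod (Y $$ (x, j)))\<^sup>2 \<le> \<mu> / real q"
        using power_mono[OF coh[OF that, of j], of 2] \<mu> by simp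
    qed
    finally show ?thesis by simp
  qed
  have small: "c * p * (vec_norm2 (y x))\<^sup>2 \<le> 1" if "x < q" for x
  proof -
    have "c * p * (vec_norm2 (y x))\<^sup>2 \<le> c * p * (real k * \<mu> / real q)"
      using y_norm[OF that] c p by (intro mult_left_mono) auto
    also have "\<dots> = 1" using p k \<mu> q by (simp add: c_def)
    finally show ?thesis .
  qed
  have small': "c * (vec_norm2 (y x))\<^sup>2 \<le> 1" if "x < q" for x
  proof -
    have "1 \<le> p" using one_le_power[of "2::real" "Suc s"] by (simp add: p_def)
    then have "c * (vec_norm2 (y x))\<^sup>2 * 1 \<le> c * (vec_norm2 (y x))\<^sup>2 * p"
      using c by (intro mult_left_mono) auto
    then show ?thesis using small[OF that] by (simp add: mult_ac)
  qed
  define V where "V = (\<lambda>x. damp k c (y x))"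
  have V: "V x \<in> carrier_mat k k" "mat_adjoint (V x) = V x" for x using y by (auto simp: V_def)
  define T where "T = sandwich k V"
  have T: "T xs \<in> carrier_mat k k" "mat_adjoint (T xs) = T xs" for xs
    using sandwich_hermitian[of V k xs, OF V] by (auto simp: T_def)
  define F where "F = (\<lambda>xs. Re (tr (pow2 (Suc s) (T xs))))"
  have F_nonneg: "0 \<le> F xs" for xs
    using tr_mult_adjoint[of "pow2 s (T xs)"] pow2_adjoint[OF T(1), of s xs] T(2)[of xs]
      frob_sq_nonneg[of "pow2 s (T xs)"] unfolding F_def pow2_Suc' by simp
  have pow2_one: "pow2 r (1\<^sub>m k) = 1\<^sub>m k" for r by (induction r) auto
  have F_Nil: "F [] = real k" unfolding F_def T_def sandwich.simps pow2_one by (simp add: tr_def)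
  define r where "r = 1 - 2 / (3 * (real k * \<mu>))"
  have r0: "0 \<le> r"
  proof -
    have "1 \<le> real k * \<mu>" using mult_mono[of 1 "real k" 1 \<mu>] k \<mu> by simp
    then show ?thesis by (simp add: r_def field_simps)
  qed
  have step: "(\<Sum>x<q. F (x # xs)) \<le> real q * r * F xs" for xs
  proof -
    define H where "H = pow2 (Suc s) (T xs)"
    have H: "H \<in> carrier_mat k k" using pow2_carrier[OF T(1)] unfolding H_def by blast
    have "(\<Sum>x<q. F (x # xs)) \<le> (\<Sum>x<q. Re (tr H) - 2 / 3 * (c * p) * Re (ip (H *\<^sub>v y x) (y x)))"
    proof (rule sum_mono)
      fix x assume "x \<in> {..<q}"
      then have "c * 2 ^ Suc s * (vec_norm2 (y x))\<^sup>2 \<le> 1" using small[of x] by (simp add: p_def)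
      from damped_trace_decrease[OF T(1,2) y c this, of xs]
      show "F (x # xs) \<le> Re (tr H) - 2 / 3 * (c * p) * Re (ip (H *\<^sub>v y x) (y x))"
        unfolding H_def p_def F_def T_def V_def sandwich.simps .
    qed
    also have "\<dots> = real q * Re (tr H) - 2 / 3 * (c * p) * Re (\<Sum>x<q. ip (H *\<^sub>v y x) (y x))"
      by (simp add: sum_subtractf sum_distrib_left)
    also have "(\<Sum>x<q. ip (H *\<^sub>v y x) (y x)) = tr H"
      unfolding y_def by (rule sum_frame_forms[OF Y H])
    also have "real q * Re (tr H) - 2 / 3 * (c * p) * Re (tr H) = real q * r * F xs"
      using p k\<mu> by (simp add: c_def r_def F_def H_def field_simps del: pow2.simps)
    finally show ?thesis .
  qed
  define S where "S = {C. \<exists>g \<in> carrier_vec k.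
    (\<Sum>x\<leftarrow>C. (cmod ((Y *\<^sub>v g) $ x))\<^sup>2) < real l / (400 * real q) * (vec_norm2 g)\<^sup>2}"
  define t where "t = ((19 / 20 :: real)\<^sup>2) ^ (2 ^ Suc s)"
  have large: "t \<le> F C" if C: "C \<in> S" "length C = l" "set C \<subseteq> {..<q}" for C
  proof -
    obtain g where g: "g \<in> carrier_vec k"
      "(\<Sum>x\<leftarrow>C. (cmod ((Y *\<^sub>v g) $ x))\<^sup>2) < real l / (400 * real q) * (vec_norm2 g)\<^sup>2"
      using C(1) by (auto simp: S_def)
    have "0 \<le> (\<Sum>x\<leftarrow>C. (cmod ((Y *\<^sub>v g) $ x))\<^sup>2)" by (rule sum_list_nonneg) auto
    then have "vec_norm2 g \<noteq> 0" using g(2) by auto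
    then have g0: "0 < vec_norm2 g" using vec_norm2_nonneg[of g] by linarith
    define u where "u = complex_of_real (1 / vec_norm2 g) \<cdot>\<^sub>v g"
    have u: "u \<in> carrier_vec k" "vec_norm2 u = 1"
      using g(1) g0 by (auto simp: u_def vec_norm2_smult norm_divide)
    have "(\<Sum>x\<leftarrow>C. (cmod (ip u (y x)))\<^sup>2) = (\<Sum>x\<leftarrow>C. (cmod ((Y *\<^sub>v g) $ x))\<^sup>2 * (1 / (vec_norm2 g)\<^sup>2))"
    proof (intro arg_cong[where f = sum_list] map_cong refl)
      fix x assume "x \<in> set C"
      then have "ip u (y x) = of_real (1 / vec_norm2 g) * (Y *\<^sub>v g) $ x"
        using C(3) ip_frame_vec[OF Y(1) g(1), of x] by (auto simp: u_def ip_smult_left y_def)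
      then show "(cmod (ip u (y x)))\<^sup>2 = (cmod ((Y *\<^sub>v g) $ x))\<^sup>2 * (1 / (vec_norm2 g)\<^sup>2)"
        by (simp add: norm_mult norm_divide power_divide)
    qed
    also have "\<dots> = (\<Sum>x\<leftarrow>C. (cmod ((Y *\<^sub>v g) $ x))\<^sup>2) * (1 / (vec_norm2 g)\<^sup>2)"
      by (rule sum_list_mult_const)
    also have "\<dots> \<le> real l / (400 * real q) * (vec_norm2 g)\<^sup>2 * (1 / (vec_norm2 g)\<^sup>2)"
      using g(2) by (intro mult_right_mono) auto
    also have "\<dots> = real l / (400 * real q)" using g0 by simp
    finally have usum: "(\<Sum>x\<leftarrow>C. (cmod (ip u (y x)))\<^sup>2) \<le> real l / (400 * real q)" .
    define w where "w = walk V C u"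
    have w: "w \<in> carrier_vec k" unfolding w_def by (rule walk_carrier[OF V(1) u(1)])
    have "(vec_norm2 (w - u))\<^sup>2 \<le> (vec_norm2 (u - u))\<^sup>2 + c * (\<Sum>x\<leftarrow>C. (cmod (ip u (y x)))\<^sup>2)"
      unfolding w_def V_def by (rule walk_displacement[OF y c _ u(1) u(1)]) (use small' C(3) in auto)
    also have "u - u = 0\<^sub>v k" using u by auto
    also have "(vec_norm2 (0\<^sub>v k))\<^sup>2 + c * (\<Sum>x\<leftarrow>C. (cmod (ip u (y x)))\<^sup>2) \<le> c * (real l / (400 * real q))"
      using mult_left_mono[OF usum c] by simp
    also have "\<dots> = \<Lambda> / (400 * p)" using q k\<mu> p by (simp add: c_def \<Lambda>_def field_simps)
    also have "\<dots> \<le> (1 / 20)\<^sup>2" using p by (simp add: power2_eq_square field_simps)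
    finally have "vec_norm2 (w - u) \<le> 1 / 20" by (rule power2_le_imp_le) simp
    moreover have "u - w + w = u" using u(1) w by (intro eq_vecI) auto
    then have "vec_norm2 u \<le> vec_norm2 (u - w) + vec_norm2 w"
      using vec_norm2_triangle[of "u - w" k w] u(1) w by simp
    ultimately have w_ge: "19 / 20 \<le> vec_norm2 w" using u vec_norm2_minus_commute[OF u(1) w] by simp
    have form: "Re (ip (T C *\<^sub>v u) u) = (vec_norm2 w)\<^sup>2"
      using sandwich_form[OF V u(1), where xs = C] by (simp add: T_def w_def)
    have "t \<le> ((vec_norm2 w)\<^sup>2) ^ (2 ^ Suc s)"
      unfolding t_def using w_ge by (intro power_mono) auto
    also have "\<dots> \<le> F C"
      using tr_pow2_ge_form[OF T(1)[of C] T(2)[of C] u, of s] unfolding form F_def by simp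
    finally show ?thesis .
  qed
  have "measure_pmf.prob (sample_indices l q) S * t \<le> r ^ l * F []"
    using prob_sample_indices_le[OF q F_nonneg large] expectation_sample_indices_le[OF q r0 step, where l = l]
    by (rule order_trans)
  also have "\<dots> \<le> exp (- (2 / 3) * \<Lambda>) * real k"
  proof -
    have "r \<le> exp (- (2 / (3 * (real k * \<mu>))))" using exp_ge_add_one_self[of "- (2 / (3 * (real k * \<mu>)))"] by (simp add: r_def)
    then have "r ^ l \<le> exp (- (2 / (3 * (real k * \<mu>)))) ^ l" using r0 by (rule power_mono)
    also have "\<dots> = exp (- (2 / 3) * \<Lambda>)" by (simp add: \<Lambda>_def field_simps flip: exp_of_nat_mult)
    finally show ?thesis unfolding F_Nil by (rule mult_right_mono) simp
  qed
  finally have Pt: "measure_pmf.prob (sample_indices l q) S * t \<le> exp (- (2 / 3) * \<Lambda>) * real k" .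
  have t: "exp (- (2 / 5) * \<Lambda>) \<le> t"
  proof -
    \<comment> \<open>\<open>1 / 10\<close> is a convenient upper bound for \<open>- ln (19 / 20)\<close>.\<close>
    have "1 / (19 / 20) \<le> exp (1 / 10 :: real)" using exp_ge_add_one_self[of "1 / 10"] by simp
    then have "exp (- (1 / 10)) \<le> (19 / 20 :: real)" by (simp add: exp_minus field_simps)
    then have "(exp (- (1 / 10)) ^ 2) ^ (2 ^ Suc s) \<le> t" unfolding t_def by (intro power_mono) auto
    moreover have "(exp (- (1 / 10)) ^ 2) ^ (2 ^ Suc s) = exp (- (1 / 5) * p)"
      by (simp add: p_def flip: exp_of_nat_mult power_mult)
    moreover have "exp (- (2 / 5) * \<Lambda>) \<le> exp (- (1 / 5) * p)" using p by simp
    ultimately show ?thesis by linarith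
  qed
  have "measure_pmf.prob (sample_indices l q) S * exp (- (2 / 5) * \<Lambda>) \<le> exp (- (2 / 3) * \<Lambda>) * real k"
    using mult_left_mono[OF t, of "measure_pmf.prob (sample_indices l q) S"] Pt by simp
  then have "measure_pmf.prob (sample_indices l q) S \<le> exp (- (2 / 3) * \<Lambda>) * real k / exp (- (2 / 5) * \<Lambda>)"
    by (simp add: pos_le_divide_eq)
  also have "\<dots> = real k * exp (- (4 / 15) * \<Lambda>)" by (simp add: field_simps flip: exp_add exp_diff)
  also have "\<dots> \<le> real k * exp (- (2 * ln (real m)))"
  proof -
    have "- (4 / 15) * \<Lambda> \<le> - (2 * ln (real m))" using \<Lambda> lnm by simp
    then show ?thesis by (intro mult_left_mono) auto
  qed
  also have "exp (- (2 * ln (real m))) = 1 / (real m)\<^sup>2"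
    using m by (simp add: exp_minus exp_double exp_ln field_simps)
  finally show ?thesis by (simp add: S_def)
qed

section \<open>Error of a column selection\<close>

text \<open>The adjoint of \<open>P A\<close> is bounded on a vector \<open>y\<close>, by splitting \<open>h = A\<^sup>* P y\<close> into \<open>Y g\<close> with \<open>g = Y\<^sup>* h\<close>
  and the rest \<open>r\<close>. The projection \<open>1 - Y Y\<^sup>*\<close> annihilates the contribution of \<open>B Y\<^sup>*\<close>, so \<open>r\<close> comes
  from \<open>D\<close> only. At a sampled position, \<open>h\<close> has as its entry the inner product of \<open>y\<close> with the
  residual of a sampled column. Hence \<open>Y g\<close> is small there, and \<open>good\<close> turns this into a bound for \<open>g\<close>.\<close>

lemma column_selection_error:
  assumes A: "A \<in> carrier_mat p q" and C: "set C \<subseteq> {..<q}" and l: "0 < length C"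
    and J: "rrqr_selection k (cols_at A C) J" and k: "0 < k"
    and Y: "Y \<in> carrier_mat q k" "mat_adjoint Y * Y = 1\<^sub>m k"
    and split: "A = B * mat_adjoint Y + D" "B \<in> carrier_mat p k" "D \<in> carrier_mat p q"
    and D: "op_le D e" "0 \<le> e"
    and good: "\<And>g. g \<in> carrier_vec k \<Longrightarrow>
      real (length C) / (400 * real q) * (vec_norm2 g)\<^sup>2 \<le> (\<Sum>x\<leftarrow>C. (cmod ((Y *\<^sub>v g) $ x))\<^sup>2)"
  shows "op_le (residual_projection (cols_at A (map (\<lambda>j. C ! j) J)) * A) (61 * e * sqrt (real q * real k))"
proof -
  define M where "M = cols_at A (map (\<lambda>j. C ! j) J)"
  define P where "P = residual_projection M"
  have M: "M \<in> carrier_mat p k" using A J by (auto simp: M_def rrqr_selection_def)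
  note P = residual_projection[OF M, folded P_def]
  have q: "0 < q" using C l by (cases C) auto
  have Y': "mat_adjoint Y \<in> carrier_mat k q" using Y by simp
  define \<kappa> where "\<kappa> = e * (1 + sqrt (1 + 2 * real k))"
  have \<kappa>: "0 \<le> \<kappa>" using D(2) by (simp add: \<kappa>_def)
  have "vec_norm2 (mat_adjoint (P * A) *\<^sub>v y) \<le> 61 * e * sqrt (real q * real k) * vec_norm2 y"
    if y: "y \<in> carrier_vec p" for y
  proof -
    define w where "w = P *\<^sub>v y"
    have w: "w \<in> carrier_vec p" using P(1) y by (simp add: w_def)
    have w_le: "vec_norm2 w \<le> vec_norm2 y"
      using op_leD[OF hermitian_idempotent_contraction[OF P(1-3)], of y] P(1) y by (simp add: w_def)
    define h where "h = mat_adjoint A *\<^sub>v w"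
    have h: "h \<in> carrier_vec q" using A w by (simp add: h_def)
    have PAy: "mat_adjoint (P * A) *\<^sub>v y = h"
      using A P(1,2) y by (simp add: mat_adjoint_mult h_def w_def assoc_mult_mat_vec[of _ q p _ p])
    define d where "d = mat_adjoint D *\<^sub>v w"
    have d: "d \<in> carrier_vec q" using split w by (simp add: d_def)
    have d_le: "vec_norm2 d \<le> e * vec_norm2 y"
    proof -
      have "vec_norm2 d \<le> e * vec_norm2 w"
        using op_leD[OF op_le_adjoint[OF D], of w] split w by (simp add: d_def)
      also have "\<dots> \<le> e * vec_norm2 y" by (rule mult_left_mono[OF w_le D(2)])
      finally show ?thesis .
    qed
    define b where "b = mat_adjoint B *\<^sub>v w"
    have b: "b \<in> carrier_vec k" using split w by (simp add: b_def)
    have h_split: "h = Y *\<^sub>v b + d"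
    proof -
      have "mat_adjoint A = Y * mat_adjoint B + mat_adjoint D"
        unfolding split(1) using split(2,3) Y
        by (subst mat_adjoint_add[of _ p q]) (auto simp: mat_adjoint_mult)
      then have "h = (Y * mat_adjoint B) *\<^sub>v w + mat_adjoint D *\<^sub>v w"
        unfolding h_def using split(2,3) Y w by (simp add: add_mult_distrib_mat_vec[of _ q p])
      then show ?thesis
        using split(2) Y w assoc_mult_mat_vec[of Y q k "mat_adjoint B" p w] by (simp add: b_def d_def)
    qed
    define g where "g = mat_adjoint Y *\<^sub>v h"
    have g: "g \<in> carrier_vec k" using Y h by (simp add: g_def)
    define Q where "Q = 1\<^sub>m q - Y * mat_adjoint Y"
    have YY: "Y * mat_adjoint Y \<in> carrier_mat q q" using Y by simp
    have Q: "Q \<in> carrier_mat q q" using YY by (simp add: Q_def minus_carrier_mat)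
    have Q_adj: "mat_adjoint Q = Q"
      unfolding Q_def using YY Y by (simp add: mat_adjoint_minus[of _ q q] mat_adjoint_mult)
    have QY: "Q * Y = 0\<^sub>m q k"
    proof -
      have "Q * Y = Y - Y * (mat_adjoint Y * Y)"
        unfolding Q_def using YY Y(1) assoc_mult_mat[of Y q k "mat_adjoint Y" q Y k]
        by (simp add: minus_mult_distrib_mat[of _ q q _ _ k] del: assoc_mult_mat)
      then show ?thesis using Y by simp
    qed
    have Q_idem: "Q * Q = Q"
    proof -
      have "Q * Q = Q - Q * (Y * mat_adjoint Y)"
        using mult_minus_distrib_mat[OF Q, of "1\<^sub>m q" q "Y * mat_adjoint Y"] YY Q right_mult_one_mat[OF Q]
        by (simp add: Q_def[symmetric] del: assoc_mult_mat)
      also have "Q * (Y * mat_adjoint Y) = (Q * Y) * mat_adjoint Y"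
        using assoc_mult_mat[OF Q Y(1) Y'] by simp
      also have "\<dots> = 0\<^sub>m q q" unfolding QY using Y' by simp
      finally show ?thesis using Q by auto
    qed
    define r where "r = Q *\<^sub>v h"
    have r: "r \<in> carrier_vec q" using Q h by (simp add: r_def)
    have h_g: "h = Y *\<^sub>v g + r"
    proof -
      have "r = h - Y *\<^sub>v g"
        unfolding r_def Q_def g_def using YY Y h
          minus_mult_distrib_mat_vec[of "1\<^sub>m q" q q "Y * mat_adjoint Y" h]
          assoc_mult_mat_vec[of Y q k "mat_adjoint Y" q h] by simp
      then show ?thesis using h Y g by auto
    qed
    have r_le: "vec_norm2 r \<le> e * vec_norm2 y"
    proof -
      have "r = (Q * Y) *\<^sub>v b + Q *\<^sub>v d"
        unfolding r_def h_split using Q Y b d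
        by (simp add: mult_add_distrib_mat_vec[of _ q q] assoc_mult_mat_vec[of _ q q _ k])
      then have "r = Q *\<^sub>v d" using Q d b by (simp add: QY zero_mat_mult_vec)
      then have "vec_norm2 r \<le> vec_norm2 d"
        using op_leD[OF hermitian_idempotent_contraction[OF Q Q_adj Q_idem], of d] Q d by simp
      then show ?thesis using d_le by simp
    qed
    have entry: "cmod ((Y *\<^sub>v g) $ x) \<le> \<kappa> * vec_norm2 y" if x: "x \<in> set C" for x
    proof -
      obtain j where j: "j < length C" "C ! j = x" using x by (auto simp: in_set_conv_nth)
      have xq: "x < q" using x C by auto
      have colx: "col A x \<in> carrier_vec p" using A by (intro carrier_vecI) simp
      have "h $ x = ip w (col A x)"
        unfolding h_def ip_def using A w xq
        by (auto simp: mult_vec_index_sum mult.commute simp del: index_mult_mat_vec)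
      also have "\<dots> = ip y (P *\<^sub>v col A x)"
        unfolding w_def using ip_adjoint[OF P(1) y colx] P(2) by simp
      finally have "cmod (h $ x) \<le> vec_norm2 y * vec_norm2 (P *\<^sub>v col A x)"
        using ip_Cauchy_Schwarz[of y "P *\<^sub>v col A x"] y P(1) by simp
      also have "\<dots> \<le> vec_norm2 y * (sqrt (1 + 2 * real k) * e)"
        using rrqr_selection_residual[OF A C J k j(1) split(1,2) Y' split(3) D] j(2)
        by (intro mult_left_mono) (auto simp: P_def M_def)
      finally have hx: "cmod (h $ x) \<le> sqrt (1 + 2 * real k) * e * vec_norm2 y" by (simp add: mult_ac)
      have "cmod (r $ x) \<le> vec_norm2 r" using norm_entry_le[of x r] r xq by simp
      then have rx: "cmod (r $ x) \<le> e * vec_norm2 y" using r_le by linarith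
      have "h $ x = (Y *\<^sub>v g) $ x + r $ x" using h_g r Y g xq by (metis carrier_vecD index_add_vec(1))
      then have "(Y *\<^sub>v g) $ x = h $ x - r $ x" by simp
      then have "cmod ((Y *\<^sub>v g) $ x) \<le> cmod (h $ x) + cmod (r $ x)" using norm_triangle_ineq4 by simp
      then show ?thesis using hx rx by (simp add: \<kappa>_def algebra_simps)
    qed
    have g_le: "vec_norm2 g \<le> 20 * sqrt (real q) * (\<kappa> * vec_norm2 y)"
    proof -
      have "real (length C) / (400 * real q) * (vec_norm2 g)\<^sup>2 \<le> (\<Sum>x\<leftarrow>C. (cmod ((Y *\<^sub>v g) $ x))\<^sup>2)"
        by (rule good[OF g])
      also have "\<dots> \<le> (\<Sum>x\<leftarrow>C. (\<kappa> * vec_norm2 y)\<^sup>2)"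
        using entry by (intro sum_list_mono power_mono) auto
      also have "\<dots> = real (length C) * (\<kappa> * vec_norm2 y)\<^sup>2" by (simp add: sum_list_triv)
      finally have "(vec_norm2 g)\<^sup>2 \<le> 400 * real q * (\<kappa> * vec_norm2 y)\<^sup>2"
        using l q by (simp add: field_simps)
      also have "\<dots> = (20 * sqrt (real q) * (\<kappa> * vec_norm2 y))\<^sup>2" by (simp add: power_mult_distrib)
      finally show ?thesis by (rule power2_le_imp_le) (use \<kappa> in simp)
    qed
    have "vec_norm2 h \<le> vec_norm2 (Y *\<^sub>v g) + vec_norm2 r"
      using vec_norm2_triangle[of "Y *\<^sub>v g" q r] Y g r h_g by simp
    also have "\<dots> \<le> 20 * sqrt (real q) * (\<kappa> * vec_norm2 y) + e * vec_norm2 y"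
      using isometry_norm[OF Y g] g_le r_le by simp
    also have "\<dots> \<le> 61 * e * sqrt (real q * real k) * vec_norm2 y"
    proof -
      \<comment> \<open>\<open>20 \<cdot> 3\<close> from \<open>g\<close>, as \<open>1 + sqrt (1 + 2 k) \<le> 3 sqrt k\<close>, and 1 from \<open>r\<close>.\<close>
      have k1: "1 \<le> sqrt (real k)" using k by simp
      have q1: "1 \<le> sqrt (real q)" using q by simp
      have "1 + 2 * real k \<le> (2 * sqrt (real k))\<^sup>2" using k by (simp add: power_mult_distrib)
      then have "sqrt (1 + 2 * real k) \<le> 2 * sqrt (real k)" by (intro real_le_lsqrt) auto
      then have "1 + sqrt (1 + 2 * real k) \<le> 3 * sqrt (real k)" using k1 by linarith
      then have "\<kappa> \<le> e * (3 * sqrt (real k))"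
        unfolding \<kappa>_def using D(2) by (rule mult_left_mono)
      then have "20 * sqrt (real q) * (\<kappa> * vec_norm2 y) \<le> 20 * sqrt (real q) * (e * (3 * sqrt (real k)) * vec_norm2 y)"
        by (intro mult_left_mono mult_right_mono) auto
      moreover have "e * vec_norm2 y * 1 \<le> e * vec_norm2 y * (sqrt (real q) * sqrt (real k))"
        using mult_mono[OF q1 k1] D(2) by (intro mult_left_mono) auto
      ultimately show ?thesis by (simp add: real_sqrt_mult algebra_simps)
    qed
    finally show ?thesis unfolding PAy .
  qed
  then have "op_le (mat_adjoint (P * A)) (61 * e * sqrt (real q * real k))"
    using P(1) by (simp add: op_le_def)
  from op_le_adjoint[OF this] show ?thesis using D(2) by (simp add: P_def M_def)
qed

section \<open>Error of the skeleton\<close>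

lemma hcat_mult_four_block:
  assumes "X1 \<in> carrier_mat p a" "X2 \<in> carrier_mat p b"
    and "F11 \<in> carrier_mat a c" "F12 \<in> carrier_mat a d" "F21 \<in> carrier_mat b c" "F22 \<in> carrier_mat b d"
  shows "hcat X1 X2 * four_block_mat F11 F12 F21 F22 = hcat (X1 * F11 + X2 * F21) (X1 * F12 + X2 * F22)"
proof -
  have "hcat X1 X2 * four_block_mat F11 F12 F21 F22 =
    four_block_mat (X1 * F11 + X2 * F21) (X1 * F12 + X2 * F22)
      (0\<^sub>m 0 a * F11 + 0\<^sub>m 0 b * F21) (0\<^sub>m 0 a * F12 + 0\<^sub>m 0 b * F22)"
    using mult_four_block_mat[OF assms(1,2) zero_carrier_mat[of 0 a] zero_carrier_mat[of 0 b] assms(3-6)] assms(1,2)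
    by (simp add: hcat_def)
  also have "\<dots> = hcat (X1 * F11 + X2 * F21) (X1 * F12 + X2 * F22)"
    unfolding hcat_def by (rule cong_four_block_mat) (use assms in auto)
  finally show ?thesis .
qed

lemma hcat_mult_adjoint_hcat:
  assumes U: "U \<in> carrier_mat p a" "V \<in> carrier_mat p b"
    and Y: "Y1 \<in> carrier_mat q a" "Y2 \<in> carrier_mat q b"
  shows "hcat U V * mat_adjoint (hcat Y1 Y2) = U * mat_adjoint Y1 + V * mat_adjoint Y2"
proof (rule eq_matI)
  note H = hcat_carrier[OF U] hcat_carrier[OF Y]
  show "dim_row (hcat U V * mat_adjoint (hcat Y1 Y2)) = dim_row (U * mat_adjoint Y1 + V * mat_adjoint Y2)"
    "dim_col (hcat U V * mat_adjoint (hcat Y1 Y2)) = dim_col (U * mat_adjoint Y1 + V * mat_adjoint Y2)"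
    using carrier_matD[OF H(1)] carrier_matD[OF H(2)] U Y by auto
  fix i j assume "i < dim_row (U * mat_adjoint Y1 + V * mat_adjoint Y2)"
    "j < dim_col (U * mat_adjoint Y1 + V * mat_adjoint Y2)"
  then have ij: "i < p" "j < q" using U Y by auto
  have "(hcat U V * mat_adjoint (hcat Y1 Y2)) $$ (i, j) =
    (\<Sum>t<a + b. hcat U V $$ (i, t) * cnj (hcat Y1 Y2 $$ (j, t)))"
    using carrier_matD[OF H(1)] carrier_matD[OF H(2)] ij by (simp add: mult_index_sum del: index_mult_mat(1))
  also have "\<dots> = (\<Sum>t<a. hcat U V $$ (i, t) * cnj (hcat Y1 Y2 $$ (j, t)))
      + (\<Sum>t<b. hcat U V $$ (i, a + t) * cnj (hcat Y1 Y2 $$ (j, a + t)))"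
    by (induction b) (auto simp: add.assoc)
  also have "\<dots> = (\<Sum>t<a. U $$ (i, t) * cnj (Y1 $$ (j, t))) + (\<Sum>t<b. V $$ (i, t) * cnj (Y2 $$ (j, t)))"
    using ij hcat_index[OF U] hcat_index[OF Y] by simp
  also have "\<dots> = (U * mat_adjoint Y1 + V * mat_adjoint Y2) $$ (i, j)"
    using U Y ij by (simp add: mult_index_sum del: index_mult_mat(1))
  finally show "(hcat U V * mat_adjoint (hcat Y1 Y2)) $$ (i, j) = (U * mat_adjoint Y1 + V * mat_adjoint Y2) $$ (i, j)" .
qed

text \<open>The blocks other than \<open>A11\<close> contribute \<open>X E Y\<^sup>*\<close>, and multiplication by unitary matrices does not increase the norm.\<close>

lemma leading_block_plus_small:
  assumes X: "X1 \<in> carrier_mat m k" "X2 \<in> carrier_mat m (m - k)" "unitary_mat m (hcat X1 X2)"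
    and Y: "Y1 \<in> carrier_mat n k" "Y2 \<in> carrier_mat n (n - k)" "unitary_mat n (hcat Y1 Y2)"
    and k: "k \<le> n" "n \<le> m"
    and F: "A11 \<in> carrier_mat k k" "A12 \<in> carrier_mat k (n - k)"
      "A21 \<in> carrier_mat (m - k) k" "A22 \<in> carrier_mat (m - k) (n - k)"
    and A: "A = hcat X1 X2 * four_block_mat A11 A12 A21 A22 * mat_adjoint (hcat Y1 Y2)"
  shows "\<exists>D \<in> carrier_mat m n. A = X1 * A11 * mat_adjoint Y1 + D \<and>
    op_le D (spectral_norm (four_block_mat (0\<^sub>m k k) A12 A21 A22))"
proof -
  define X where "X = hcat X1 X2"
  define Y where "Y = hcat Y1 Y2"
  define E where "E = four_block_mat (0\<^sub>m k k) A12 A21 A22"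
  have Xc: "X \<in> carrier_mat m m" "mat_adjoint X * X = 1\<^sub>m m"
    and Yc: "Y \<in> carrier_mat n n" "mat_adjoint Y * Y = 1\<^sub>m n"
    using X(3) Y(3) by (auto simp: unitary_mat_def X_def Y_def)
  have E: "E \<in> carrier_mat m n"
    using four_block_carrier_mat[of "0\<^sub>m k k" k k A22 "m - k" "n - k" A12 A21] F k by (simp add: E_def)
  define D where "D = X * E * mat_adjoint Y"
  have D: "D \<in> carrier_mat m n" using Xc Yc E by (simp add: D_def)
  have "op_le (X * E) (1 * spectral_norm E)"
    by (rule op_le_mult[OF isometry_op_le(1)[OF Xc] op_le_spectral_norm]) (use Xc E in auto)
  then have "op_le (X * E * mat_adjoint Y) (1 * spectral_norm E * 1)"
    by (rule op_le_mult[OF _ isometry_op_le(2)[OF Yc]]) (use Xc Yc E in \<open>auto simp: spectral_norm_nonneg\<close>)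
  then have op: "op_le D (spectral_norm E)" by (simp add: D_def)
  have c: "X1 * A11 \<in> carrier_mat m k" "X2 * A21 \<in> carrier_mat m k"
    "X1 * A12 \<in> carrier_mat m (n - k)" "X2 * A22 \<in> carrier_mat m (n - k)"
    "X1 * A12 + X2 * A22 \<in> carrier_mat m (n - k)" "X1 * A11 + X2 * A21 \<in> carrier_mat m k"
    using X F by auto
  have Y1': "mat_adjoint Y1 \<in> carrier_mat k n" using Y by simp
  have "A = (X1 * A11 + X2 * A21) * mat_adjoint Y1 + (X1 * A12 + X2 * A22) * mat_adjoint Y2"
    unfolding A hcat_mult_four_block[OF X(1,2) F] by (rule hcat_mult_adjoint_hcat[OF c(6,5) Y(1,2)])
  moreover have "D = X2 * A21 * mat_adjoint Y1 + (X1 * A12 + X2 * A22) * mat_adjoint Y2"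
  proof -
    have "X * E = hcat (X1 * 0\<^sub>m k k + X2 * A21) (X1 * A12 + X2 * A22)"
      unfolding X_def E_def by (rule hcat_mult_four_block[OF X(1,2) zero_carrier_mat F(2-4)])
    also have "X1 * 0\<^sub>m k k + X2 * A21 = X2 * A21"
      using right_mult_zero_mat[OF X(1), of k] left_add_zero_mat[OF c(2)] by simp
    finally show ?thesis
      unfolding D_def Y_def using hcat_mult_adjoint_hcat[OF c(2,5) Y(1,2)] by simp
  qed
  moreover have "(X1 * A11 + X2 * A21) * mat_adjoint Y1 = X1 * A11 * mat_adjoint Y1 + X2 * A21 * mat_adjoint Y1"
    by (rule add_mult_distrib_mat[OF c(1,2) Y1'])
  ultimately have "A = X1 * A11 * mat_adjoint Y1 + D"
    using c Y Y1' by (simp add: assoc_add_mat[of _ m n])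
  then show ?thesis using D op by (auto simp: E_def)
qed

text \<open>With \<open>E = M M\<^sup>+\<close> and \<open>G = N\<^sup>+ N\<close> the difference is \<open>A - E A G = (A - E A) + E (A - A G)\<close>, where \<open>E\<close> is a contraction and
  the adjoint of \<open>A - A G\<close> is the residual of \<open>A\<^sup>*\<close> modulo the columns of \<open>N\<^sup>*\<close>.\<close>

lemma two_sided_residual:
  assumes A: "A \<in> carrier_mat m n" and M: "M \<in> carrier_mat m k" and N: "N \<in> carrier_mat k n"
    and a: "op_le (residual_projection M * A) a"
    and b: "op_le (residual_projection (mat_adjoint N) * mat_adjoint A) b" "0 \<le> b"
  shows "op_le (A - M * (pinv M * A * pinv N) * N) (a + b)"
proof -
  define E where "E = M * pinv M"
  define G where "G = pinv N * N"
  define P where "P = residual_projection (mat_adjoint N)"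
  have pM: "pinv M \<in> carrier_mat k m" and pN: "pinv N \<in> carrier_mat n k"
    using pinv_carrier M N by auto
  have E: "E \<in> carrier_mat m m" "mat_adjoint E = E" "E * E = E"
  proof -
    have h: "mat_adjoint (M * pinv M) = M * pinv M" "M * pinv M * M = M"
      using is_pinv_pinv[of M] by (auto simp: is_pinv_def)
    show "E \<in> carrier_mat m m" "mat_adjoint E = E" using M pM h by (auto simp: E_def)
    show "E * E = E"
      unfolding E_def using h(2) M pM assoc_mult_mat[of "M * pinv M" m m M k "pinv M" m] by simp
  qed
  have G: "G \<in> carrier_mat n n" "mat_adjoint G = G"
    using is_pinv_pinv[of N] N pN by (auto simp: G_def is_pinv_def)
  have P: "P = 1\<^sub>m n - G"
  proof -
    have "mat_adjoint N * mat_adjoint (pinv N) = mat_adjoint G"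
      using N pN by (simp add: G_def mat_adjoint_mult)
    then show ?thesis using N G by (simp add: P_def residual_projection_def pinv_adjoint)
  qed
  have Pc: "P \<in> carrier_mat n n" "mat_adjoint P = P"
    using residual_projection[of "mat_adjoint N" n k] N by (auto simp: P_def)
  have "op_le (mat_adjoint (P * mat_adjoint A)) b"
    using b by (intro op_le_adjoint) (auto simp: P_def)
  also have "mat_adjoint (P * mat_adjoint A) = A * P"
    using A Pc by (simp add: mat_adjoint_mult)
  finally have AP: "op_le (E * (A * P)) (1 * b)"
    by (intro op_le_mult hermitian_idempotent_contraction[OF E]) (use E A Pc in auto)
  have EA: "E * A \<in> carrier_mat m n" and EAG: "E * A * G \<in> carrier_mat m n" using E A G by auto
  have PMA: "residual_projection M * A = A - E * A"
    using M A E left_mult_one_mat[OF A]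
    by (simp add: residual_projection_def E_def[symmetric] minus_mult_distrib_mat[of _ m m _ _ n])
  have telescope: "U - W = (U - V) + (V - W)"
    if "U \<in> carrier_mat m n" "V \<in> carrier_mat m n" "W \<in> carrier_mat m n" for U V W :: "complex mat"
    using that by (intro eq_matI) auto
  have "E * (A * P) = E * A - E * A * G"
    using assoc_mult_mat[OF E(1) A Pc(1)] mult_minus_distrib_mat[OF EA, of "1\<^sub>m n" n G] G(1)
      right_mult_one_mat[OF EA] by (simp add: P)
  moreover have "M * (pinv M * A * pinv N) * N = E * A * G"
  proof -
    have "M * (pinv M * A * pinv N) = E * A * pinv N"
      using M pM A pN assoc_mult_mat[of M m k "pinv M * A" n "pinv N" k]
        assoc_mult_mat[of M m k "pinv M" m A n] by (simp add: E_def)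
    then show ?thesis
      using assoc_mult_mat[OF EA pN N] by (simp add: G_def)
  qed
  moreover have "A - E * A * G = (A - E * A) + (E * A - E * A * G)"
    by (rule telescope[OF A EA EAG])
  moreover have "op_le (residual_projection M * A + E * (A * P)) (a + b)"
    by (rule op_le_add[of _ _ _ _ m n])
      (use a AP residual_projection(1)[OF M] A E Pc in auto)
  ultimately show ?thesis by (simp add: PMA)
qed

lemma adjoint_rows_at: "set R \<subseteq> {..<dim_row A} \<Longrightarrow> mat_adjoint (rows_at A R) = cols_at (mat_adjoint A) R"
  by (rule eq_matI) (auto simp: rows_at_def cols_at_def subset_iff)

text \<open>The row selection is a column selection for \<open>A\<^sup>*\<close>, for which \<open>X\<close> and \<open>Y\<close> exchange their roles.\<close>

lemma skeleton_error:
  assumes A: "A \<in> carrier_mat m n" and k: "0 < k"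
    and C: "set C \<subseteq> {..<n}" "k \<le> length C" and R: "set R \<subseteq> {..<m}" "k \<le> length R" and nm: "n \<le> m"
    and X: "X \<in> carrier_mat m k" "mat_adjoint X * X = 1\<^sub>m k"
    and Y: "Y \<in> carrier_mat n k" "mat_adjoint Y * Y = 1\<^sub>m k"
    and split: "A = X * B * mat_adjoint Y + D" "B \<in> carrier_mat k k" "D \<in> carrier_mat m n"
    and D: "op_le D e" "0 \<le> e"
    and goodC: "\<And>g. g \<in> carrier_vec k \<Longrightarrow>
      real (length C) / (400 * real n) * (vec_norm2 g)\<^sup>2 \<le> (\<Sum>x\<leftarrow>C. (cmod ((Y *\<^sub>v g) $ x))\<^sup>2)"
    and goodR: "\<And>g. g \<in> carrier_vec k \<Longrightarrow>
      real (length R) / (400 * real m) * (vec_norm2 g)\<^sup>2 \<le> (\<Sum>x\<leftarrow>R. (cmod ((X *\<^sub>v g) $ x))\<^sup>2)"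
    and rrqr: "is_rrqr rrqr"
    and alg: "skeleton_algorithm rrqr k A C R = (C', Z, R')"
  shows "length C' = k \<and> length R' = k \<and> set C' \<subseteq> set C \<and> set R' \<subseteq> set R \<and>
    spectral_norm (A - cols_at A C' * Z * rows_at A R') \<le> 122 * (e * sqrt (real m * real k))"
proof -
  have adjR: "mat_adjoint (rows_at A R) = cols_at (mat_adjoint A) R"
    using A R by (intro adjoint_rows_at) auto
  define J where "J = rrqr k (cols_at A C)"
  define I where "I = rrqr k (cols_at (mat_adjoint A) R)"
  have J: "rrqr_selection k (cols_at A C) J" and I: "rrqr_selection k (cols_at (mat_adjoint A) R) I"
    using rrqr C R by (auto simp: is_rrqr_def J_def I_def)
  have C': "C' = map (\<lambda>j. C ! j) J" and R': "R' = map (\<lambda>i. R ! i) I"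
    and Z: "Z = pinv (cols_at A C') * A * pinv (rows_at A R')"
    using alg by (auto simp: skeleton_algorithm_def Let_def J_def I_def adjR)
  have JI: "length J = k" "set J \<subseteq> {..<length C}" "length I = k" "set I \<subseteq> {..<length R}"
    using J I by (auto simp: rrqr_selection_def)
  have sub: "set C' \<subseteq> set C" "set R' \<subseteq> set R"
    using JI by (auto simp: C' R' subset_iff)
  have len: "length C' = k" "length R' = k" using JI by (auto simp: C' R')
  have A': "mat_adjoint A \<in> carrier_mat n m" using A by simp
  have XB: "X * B \<in> carrier_mat m k" using X split by simp
  have "op_le (residual_projection (cols_at A (map (\<lambda>j. C ! j) J)) * A) (61 * e * sqrt (real n * real k))"
    by (rule column_selection_error[OF A C(1) _ J k Y split(1) XB split(3) D goodC]) (use C k in auto)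
  then have left: "op_le (residual_projection (cols_at A C') * A) (61 * e * sqrt (real n * real k))"
    by (simp add: C')
  have split': "mat_adjoint A = Y * mat_adjoint B * mat_adjoint X + mat_adjoint D"
  proof -
    have "mat_adjoint (X * B * mat_adjoint Y) = Y * (mat_adjoint B * mat_adjoint X)"
      using X Y split(2) by (simp add: mat_adjoint_mult)
    also have "\<dots> = Y * mat_adjoint B * mat_adjoint X"
      using X Y split(2) assoc_mult_mat[of Y n k "mat_adjoint B" k "mat_adjoint X" m] by simp
    finally show ?thesis
      unfolding split(1) using X Y split(2,3) by (subst mat_adjoint_add[of _ m n]) auto
  qed
  have YB: "Y * mat_adjoint B \<in> carrier_mat n k" and D': "mat_adjoint D \<in> carrier_mat n m"
    using Y split by auto
  have "op_le (residual_projection (cols_at (mat_adjoint A) (map (\<lambda>j. R ! j) I)) * mat_adjoint A)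
      (61 * e * sqrt (real m * real k))"
    by (rule column_selection_error[OF A' R(1) _ I k X split' YB D' op_le_adjoint[OF D] D(2) goodR])
      (use R k in auto)
  moreover have "cols_at (mat_adjoint A) R' = mat_adjoint (rows_at A R')"
    using A R sub by (intro adjoint_rows_at[symmetric]) auto
  ultimately have right: "op_le (residual_projection (mat_adjoint (rows_at A R')) * mat_adjoint A)
      (61 * e * sqrt (real m * real k))"
    by (simp add: R')
  have rows: "rows_at A R' \<in> carrier_mat k n" using A len by (auto simp: rows_at_def)
  have cols: "cols_at A C' \<in> carrier_mat m k" using cols_at_carrier[OF A, of C'] len by simp
  have "op_le (A - cols_at A C' * Z * rows_at A R')
      (61 * e * sqrt (real n * real k) + 61 * e * sqrt (real m * real k))"
    unfolding Z by (rule two_sided_residual[OF A cols rows left right]) (use D in simp)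
  then have "spectral_norm (A - cols_at A C' * Z * rows_at A R') \<le>
      61 * e * sqrt (real n * real k) + 61 * e * sqrt (real m * real k)"
    by (rule spectral_norm_le) (use D in simp)
  also have "\<dots> \<le> 122 * (e * sqrt (real m * real k))"
  proof -
    have "sqrt (real n * real k) \<le> sqrt (real m * real k)" using nm by (simp add: mult_right_mono)
    then have "e * sqrt (real n * real k) \<le> e * sqrt (real m * real k)" using D(2) by (rule mult_left_mono)
    then show ?thesis by simp
  qed
  finally show ?thesis using sub len by blast
qed

text \<open>Both samples are good with probability at least \<open>1 - 2 k / m\<^sup>2\<close>, by a union bound. Both this and the bound \<open>k \<le> l\<close>
  rest on \<open>ln m \<ge> 1\<close>, that is, on \<open>m \<ge> 3\<close>; for \<open>m \<le> 2\<close> the claimed probability is not positive.\<close>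

theorem theorem3p1:
  shows "\<exists>c::real. 0 < c \<and>
    (\<forall>(m::nat) (n::nat) (k::nat) (l::nat) (\<mu>::real) (A::complex mat)
      X1 X2 Y1 Y2 A11 A12 A21 A22 rrqr \<epsilon>.
      n \<le> m \<longrightarrow> 0 < k \<longrightarrow> k \<le> n \<longrightarrow>
      A \<in> carrier_mat m n \<longrightarrow>
      X1 \<in> carrier_mat m k \<longrightarrow> X2 \<in> carrier_mat m (m - k) \<longrightarrow>
      Y1 \<in> carrier_mat n k \<longrightarrow> Y2 \<in> carrier_mat n (n - k) \<longrightarrow>
      unitary_mat m (hcat X1 X2) \<longrightarrow> unitary_mat n (hcat Y1 Y2) \<longrightarrow>
      A11 \<in> carrier_mat k k \<longrightarrow> A12 \<in> carrier_mat k (n - k) \<longrightarrow>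
      A21 \<in> carrier_mat (m - k) k \<longrightarrow> A22 \<in> carrier_mat (m - k) (n - k) \<longrightarrow>
      A = hcat X1 X2 * four_block_mat A11 A12 A21 A22 * mat_adjoint (hcat Y1 Y2) \<longrightarrow>
      \<epsilon> = spectral_norm (four_block_mat (0\<^sub>m k k) A12 A21 A22) \<longrightarrow>
      coherent \<mu> X1 \<longrightarrow> coherent \<mu> Y1 \<longrightarrow>
      10 * \<mu> * real k * ln (real m) \<le> real l \<longrightarrow>
      is_rrqr rrqr \<longrightarrow>
      measure_pmf.prob (pair_pmf (sample_indices l n) (sample_indices l m))
        {(C, R). case skeleton_algorithm rrqr k A C R of (C', Z, R') \<Rightarrow>
           length C' = k \<and> length R' = k \<and> set C' \<subseteq> set C \<and> set R' \<subseteq> set R \<and>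
           spectral_norm (A - cols_at A C' * Z * rows_at A R')
             \<le> c * (\<epsilon> * sqrt (real m * real k))}
      \<ge> 1 - 4 * real k / (real m)\<^sup>2)"
proof (rule exI[of _ 122], intro conjI allI impI)
  show "0 < (122 :: real)" by simp
  fix m n k l :: nat and \<mu> :: real and A X1 X2 Y1 Y2 A11 A12 A21 A22 :: "complex mat"
    and rrqr :: "nat \<Rightarrow> complex mat \<Rightarrow> nat list" and \<epsilon> :: real
  assume nm: "n \<le> m" and k: "0 < k" and kn: "k \<le> n" and A: "A \<in> carrier_mat m n"
    and X: "X1 \<in> carrier_mat m k" "X2 \<in> carrier_mat m (m - k)"
    and Y: "Y1 \<in> carrier_mat n k" "Y2 \<in> carrier_mat n (n - k)"
    and uX: "unitary_mat m (hcat X1 X2)" and uY: "unitary_mat n (hcat Y1 Y2)"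
    and F: "A11 \<in> carrier_mat k k" "A12 \<in> carrier_mat k (n - k)"
      "A21 \<in> carrier_mat (m - k) k" "A22 \<in> carrier_mat (m - k) (n - k)"
    and decomp: "A = hcat X1 X2 * four_block_mat A11 A12 A21 A22 * mat_adjoint (hcat Y1 Y2)"
    and \<epsilon>: "\<epsilon> = spectral_norm (four_block_mat (0\<^sub>m k k) A12 A21 A22)"
    and coh: "coherent \<mu> X1" "coherent \<mu> Y1"
    and l: "10 * \<mu> * real k * ln (real m) \<le> real l" and rrqr: "is_rrqr rrqr"
  define good where "good = {(C, R). case skeleton_algorithm rrqr k A C R of (C', Z, R') \<Rightarrow>
           length C' = k \<and> length R' = k \<and> set C' \<subseteq> set C \<and> set R' \<subseteq> set R \<and>
           spectral_norm (A - cols_at A C' * Z * rows_at A R')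
             \<le> 122 * (\<epsilon> * sqrt (real m * real k))}"
  define pC where "pC = sample_indices l n"
  define pR where "pR = sample_indices l m"
  have "1 - 4 * real k / (real m)\<^sup>2 \<le> measure_pmf.prob (pair_pmf pC pR) good"
  proof (cases "m \<le> 2")
    case True
    then have "m = 1 \<or> m = 2" using k kn nm by linarith
    then have "m * m \<le> 4 * k" using k by auto
    then have "real (m * m) \<le> real (4 * k)" by (simp only: of_nat_le_iff)
    then have "1 \<le> 4 * real k / (real m)\<^sup>2" using k kn nm by (simp add: power2_eq_square field_simps)
    then show ?thesis using measure_nonneg[of "measure_pmf (pair_pmf pC pR)" good] by linarith
  next
    case False
    then have m: "3 \<le> m" by simp
    have isoX: "mat_adjoint X1 * X1 = 1\<^sub>m k" and isoY: "mat_adjoint Y1 * Y1 = 1\<^sub>m k"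
      and cohX: "\<And>i j. i < m \<Longrightarrow> j < k \<Longrightarrow> cmod (X1 $$ (i, j)) \<le> sqrt (\<mu> / real m)"
      and cohY: "\<And>i j. i < n \<Longrightarrow> j < k \<Longrightarrow> cmod (Y1 $$ (i, j)) \<le> sqrt (\<mu> / real n)"
      using coh X Y by (auto simp: coherent_def)
    have \<mu>: "1 \<le> \<mu>" using coherence_ge_one[OF X(1) isoX k cohX] by blast
    have kl: "k \<le> l"
    proof -
      have "exp 1 \<le> real m" using exp_le m by linarith
      then have "1 \<le> ln (real m)" using m by (simp add: ln_ge_iff)
      then have "1 * 1 \<le> (10 * \<mu>) * ln (real m)" using \<mu> by (intro mult_mono) auto
      then have "real k * 1 \<le> real k * ((10 * \<mu>) * ln (real m))" by (intro mult_left_mono) auto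
      then have "real k \<le> real l" using l by (simp add: mult_ac)
      then show ?thesis by simp
    qed
    obtain D where D: "D \<in> carrier_mat m n" "A = X1 * A11 * mat_adjoint Y1 + D" "op_le D \<epsilon>"
      using leading_block_plus_small[OF X uX Y uY kn nm F decomp] by (auto simp: \<epsilon>)
    have \<epsilon>0: "0 \<le> \<epsilon>" by (simp add: \<epsilon> spectral_norm_nonneg)
    define badC where "badC = {C. \<exists>g \<in> carrier_vec k.
      (\<Sum>x\<leftarrow>C. (cmod ((Y1 *\<^sub>v g) $ x))\<^sup>2) < real l / (400 * real n) * (vec_norm2 g)\<^sup>2}"
    define badR where "badR = {R. \<exists>g \<in> carrier_vec k.
      (\<Sum>x\<leftarrow>R. (cmod ((X1 *\<^sub>v g) $ x))\<^sup>2) < real l / (400 * real m) * (vec_norm2 g)\<^sup>2}"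
    have PC: "measure_pmf.prob pC badC \<le> real k / (real m)\<^sup>2"
      unfolding pC_def badC_def by (rule sampled_rows_well_conditioned[OF Y(1) isoY k cohY l m])
    have PR: "measure_pmf.prob pR badR \<le> real k / (real m)\<^sup>2"
      unfolding pR_def badR_def by (rule sampled_rows_well_conditioned[OF X(1) isoX k cohX l m])
    have in_good: "(C, R) \<in> good"
      if CR: "C \<in> set_pmf pC" "R \<in> set_pmf pR" "C \<notin> badC" "R \<notin> badR" for C R
    proof -
      have C: "length C = l" "set C \<subseteq> {..<n}" and R: "length R = l" "set R \<subseteq> {..<m}"
        using CR set_sample_indices[of n C l] set_sample_indices[of m R l] k kn nm by (auto simp: pC_def pR_def)
      obtain C' Z R' where alg: "skeleton_algorithm rrqr k A C R = (C', Z, R')" by (metis prod_cases3)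
      have "length C' = k \<and> length R' = k \<and> set C' \<subseteq> set C \<and> set R' \<subseteq> set R \<and>
        spectral_norm (A - cols_at A C' * Z * rows_at A R') \<le> 122 * (\<epsilon> * sqrt (real m * real k))"
      proof (rule skeleton_error[OF A k C(2) _ R(2) _ nm X(1) isoX Y(1) isoY D(2) F(1) D(1,3) \<epsilon>0 _ _ rrqr alg])
        show "k \<le> length C" "k \<le> length R" using kl C R by auto
        show "real (length C) / (400 * real n) * (vec_norm2 g)\<^sup>2 \<le> (\<Sum>x\<leftarrow>C. (cmod ((Y1 *\<^sub>v g) $ x))\<^sup>2)"
          if "g \<in> carrier_vec k" for g using CR(3) that C by (auto simp: badC_def not_less)
        show "real (length R) / (400 * real m) * (vec_norm2 g)\<^sup>2 \<le> (\<Sum>x\<leftarrow>R. (cmod ((X1 *\<^sub>v g) $ x))\<^sup>2)"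
          if "g \<in> carrier_vec k" for g using CR(4) that R by (auto simp: badR_def not_less)
      qed
      then show ?thesis by (simp add: good_def alg)
    qed
    let ?P = "measure_pmf.prob (pair_pmf pC pR)"
    have "1 - ?P good = ?P (- good)"
      using measure_pmf.prob_compl[of good "pair_pmf pC pR"] by (simp add: Compl_eq_Diff_UNIV)
    also have "\<dots> \<le> ?P (fst -` badC \<union> snd -` badR)"
      by (rule measure_pmf.finite_measure_mono_AE) (use in_good in \<open>auto simp: AE_measure_pmf_iff\<close>)
    also have "\<dots> \<le> ?P (fst -` badC) + ?P (snd -` badR)"
      by (rule measure_subadditive) auto
    also have "?P (fst -` badC) = measure_pmf.prob pC badC"
      by (metis map_fst_pair_pmf measure_map_pmf)
    also have "?P (snd -` badR) = measure_pmf.prob pR badR"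
      by (metis map_snd_pair_pmf measure_map_pmf)
    finally have "1 - ?P good \<le> 2 * (real k / (real m)\<^sup>2)" using PC PR by linarith
    moreover have "2 * (real k / (real m)\<^sup>2) \<le> 4 * real k / (real m)\<^sup>2" by (simp add: divide_right_mono)
    ultimately show ?thesis by linarith
  qed
  then show "measure_pmf.prob (pair_pmf (sample_indices l n) (sample_indices l m))
        {(C, R). case skeleton_algorithm rrqr k A C R of (C', Z, R') \<Rightarrow>
           length C' = k \<and> length R' = k \<and> set C' \<subseteq> set C \<and> set R' \<subseteq> set R \<and>
           spectral_norm (A - cols_at A C' * Z * rows_at A R')
             \<le> 122 * (\<epsilon> * sqrt (real m * real k))}
      \<ge> 1 - 4 * real k / (real m)\<^sup>2"
    by (simp only: good_def pC_def pR_def)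
qed

end
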